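(* Let $\mathcal C$ be one of $\mathcal K^{N}_{\mathbf m,\mathbf p}$, $\mathcal K^{2,r}_{\mathbf m,\mathbf p}$ (with $N=2$), or ${}^c\mathcal K^{N,r}_{\mathbf m,\mathbf p}$ (for some $c>0$), and set $\nu=\sum_{i=1}^N m_ip_i$, $c_0=3$ if $\mathcal C=\mathcal K^N_{\mathbf m,\mathbf p}$; $\nu=2r(m_1p_1+m_2p_2+1)$, $c_0=9p$ if $\mathcal C=\mathcal K^{2,r}_{\mathbf m,\mathbf p}$; $\nu=r\sum_{i=1}^N m_ip_i$, $c_0=rc$ if $\mathcal C={}^c\mathcal K^{N,r}_{\mathbf m,\mathbf p}$. Fix $u>0$. Suppose $\mathbf D^0\in\mathcal C$, the coefficient, noise and parameter assumptions below hold, $\bar\lambda C_{\min}<\rho<\bar\lambda C_{\max}$ and $\frac{M_\epsilon}{M_x}<\frac72(\bar\lambda C_{\max}-\rho)$. Then there is a constant $C>0$ such that, if the number $L$ of independent samples satisfies $$\frac{L}{\log L}\ge Cp^2(\nu\log c_0+u)\frac{M_y^4}{\big(\rho(\rho-\bar\lambda C_{\min})s\,\mathbb E\{x^2\}\big)^2},$$ then with probability at least $1-e^{-u}$ the empirical risk $\mathbf D\in\mathcal C\mapsto F_{\mathbf Y}(\mathbf D)$ has a local minimizer $\mathbf D^*$ (relative to $\mathcal C$) with $\|\mathbf D^*-\mathbf D^0\|_F<\rho$.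
   Context: Let $N\ge2$, $m_n,p_n\ge1$, $m=\prod_n m_n$, $p=\prod_n p_n$. The oblique manifold $\mathcal D_{m\times p}$ is the set of $m\times p$ matrices with unit $\ell_2$-norm columns. The separation rank $\mathfrak R^N_{\mathbf m,\mathbf p}(\mathbf A)$ is the minimum $r$ with $\mathbf A=\sum_{k=1}^r\mathbf A^k_1\otimes\cdots\otimes\mathbf A^k_N$, $\mathbf A^k_n\in\mathbb R^{m_n\times p_n}$. $\mathcal K^{N,r}_{\mathbf m,\mathbf p}=\{\mathbf D\in\mathcal D_{m\times p}:\mathfrak R^N_{\mathbf m,\mathbf p}(\mathbf D)\le r\}$, $\mathcal K^N_{\mathbf m,\mathbf p}=\mathcal K^{N,1}_{\mathbf m,\mathbf p}$, $\mathcal K^{2,r}_{\mathbf m,\mathbf p}$ is the case $N=2$, and ${}^c\mathcal K^{N,r}_{\mathbf m,\mathbf p}$ is the set of $\mathbf D\in\mathcal D_{m\times p}$ expressible as $\sum_{k=1}^r\bigotimes_n\mathbf D^k_n$ with $\|\bigotimes_n\mathbf D^k_n\|_F\le c$ for all $k$. Generative model: samples $\mathbf y_l=\mathbf D^0\mathbf x^0_l+\boldsymbol\varepsilon_l\in\mathbb R^m$, $l\in[L]$, are independent copies of $\mathbf y=\mathbf D^0\mathbf x^0+\boldsymbol\varepsilon$, where a support $\mathcal J\subset[p]$ with $|\mathcal J|=s$ is chosen uniformly at random and $\mathbf x^0$ is supported on $\mathcal J$; $\mathbf s^0=\mathrm{sgn}(\mathbf x^0)$. Coefficient assumption: for a real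 random variable $x$ and constants $M_x,\underline x>0$: $\mathbb E\{\mathbf x^0_{\mathcal J}[\mathbf x^0_{\mathcal J}]^T|\mathcal J\}=\mathbb E\{x^2\}\mathbf I_s$, $\mathbb E\{\mathbf s^0_{\mathcal J}[\mathbf s^0_{\mathcal J}]^T|\mathcal J\}=\mathbf I_s$, $\mathbb E\{\mathbf s^0_{\mathcal J}[\mathbf x^0_{\mathcal J}]^T|\mathcal J\}=\mathbb E\{|x|\}\mathbf I_s$, $\|\mathbf x^0\|_2\le M_x$ and $\min_{j\in\mathcal J}|x^0_j|\ge\underline x$ a.s. Noise assumption: for a real random variable $\epsilon$ and $M_\epsilon>0$: $\mathbb E\{\boldsymbol\varepsilon\boldsymbol\varepsilon^T|\mathcal J\}=\mathbb E\{\epsilon^2\}\mathbf I_m$, $\mathbb E\{\mathbf x^0\boldsymbol\varepsilon^T|\mathcal J\}=\mathbb E\{\mathbf s^0\boldsymbol\varepsilon^T|\mathcal J\}=0$, $\|\boldsymbol\varepsilon\|_2\le M_\epsilon$ a.s. $M_y$ is a constant with $\|\mathbf y\|_2\le M_y$ a.s. Parameters: $\lambda>0$, $\bar\lambda=\lambda/\mathbb E\{|x|\}$, $C_{\min}=24\frac{\mathbb E\{|x|\}^2}{\mathbb E\{x^2\}}(\|\mathbf D^0\|_2+1)^2\frac sp\|[\mathbf D^0]^T\mathbf D^0-\mathbf I\|_F$, $C_{\max}=\frac{2\mathbb E\{|x|\}}{7M_x}(1-2\mu_s(\mathbf D^0))$, with cumulative coherence $\mu_s(\mathbf D)=\max_{|\mathcal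 J|\le s}\max_{j\notin\mathcal J}\|\mathbf D_{\mathcal J}^T\mathbf d_j\|_1$. Parameter assumption: $C_{\min}\le C_{\max}$, $\lambda\le\underline x/4$, $s\le\frac{p}{16(\|\mathbf D^0\|_2+1)^2}$, $\mu_s(\mathbf D^0)\le1/4$, $\frac{M_\epsilon}{M_x}<\frac72(C_{\max}-C_{\min})\bar\lambda$. Objective: $f_{\mathbf y}(\mathbf D)=\inf_{\mathbf x\in\mathbb R^p}\frac12\|\mathbf y-\mathbf D\mathbf x\|_2^2+\lambda\|\mathbf x\|_1$ and $F_{\mathbf Y}(\mathbf D)=\frac1L\sum_{l=1}^Lf_{\mathbf y_l}(\mathbf D)$. *)

theory Defs
  imports "HOL-Probability.Probability"
begin

text \<open>Matrices are represented as functions nat => nat => real; an m x p matrix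
  uses the entries with row index < m and column index < p. Vectors are nat => real.\<close>

type_synonym mat = "nat \<Rightarrow> nat \<Rightarrow> real"

text \<open>A sample of the generative model: (support J, coefficient vector x0, noise eps).\<close>
type_synonym sample = "nat set \<times> (nat \<Rightarrow> real) \<times> (nat \<Rightarrow> real)"

definition sample_space :: "sample measure" where
  "sample_space = count_space UNIV \<Otimes>\<^sub>M
     ((\<Pi>\<^sub>M i\<in>UNIV. (borel :: real measure)) \<Otimes>\<^sub>M (\<Pi>\<^sub>M i\<in>UNIV. (borel :: real measure)))"

definition kron2 :: "mat \<Rightarrow> nat \<Rightarrow> nat \<Rightarrow> mat \<Rightarrow> mat" where
  "kron2 A m2 p2 B = (\<lambda>i j. A (i div m2) (j div p2) * B (i mod m2) (j mod p2))"

fun kron_list :: "mat list \<Rightarrow> nat list \<Rightarrow> nat list \<Rightarrow> mat" where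
  "kron_list [] [] [] = (\<lambda>i j. 1)"
| "kron_list (A # As) (m # ms) (p # ps) =
     kron2 A (prod_list ms) (prod_list ps) (kron_list As ms ps)"
| "kron_list _ _ _ = (\<lambda>i j. 0)"

definition frob_norm :: "nat \<Rightarrow> nat \<Rightarrow> mat \<Rightarrow> real" where
  "frob_norm m p A = sqrt (\<Sum>i<m. \<Sum>j<p. (A i j)\<^sup>2)"

definition oblique :: "nat \<Rightarrow> nat \<Rightarrow> mat set" where
  "oblique m p = {D. (\<forall>i j. (m \<le> i \<or> p \<le> j) \<longrightarrow> D i j = 0) \<and>
                     (\<forall>j<p. (\<Sum>i<m. (D i j)\<^sup>2) = 1)}"

definition sep_rep :: "nat list \<Rightarrow> nat list \<Rightarrow> nat \<Rightarrow> mat \<Rightarrow> bool" where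
  "sep_rep ms ps r A \<longleftrightarrow> (\<exists>F :: nat \<Rightarrow> mat list.
     (\<forall>k<r. length (F k) = length ms) \<and>
     (\<forall>i<prod_list ms. \<forall>j<prod_list ps. A i j = (\<Sum>k<r. kron_list (F k) ms ps i j)))"

definition sep_rank :: "nat list \<Rightarrow> nat list \<Rightarrow> mat \<Rightarrow> nat" where
  "sep_rank ms ps A = (LEAST r. sep_rep ms ps r A)"

text \<open>K^{N,r}_{m,p}; K^N = K^{N,1}; K^{2,r} is the case N = 2.\<close>
definition K_set :: "nat list \<Rightarrow> nat list \<Rightarrow> nat \<Rightarrow> mat set" where
  "K_set ms ps r = {D \<in> oblique (prod_list ms) (prod_list ps). sep_rank ms ps D \<le> r}"

definition cK_set :: "nat list \<Rightarrow> nat list \<Rightarrow> nat \<Rightarrow> real \<Rightarrow> mat set" where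
  "cK_set ms ps r c = {D \<in> oblique (prod_list ms) (prod_list ps). \<exists>F :: nat \<Rightarrow> mat list.
     (\<forall>k<r. length (F k) = length ms \<and>
            frob_norm (prod_list ms) (prod_list ps) (kron_list (F k) ms ps) \<le> c) \<and>
     (\<forall>i<prod_list ms. \<forall>j<prod_list ps. D i j = (\<Sum>k<r. kron_list (F k) ms ps i j))}"

definition spec_norm :: "nat \<Rightarrow> nat \<Rightarrow> mat \<Rightarrow> real" where
  "spec_norm m p A = Sup {sqrt (\<Sum>i<m. (\<Sum>j<p. A i j * x j)\<^sup>2) | x. (\<Sum>j<p. (x j)\<^sup>2) \<le> 1}"

definition gram_dev :: "nat \<Rightarrow> nat \<Rightarrow> mat \<Rightarrow> real" where
  "gram_dev m p D = sqrt (\<Sum>i<p. \<Sum>j<p.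
      ((\<Sum>k<m. D k i * D k j) - (if i = j then 1 else 0))\<^sup>2)"

definition cum_coherence :: "nat \<Rightarrow> nat \<Rightarrow> nat \<Rightarrow> mat \<Rightarrow> real" where
  "cum_coherence m p s D = Max {(\<Sum>i\<in>J. \<bar>\<Sum>k<m. D k i * D k j\<bar>) | J j.
      J \<subseteq> {..<p} \<and> card J \<le> s \<and> j < p \<and> j \<notin> J}"

definition lasso_obj :: "nat \<Rightarrow> nat \<Rightarrow> real \<Rightarrow> (nat \<Rightarrow> real) \<Rightarrow> mat \<Rightarrow> real" where
  "lasso_obj m p lam y D = (INF x :: nat \<Rightarrow> real.
      (1/2) * (\<Sum>i<m. (y i - (\<Sum>j<p. D i j * x j))\<^sup>2) + lam * (\<Sum>j<p. \<bar>x j\<bar>))"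

definition emp_risk :: "nat \<Rightarrow> nat \<Rightarrow> real \<Rightarrow> nat \<Rightarrow> (nat \<Rightarrow> nat \<Rightarrow> real) \<Rightarrow> mat \<Rightarrow> real" where
  "emp_risk m p lam L Y D = (1 / real L) * (\<Sum>l<L. lasso_obj m p lam (Y l) D)"

definition sample_y :: "nat \<Rightarrow> mat \<Rightarrow> sample \<Rightarrow> nat \<Rightarrow> real" where
  "sample_y p D0 \<omega> = (\<lambda>i. (\<Sum>j<p. D0 i j * fst (snd \<omega>) j) + snd (snd \<omega>) i)"

definition cond_exp :: "'a measure \<Rightarrow> 'a set \<Rightarrow> ('a \<Rightarrow> real) \<Rightarrow> real" where
  "cond_exp M A f = (\<integral>\<omega>. indicator A \<omega> * f \<omega> \<partial>M) / measure M A"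

definition local_min_on :: "nat \<Rightarrow> nat \<Rightarrow> mat set \<Rightarrow> (mat \<Rightarrow> real) \<Rightarrow> mat \<Rightarrow> bool" where
  "local_min_on m p C F D \<longleftrightarrow> D \<in> C \<and>
     (\<exists>\<epsilon>>0. \<forall>D'\<in>C. frob_norm m p (\<lambda>i j. D' i j - D i j) < \<epsilon> \<longrightarrow> F D \<le> F D')"

definition C_min :: "real \<Rightarrow> real \<Rightarrow> nat \<Rightarrow> nat \<Rightarrow> nat \<Rightarrow> mat \<Rightarrow> real" where
  "C_min Eabs Ex2 s m p D0 = 24 * (Eabs\<^sup>2 / Ex2) * (spec_norm m p D0 + 1)\<^sup>2
      * (real s / real p) * gram_dev m p D0"

definition C_max :: "real \<Rightarrow> real \<Rightarrow> nat \<Rightarrow> nat \<Rightarrow> nat \<Rightarrow> mat \<Rightarrow> real" where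
  "C_max Eabs Mx s m p D0 = (2 * Eabs / (7 * Mx)) * (1 - 2 * cum_coherence m p s D0)"

end

theory Submission
  imports Defs
begin

text \<open>
  Fix a support \<open>J\<close> with signs \<open>s\<close> and put \<open>G = D\<^sub>J\<^sup>T D\<^sub>J\<close>, \<open>b = D\<^sub>J\<^sup>T y - \<lambda> s\<close>. The residual of
  \<open>G\<^sup>-\<^sup>1 b\<close> is dual feasible for the lasso, so \<open>f\<^sub>y(D) \<ge> \<parallel>y\<parallel>\<^sup>2/2 - b\<^sup>T G\<^sup>-\<^sup>1 b/2\<close>, and at \<open>D\<^sup>0\<close> sign
  consistency of the primal point gives the reverse inequality. The moment assumptions turn the expected
  difference into traces of Gram matrices; averaging over the supports yields
  \<open>E f\<^sub>y(D) - E f\<^sub>y(D\<^sup>0) \<ge> (E x\<^sup>2 s / 8p) \<rho> (\<rho> - \<lambda> C\<^sub>m\<^sub>i\<^sub>n / E|x|)\<close> on the sphere of radius \<open>\<rho>\<close>. Hoeffding's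
  inequality on a net of the sphere inside the constraint set, together with the Lipschitz continuity of
  \<open>f\<^sub>y\<close>, makes the empirical risk on the sphere larger than at \<open>D\<^sup>0\<close>. As the constraint set is compact, the
  minimum over the ball is attained, necessarily in the interior.\<close>

section \<open>Linear algebra over finite index sets\<close>

text \<open>The gap is positive because diagonal and off-diagonal terms carry different weights. The
  gain \<open>Ex2 * \<rho>^2 / 2\<close> sits on the diagonal: unit columns force
  \<open><d_k, \<delta>_k> = - |\<delta>_k|^2 / 2\<close>. The errors are products of Frobenius
  norms of off-diagonal parts, and a pair of indices belongs to a random support with frequency at
  most \<open>(s / p)^2\<close>, against \<open>s / p\<close> for a single index. The spare factor
  \<open>s / p\<close> absorbs the squared operator norm \<open>B^2\<close>,
  \<open>B = |D0| + 1\<close>, through the sparsity assumption. Products of norms do not average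
  over supports, so they are first split into sums of squares. The error linear in the Gram
  deviation g of \<open>D0\<close> is at most
  \<open>3 * lam * Eabs * B^2 * (s / p)^2 * g * \<rho>\<close>; the 24 in \<open>C_min\<close> is
  this 3 divided by the 1/8 that survives of the gain. The logarithm of L is the price of the net:
  its mesh is never finer than \<open>1 / L\<close>, so the logarithm of its size is of order
  \<open>\<nu> * log c0 * log L\<close>.\<close>

definition dot :: "'a set \<Rightarrow> ('a \<Rightarrow> real) \<Rightarrow> ('a \<Rightarrow> real) \<Rightarrow> real" where
  "dot J u v = (\<Sum>i\<in>J. u i * v i)"

definition app :: "'a set \<Rightarrow> ('b \<Rightarrow> 'a \<Rightarrow> real) \<Rightarrow> ('a \<Rightarrow> real) \<Rightarrow> 'b \<Rightarrow> real" where
  "app J A u = (\<lambda>i. \<Sum>j\<in>J. A i j * u j)"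

lemma dot_commute: "dot J u v = dot J v u"
  by (simp add: dot_def mult.commute)

lemma dot_self: "dot J u u = (\<Sum>i\<in>J. (u i)\<^sup>2)"
  by (simp add: dot_def power2_eq_square)

lemma dot_self_nonneg [simp]: "0 \<le> dot J u u"
  by (simp add: dot_self sum_nonneg)

lemma dot_cong: "(\<And>i. i \<in> J \<Longrightarrow> u i = u' i) \<Longrightarrow> (\<And>i. i \<in> J \<Longrightarrow> v i = v' i) \<Longrightarrow> dot J u v = dot J u' v'"
  by (auto simp: dot_def intro: sum.cong)

lemma dot_add_left: "dot J (\<lambda>i. u i + v i) w = dot J u w + dot J v w"
  by (simp add: dot_def algebra_simps sum.distrib)

lemma dot_add_right: "dot J w (\<lambda>i. u i + v i) = dot J w u + dot J w v"
  by (simp add: dot_def algebra_simps sum.distrib)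

lemma dot_diff_left: "dot J (\<lambda>i. u i - v i) w = dot J u w - dot J v w"
  by (simp add: dot_def algebra_simps sum_subtractf)

lemma dot_diff_right: "dot J w (\<lambda>i. u i - v i) = dot J w u - dot J w v"
  by (simp add: dot_def algebra_simps sum_subtractf)

lemma dot_scale_left: "dot J (\<lambda>i. c * u i) w = c * dot J u w"
  by (simp add: dot_def algebra_simps sum_distrib_left)

lemma dot_scale_right: "dot J w (\<lambda>i. c * u i) = c * dot J w u"
  by (simp add: dot_def algebra_simps sum_distrib_left)

lemmas dot_linear = dot_add_left dot_add_right dot_diff_left dot_diff_right dot_scale_left dot_scale_right

lemma dot_Cauchy_Schwarz: "(dot J u v)\<^sup>2 \<le> dot J u u * dot J v v"
  using Cauchy_Schwarz_ineq_sum[of u v J] by (simp add: dot_def power2_eq_square)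

lemma abs_dot_le_sqrt: "\<bar>dot J u v\<bar> \<le> sqrt (dot J u u) * sqrt (dot J v v)"
  using dot_Cauchy_Schwarz[of J u v] by (metis real_sqrt_abs real_sqrt_le_mono real_sqrt_mult)

lemma L2_set_dot: "L2_set u J = sqrt (dot J u u)"
  by (simp add: L2_set_def dot_self)

lemma app_linear:
  "app J A (\<lambda>j. u j + v j) i = app J A u i + app J A v i"
  "app J A (\<lambda>j. u j - v j) i = app J A u i - app J A v i"
  "app J A (\<lambda>j. c * u j) i = c * app J A u i"
  by (simp_all add: app_def algebra_simps sum.distrib sum_subtractf sum_distrib_left)

lemma app_cong: "(\<And>i. i \<in> J \<Longrightarrow> u i = v i) \<Longrightarrow> app J A u = app J A v"
  by (auto simp: app_def intro!: sum.cong)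

lemma dot_app_transpose: "dot I u (app J A v) = dot J (app I (\<lambda>j i. A i j) u) v"
  unfolding dot_def app_def sum_distrib_left sum_distrib_right
  by (subst sum.swap) (simp add: mult_ac)

lemma dot_app_sym:
  assumes "\<And>i j. i \<in> J \<Longrightarrow> j \<in> J \<Longrightarrow> A i j = A j i"
  shows "dot J u (app J A v) = dot J (app J A u) v"
  unfolding dot_app_transpose using assms by (auto simp: app_def intro!: dot_cong sum.cong)

text \<open>Gaussian elimination, one index at a time. Positive definiteness gives a positive pivot,
  and the quadratic form of the Schur complement at \<open>v\<close> is the form of \<open>G\<close>
  at a suitable extension of \<open>v\<close>, so the induction hypothesis applies to the
  complement.\<close>

lemma pos_def_solvable:
  fixes G :: "'a \<Rightarrow> 'a \<Rightarrow> real"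
  assumes "finite J"
    and "\<And>v. (\<exists>i\<in>J. v i \<noteq> 0) \<Longrightarrow> dot J v (app J G v) > 0"
  shows "\<exists>v. \<forall>i\<in>J. app J G v i = b i"
  using assms
proof (induction J arbitrary: G b rule: finite_induct)
  case empty
  then show ?case by simp
next
  case (insert a J)
  have J: "finite J" "a \<notin> J" by fact+
  have expand: "dot (insert a J) w (app (insert a J) G w) =
     w a * w a * G a a + w a * (\<Sum>k\<in>J. G a k * w k) + w a * (\<Sum>i\<in>J. w i * G i a)
     + dot J w (app J G w)" for w
    using J by (simp add: dot_def app_def algebra_simps sum.distrib sum_distrib_left)
  have gaa: "G a a > 0"
  proof -
    have "dot (insert a J) (\<lambda>i. if i = a then 1 else 0) (app (insert a J) G (\<lambda>i. if i = a then 1 else 0)) > 0"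
      by (rule insert.prems) auto
    moreover have "dot J (\<lambda>i. if i = a then 1 else 0) (app J G (\<lambda>i. if i = a then 1 else 0)) = 0"
      unfolding dot_def using J by (intro sum.neutral) auto
    moreover have "(\<Sum>k\<in>J. G a k * (if k = a then 1 else 0)) = 0" "(\<Sum>k\<in>J. (if k = a then 1 else 0) * G k a) = 0"
      using J by (auto intro!: sum.neutral)
    ultimately show ?thesis unfolding expand by simp
  qed
  \<comment> \<open>Schur complement of the pivot \<open>a\<close>\<close>
  define G' where "G' = (\<lambda>i k. G i k - G i a * G a k / G a a)"
  have G'app: "app J G' v i = app J G v i - G i a * (\<Sum>k\<in>J. G a k * v k) / G a a" for v i
    by (simp add: app_def G'_def algebra_simps sum_subtractf sum_distrib_left sum_divide_distrib)
  have "dot J v (app J G' v) > 0" if v: "\<exists>i\<in>J. v i \<noteq> 0" for v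
  proof -
    \<comment> \<open>This entry at the pivot makes row \<open>a\<close> of the product of
      \<open>G\<close> and \<open>w\<close> vanish, so the form of \<open>G\<close> at
      \<open>w\<close> collapses to that of \<open>G'\<close> at \<open>v\<close>.\<close>
    define w where "w = v(a := - (\<Sum>k\<in>J. G a k * v k) / G a a)"
    have wJ: "w i = v i" if "i \<in> J" for i using that J by (auto simp: w_def)
    have "dot (insert a J) w (app (insert a J) G w) > 0"
      using v wJ by (intro insert.prems) (metis insertCI)
    moreover have "(\<Sum>k\<in>J. G a k * w k) = (\<Sum>k\<in>J. G a k * v k)" "(\<Sum>i\<in>J. w i * G i a) = (\<Sum>i\<in>J. v i * G i a)"
      "dot J w (app J G w) = dot J v (app J G v)"
      using wJ by (auto intro!: sum.cong dot_cong simp: app_def)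
    moreover have "dot J v (app J G' v) = dot J v (app J G v) - (\<Sum>i\<in>J. v i * G i a) * (\<Sum>k\<in>J. G a k * v k) / G a a"
      unfolding G'app dot_diff_right
      by (simp add: dot_def sum_distrib_right sum_divide_distrib mult_ac)
    moreover have "w a = - (\<Sum>k\<in>J. G a k * v k) / G a a" by (simp add: w_def)
    ultimately have "0 < G a a * dot J v (app J G' v)" unfolding expand using gaa
      by (simp add: field_simps)
    then show ?thesis using gaa by (simp add: zero_less_mult_iff)
  qed
  from insert.IH[OF this, of "\<lambda>i. b i - G i a * b a / G a a"]
  obtain v where v: "\<And>i. i \<in> J \<Longrightarrow> app J G' v i = b i - G i a * b a / G a a" by auto
  define w where "w = v(a := (b a - (\<Sum>k\<in>J. G a k * v k)) / G a a)"
  have wJ: "w i = v i" if "i \<in> J" for i using that J by (auto simp: w_def)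
  have appw: "app (insert a J) G w i = G i a * w a + app J G v i" for i
    using J wJ by (simp add: app_def)
  have "app (insert a J) G w i = b i" if "i \<in> insert a J" for i
  proof (cases "i = a")
    case True
    show ?thesis unfolding True appw using gaa by (simp add: w_def app_def)
  next
    case False
    with that have i: "i \<in> J" by simp
    show ?thesis unfolding appw using v[OF i, unfolded G'app] gaa
      by (simp add: w_def field_simps)
  qed
  then show ?case by blast
qed

text \<open>A Schur test: each product \<open>v i * v j\<close> is split into half the sum of the
  squares, and by symmetry both halves add up to the same weighted row sum.\<close>

lemma quadratic_form_le_row_sum:
  assumes fin: "finite J"
    and sym: "\<And>i j. i \<in> J \<Longrightarrow> j \<in> J \<Longrightarrow> A i j = A j i"
    and row: "\<And>i. i \<in> J \<Longrightarrow> (\<Sum>j\<in>J. \<bar>A i j\<bar>) \<le> \<mu>"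
  shows "\<bar>dot J v (app J A v)\<bar> \<le> \<mu> * dot J v v"
proof -
  have "\<bar>dot J v (app J A v)\<bar> \<le> (\<Sum>i\<in>J. \<Sum>j\<in>J. \<bar>v i * (A i j * v j)\<bar>)"
    unfolding dot_def app_def sum_distrib_left
    by (intro order.trans[OF sum_abs] sum_mono order_refl)
  also have "\<dots> \<le> (\<Sum>i\<in>J. \<Sum>j\<in>J. \<bar>A i j\<bar> * ((v i)\<^sup>2 / 2) + \<bar>A i j\<bar> * ((v j)\<^sup>2 / 2))"
  proof (intro sum_mono)
    fix i j
    have "0 \<le> (\<bar>v i\<bar> - \<bar>v j\<bar>)\<^sup>2" by simp
    then have "\<bar>v i\<bar> * \<bar>v j\<bar> \<le> (v i)\<^sup>2 / 2 + (v j)\<^sup>2 / 2" by (simp add: power2_diff)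
    then have "\<bar>A i j\<bar> * (\<bar>v i\<bar> * \<bar>v j\<bar>) \<le> \<bar>A i j\<bar> * ((v i)\<^sup>2 / 2 + (v j)\<^sup>2 / 2)"
      by (intro mult_left_mono) auto
    then show "\<bar>v i * (A i j * v j)\<bar> \<le> \<bar>A i j\<bar> * ((v i)\<^sup>2 / 2) + \<bar>A i j\<bar> * ((v j)\<^sup>2 / 2)"
      by (simp add: abs_mult algebra_simps)
  qed
  also have "\<dots> = (\<Sum>i\<in>J. \<Sum>j\<in>J. \<bar>A i j\<bar> * ((v i)\<^sup>2 / 2)) + (\<Sum>i\<in>J. \<Sum>j\<in>J. \<bar>A i j\<bar> * ((v j)\<^sup>2 / 2))"
    by (simp add: sum.distrib)
  also have "(\<Sum>i\<in>J. \<Sum>j\<in>J. \<bar>A i j\<bar> * ((v j)\<^sup>2 / 2)) = (\<Sum>i\<in>J. \<Sum>j\<in>J. \<bar>A i j\<bar> * ((v i)\<^sup>2 / 2))"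
    by (subst sum.swap) (auto intro!: sum.cong simp: sym)
  also have "(\<Sum>i\<in>J. \<Sum>j\<in>J. \<bar>A i j\<bar> * ((v i)\<^sup>2 / 2)) + (\<Sum>i\<in>J. \<Sum>j\<in>J. \<bar>A i j\<bar> * ((v i)\<^sup>2 / 2))
      = (\<Sum>i\<in>J. (\<Sum>j\<in>J. \<bar>A i j\<bar>) * (v i)\<^sup>2)"
    by (simp add: sum.distrib[symmetric] sum_distrib_right)
  also have "\<dots> \<le> (\<Sum>i\<in>J. \<mu> * (v i)\<^sup>2)"
    by (intro sum_mono mult_right_mono row) auto
  finally show ?thesis by (simp add: dot_self sum_distrib_left)
qed

text \<open>A unit-diagonal symmetric matrix, strictly diagonally dominant on the index set \<open>J\<close>, with its inverse
  \<open>H\<close> on \<open>J\<close>; entries of \<open>G\<close> and \<open>H\<close> outside \<open>J \<times> J\<close> are irrelevant.\<close>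

locale gram_inverse =
  fixes J :: "'a set" and G H :: "'a \<Rightarrow> 'a \<Rightarrow> real" and \<mu> :: real
  assumes fin: "finite J"
    and symG: "\<And>i j. i \<in> J \<Longrightarrow> j \<in> J \<Longrightarrow> G i j = G j i"
    and diagG: "\<And>i. i \<in> J \<Longrightarrow> G i i = 1"
    and rowG: "\<And>i. i \<in> J \<Longrightarrow> (\<Sum>j\<in>J - {i}. \<bar>G i j\<bar>) \<le> \<mu>"
    and mu: "\<mu> < 1"
    and GH: "\<And>i j. i \<in> J \<Longrightarrow> j \<in> J \<Longrightarrow> (\<Sum>k\<in>J. G i k * H k j) = of_bool (i = j)"

text \<open>Gershgorin's bound in the language of quadratic forms: the row sum test is applied to
  \<open>G\<close> minus the identity, whose diagonal vanishes.\<close>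

lemma gram_coercive:
  fixes G :: "'a \<Rightarrow> 'a \<Rightarrow> real"
  assumes fin: "finite J"
    and symG: "\<And>i j. i \<in> J \<Longrightarrow> j \<in> J \<Longrightarrow> G i j = G j i"
    and diagG: "\<And>i. i \<in> J \<Longrightarrow> G i i = 1"
    and rowG: "\<And>i. i \<in> J \<Longrightarrow> (\<Sum>j\<in>J - {i}. \<bar>G i j\<bar>) \<le> \<mu>"
  shows "(1 - \<mu>) * dot J v v \<le> dot J v (app J G v)" "dot J v (app J G v) \<le> (1 + \<mu>) * dot J v v"
proof -
  define E where "E = (\<lambda>i j. G i j - of_bool (i = j))"
  have "\<bar>dot J v (app J E v)\<bar> \<le> \<mu> * dot J v v"
  proof (rule quadratic_form_le_row_sum[OF fin])
    fix i assume i: "i \<in> J"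
    have "(\<Sum>j\<in>J. \<bar>E i j\<bar>) = \<bar>E i i\<bar> + (\<Sum>j\<in>J - {i}. \<bar>E i j\<bar>)"
      by (rule sum.remove) (use fin i in auto)
    also have "\<dots> = (\<Sum>j\<in>J - {i}. \<bar>G i j\<bar>)"
    proof -
      have "\<bar>E i j\<bar> = \<bar>G i j\<bar>" if "j \<in> J - {i}" for j using that by (cases "i = j") (auto simp: E_def)
      then show ?thesis using i diagG by (simp add: E_def)
    qed
    finally show "(\<Sum>j\<in>J. \<bar>E i j\<bar>) \<le> \<mu>" using rowG[OF i] by simp
  qed (auto simp: E_def symG)
  moreover have "dot J v (app J G v) = dot J v v + dot J v (app J E v)"
  proof -
    have "app J G v i = v i + app J E v i" if "i \<in> J" for i
    proof -
      have "app J G v i = (\<Sum>j\<in>J. of_bool (i = j) * v j) + app J E v i"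
        unfolding app_def sum.distrib[symmetric] by (auto intro!: sum.cong simp: E_def algebra_simps)
      also have "(\<Sum>j\<in>J. of_bool (i = j) * v j) = (\<Sum>j\<in>J. if i = j then v j else 0)"
        by (intro sum.cong) auto
      also have "\<dots> = v i" using that fin by simp
      finally show ?thesis .
    qed
    then show ?thesis by (subst dot_cong[of J v v "app J G v" "\<lambda>i. v i + app J E v i"]) (auto simp: dot_linear)
  qed
  ultimately show "(1 - \<mu>) * dot J v v \<le> dot J v (app J G v)" "dot J v (app J G v) \<le> (1 + \<mu>) * dot J v v"
    by (auto simp: algebra_simps)
qed

lemma gram_inverse_exists:
  fixes G :: "'a \<Rightarrow> 'a \<Rightarrow> real"
  assumes fin: "finite J"
    and symG: "\<And>i j. i \<in> J \<Longrightarrow> j \<in> J \<Longrightarrow> G i j = G j i"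
    and diagG: "\<And>i. i \<in> J \<Longrightarrow> G i i = 1"
    and rowG: "\<And>i. i \<in> J \<Longrightarrow> (\<Sum>j\<in>J - {i}. \<bar>G i j\<bar>) \<le> \<mu>"
    and mu: "\<mu> < 1"
  shows "\<exists>H. gram_inverse J G H \<mu>"
proof -
  have "\<exists>v. \<forall>i\<in>J. app J G v i = b i" for b
  proof (rule pos_def_solvable[OF fin])
    fix v :: "'a \<Rightarrow> real" assume "\<exists>i\<in>J. v i \<noteq> 0"
    then obtain i where i: "i \<in> J" "v i \<noteq> 0" by blast
    have "0 < (v i)\<^sup>2" using i by simp
    also have "\<dots> \<le> dot J v v" unfolding dot_self using fin i by (intro member_le_sum) auto
    finally have "0 < (1 - \<mu>) * dot J v v" using mu by simp
    also have "\<dots> \<le> dot J v (app J G v)" by (rule gram_coercive[OF fin symG diagG rowG]) auto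
    finally show "0 < dot J v (app J G v)" .
  qed
  from this[of "\<lambda>i. of_bool (i = _)"] obtain V where "\<And>j. \<forall>i\<in>J. app J G (V j) i = of_bool (i = j)" by metis
  then have "gram_inverse J G (\<lambda>k j. V j k) \<mu>"
    using assms by unfold_locales (auto simp: app_def)
  then show ?thesis by blast
qed

context gram_inverse
begin

lemma delta_sum: "i \<in> J \<Longrightarrow> (\<Sum>j\<in>J. of_bool (i = j) * f j) = f i"
  and delta_sum': "i \<in> J \<Longrightarrow> (\<Sum>j\<in>J. f j * of_bool (j = i)) = (f i :: real)"
  using fin by (auto simp: of_bool_def if_distrib if_distribR sum.delta sum.delta' cong: if_cong)

text \<open>\<open>GH\<close> provides only a right inverse. Inserting the identity as
  \<open>G H\<close> shows that \<open>H\<close> equals its transpose times \<open>G\<close> times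
  \<open>H\<close>, which is symmetric; symmetry then turns the right inverse into a left
  one.\<close>

lemma symH: "i \<in> J \<Longrightarrow> j \<in> J \<Longrightarrow> H i j = H j i"
proof -
  assume ij: "i \<in> J" "j \<in> J"
  have "H i j = (\<Sum>l\<in>J. (\<Sum>k\<in>J. G l k * H k i) * H l j)"
    using ij by (simp add: GH delta_sum' mult.commute cong: sum.cong)
  also have "\<dots> = (\<Sum>k\<in>J. H k i * (\<Sum>l\<in>J. G k l * H l j))"
    unfolding sum_distrib_left sum_distrib_right
    by (subst sum.swap) (auto intro!: sum.cong simp: symG)
  also have "\<dots> = H j i" using ij by (simp add: GH delta_sum')
  finally show ?thesis .
qed

lemma HG: "i \<in> J \<Longrightarrow> j \<in> J \<Longrightarrow> (\<Sum>k\<in>J. H i k * G k j) = of_bool (i = j)"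
  using GH[of j i] by (auto simp: symH symG mult.commute cong: sum.cong)

lemma app_GH: "i \<in> J \<Longrightarrow> app J G (app J H u) i = u i"
proof -
  assume i: "i \<in> J"
  have "app J G (app J H u) i = (\<Sum>j\<in>J. (\<Sum>k\<in>J. G i k * H k j) * u j)"
    unfolding app_def sum_distrib_left sum_distrib_right
    by (subst sum.swap) (simp add: mult_ac)
  then show ?thesis using i by (simp add: GH delta_sum)
qed

lemma app_HG: "i \<in> J \<Longrightarrow> app J H (app J G u) i = u i"
proof -
  assume i: "i \<in> J"
  have "app J H (app J G u) i = (\<Sum>j\<in>J. (\<Sum>k\<in>J. H i k * G k j) * u j)"
    unfolding app_def sum_distrib_left sum_distrib_right
    by (subst sum.swap) (simp add: mult_ac)
  then show ?thesis using i by (simp add: HG delta_sum)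
qed

lemmas coercive = gram_coercive[OF fin symG diagG rowG]

text \<open>Everything comes from \<open>w = H u\<close>: coercivity of \<open>G\<close> at
  \<open>w\<close> reads \<open>(1 - \<mu>) |w|^2 \<le> <u, w>\<close>, and Cauchy-Schwarz converts
  this into bounds by \<open>|u|\<close>. In particular \<open>H\<close> has operator norm at most
  \<open>1 / (1 - \<mu>)\<close>.\<close>

lemma H_nonneg: "0 \<le> dot J u (app J H u)"
  and H_norm: "(1 - \<mu>)\<^sup>2 * dot J (app J H u) (app J H u) \<le> dot J u u"
  and H_form: "(1 - \<mu>) * dot J u (app J H u) \<le> dot J u u"
proof -
  define w where "w = app J H u"
  have wu: "dot J w (app J G w) = dot J u w"
    unfolding w_def by (subst dot_commute) (auto intro!: dot_cong simp: app_GH)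
  have c: "(1 - \<mu>) * dot J w w \<le> dot J u w" using coercive(1)[of w] wu by simp
  then show n: "0 \<le> dot J u (app J H u)" using mu unfolding w_def
    by (meson diff_ge_0_iff_ge dot_self_nonneg less_imp_le mult_nonneg_nonneg order.trans)
  have cs: "(dot J u w)\<^sup>2 \<le> dot J u u * dot J w w" by (rule dot_Cauchy_Schwarz)
  show "(1 - \<mu>) * dot J u (app J H u) \<le> dot J u u"
  proof (cases "dot J u w = 0")
    case False
    then have pos: "dot J u w > 0" using n by (simp add: w_def)
    have "(1 - \<mu>) * (dot J u w)\<^sup>2 \<le> dot J u u * ((1 - \<mu>) * dot J w w)"
      using cs mu by (simp add: mult.left_commute mult_left_mono)
    also have "\<dots> \<le> dot J u u * dot J u w" using c by (intro mult_left_mono) auto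
    finally show ?thesis using pos by (simp add: power2_eq_square w_def)
  qed (simp add: w_def)
  then have "(1 - \<mu>) * ((1 - \<mu>) * dot J w w) \<le> dot J u u"
    using c mu by (smt (verit) mult_left_mono w_def)
  then show "(1 - \<mu>)\<^sup>2 * dot J (app J H u) (app J H u) \<le> dot J u u"
    by (simp add: w_def power2_eq_square mult.assoc)
qed

text \<open>The maximum norm bound for inverses of diagonally dominant matrices: at an index where
  \<open>w = H u\<close> is largest, the off-diagonal part of \<open>G w = u\<close> can cancel at
  most the fraction \<open>\<mu>\<close> of the diagonal part.\<close>

lemma H_sup:
  assumes "i \<in> J" "\<And>j. j \<in> J \<Longrightarrow> \<bar>u j\<bar> \<le> c"
  shows "(1 - \<mu>) * \<bar>app J H u i\<bar> \<le> c"
proof -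
  define w where "w = app J H u"
  define M where "M = Max ((\<lambda>j. \<bar>w j\<bar>) ` J)"
  have M: "\<bar>w j\<bar> \<le> M" if "j \<in> J" for j unfolding M_def using fin that by auto
  have "M \<in> (\<lambda>j. \<bar>w j\<bar>) ` J" unfolding M_def using fin assms by (intro Max_in) auto
  then obtain k where k: "k \<in> J" "M = \<bar>w k\<bar>" by blast
  have "u k = app J G w k" using k by (simp add: w_def app_GH)
  also have "\<dots> = w k + (\<Sum>j\<in>J - {k}. G k j * w j)"
    unfolding app_def by (subst sum.remove[OF fin k(1)]) (simp add: diagG k)
  finally have "\<bar>w k\<bar> \<le> \<bar>u k\<bar> + \<bar>\<Sum>j\<in>J - {k}. G k j * w j\<bar>" by simp
  also have "\<bar>\<Sum>j\<in>J - {k}. G k j * w j\<bar> \<le> (\<Sum>j\<in>J - {k}. \<bar>G k j\<bar> * M)"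
    by (intro order.trans[OF sum_abs] sum_mono) (auto simp: abs_mult intro!: mult_left_mono M)
  also have "\<dots> \<le> \<mu> * M" unfolding sum_distrib_right[symmetric]
    using k by (intro mult_right_mono rowG) auto
  finally have "(1 - \<mu>) * M \<le> c" using assms(2)[OF k(1)] k by (simp add: algebra_simps)
  moreover have "(1 - \<mu>) * \<bar>w i\<bar> \<le> (1 - \<mu>) * M" using mu M assms by (intro mult_left_mono) auto
  ultimately show ?thesis by (simp add: w_def)
qed

lemma H_entry: "i \<in> J \<Longrightarrow> 0 \<le> H i i \<and> (1 - \<mu>) * H i i \<le> 1"
proof -
  assume i: "i \<in> J"
  define e :: "'a \<Rightarrow> real" where "e = (\<lambda>j. of_bool (j = i))"
  have "app J H e j = H j i" for j using i by (simp add: app_def e_def delta_sum')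
  then have "dot J e (app J H e) = H i i" "dot J e e = 1"
    using delta_sum'[OF i, of "\<lambda>j. H j i"] delta_sum'[OF i, of "\<lambda>j. of_bool (j = i)"]
    by (simp_all add: dot_def e_def mult.commute)
  then show ?thesis using H_nonneg[of e] H_form[of e] by simp
qed

text \<open>\<open>H_norm\<close> applied to column \<open>j\<close> of \<open>G - I\<close>, since
  \<open>H (G - I) = - (H - I)\<close>. This makes the off-diagonal part of \<open>H\<close> first
  order in that of \<open>G\<close>.\<close>

lemma H_minus_id:
  assumes "j \<in> J"
  shows "(1 - \<mu>)\<^sup>2 * (\<Sum>i\<in>J. (H i j - of_bool (i = j))\<^sup>2) \<le> (\<Sum>i\<in>J. (G i j - of_bool (i = j))\<^sup>2)"
proof -
  define e where "e = (\<lambda>i. G i j - of_bool (i = j))"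
  have "app J H e i = - (H i j - of_bool (i = j))" if "i \<in> J" for i
  proof -
    have "app J H e i = (\<Sum>k\<in>J. H i k * G k j) - (\<Sum>k\<in>J. H i k * of_bool (k = j))"
      by (simp add: app_def e_def algebra_simps sum_subtractf)
    then show ?thesis using that assms by (simp add: HG delta_sum')
  qed
  then have "dot J (app J H e) (app J H e) = (\<Sum>i\<in>J. (H i j - of_bool (i = j))\<^sup>2)"
    unfolding dot_self by (intro sum.cong) (auto simp: power2_commute)
  then show ?thesis using H_norm[of e] by (simp add: dot_self e_def)
qed

end

section \<open>The lasso objective\<close>

definition cor :: "nat \<Rightarrow> mat \<Rightarrow> (nat \<Rightarrow> real) \<Rightarrow> nat \<Rightarrow> real" where
  "cor m D y = (\<lambda>j. dot {..<m} (\<lambda>k. D k j) y)"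

definition gram :: "nat \<Rightarrow> mat \<Rightarrow> mat \<Rightarrow> mat" where
  "gram m D E = (\<lambda>i j. dot {..<m} (\<lambda>k. D k i) (\<lambda>k. E k j))"

lemma dot_app_cor: "dot {..<m} v (app J D x) = dot J (cor m D v) x"
  unfolding dot_app_transpose by (auto intro!: dot_cong simp: app_def cor_def dot_def)

lemma cor_app: "cor m D (app J E x) = app J (gram m D E) x"
  by (rule ext) (simp add: cor_def dot_app_transpose[of "{..<m}"], simp add: app_def gram_def dot_def mult.commute)

lemma cor_linear:
  "cor m D (\<lambda>i. u i + v i) j = cor m D u j + cor m D v j"
  "cor m D (\<lambda>i. u i - v i) j = cor m D u j - cor m D v j"
  "cor m D (\<lambda>i. c * u i) j = c * cor m D u j"
  by (simp_all add: cor_def dot_linear)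

lemma gram_sym: "gram m D D i j = gram m D D j i"
  by (simp add: gram_def dot_commute)

abbreviation lasso_val :: "nat \<Rightarrow> nat \<Rightarrow> real \<Rightarrow> (nat \<Rightarrow> real) \<Rightarrow> mat \<Rightarrow> (nat \<Rightarrow> real) \<Rightarrow> real" where
  "lasso_val m p lam y D x \<equiv> (1/2) * dot {..<m} (\<lambda>i. y i - app {..<p} D x i) (\<lambda>i. y i - app {..<p} D x i) + lam * (\<Sum>j<p. \<bar>x j\<bar>)"

lemma lasso_obj_alt: "lasso_obj m p lam y D = (INF x.
    lasso_val m p lam y D x)"
  by (simp add: lasso_obj_def dot_self app_def)

context
  fixes lam :: real and m p :: nat
  assumes lam: "lam \<ge> 0"
begin

lemma lasso_terms_nonneg: "0 \<le> (1/2) * dot {..<m} r r + lam * (\<Sum>j<p. \<bar>x j\<bar>)"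
  using lam by (intro add_nonneg_nonneg mult_nonneg_nonneg sum_nonneg) auto

lemma lasso_bdd_below: "bdd_below (range (\<lambda>x. lasso_val m p lam y D x))"
  using lasso_terms_nonneg by (intro bdd_belowI[of _ 0]) auto

lemma lasso_obj_le: "lasso_obj m p lam y D \<le>
   lasso_val m p lam y D x"
  unfolding lasso_obj_alt by (rule cINF_lower[OF lasso_bdd_below]) auto

lemma lasso_obj_greatest:
  assumes "\<And>x. c \<le> lasso_val m p lam y D x"
  shows "c \<le> lasso_obj m p lam y D"
  unfolding lasso_obj_alt using assms by (intro cINF_greatest) auto

lemma lasso_obj_nonneg: "0 \<le> lasso_obj m p lam y D"
  by (rule lasso_obj_greatest) (rule lasso_terms_nonneg)

lemma lasso_obj_le_half: "lasso_obj m p lam y D \<le> (1/2) * dot {..<m} y y"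
  using lasso_obj_le[of y D "\<lambda>_. 0"] by (simp add: app_def)

text \<open>Weak duality for the lasso. Its two ingredients are
  \<open><\<theta>, r> - |\<theta>|^2 / 2 \<le> |r|^2 / 2\<close> for the residual \<open>r\<close>
  of \<open>x\<close>, and \<open><\<theta>, D x> \<le> lam * |x|_1\<close> from the constraint on
  \<open>\<theta>\<close>.\<close>

lemma lasso_obj_ge_dual:
  assumes "\<And>j. j < p \<Longrightarrow> \<bar>cor m D \<theta> j\<bar> \<le> lam"
  shows "dot {..<m} \<theta> y - (1/2) * dot {..<m} \<theta> \<theta> \<le> lasso_obj m p lam y D"
proof (rule lasso_obj_greatest)
  fix x
  define r where "r = (\<lambda>i. y i - app {..<p} D x i)"
  have "0 \<le> dot {..<m} (\<lambda>i. r i - \<theta> i) (\<lambda>i. r i - \<theta> i)" by simp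
  then have a: "dot {..<m} \<theta> r - (1/2) * dot {..<m} \<theta> \<theta> \<le> (1/2) * dot {..<m} r r"
    by (simp add: dot_linear dot_commute[of _ r \<theta>])
  have "dot {..<p} (cor m D \<theta>) x \<le> (\<Sum>j<p. lam * \<bar>x j\<bar>)"
    unfolding dot_def
  proof (rule sum_mono)
    fix j assume "j \<in> {..<p}"
    then have "\<bar>cor m D \<theta> j\<bar> * \<bar>x j\<bar> \<le> lam * \<bar>x j\<bar>" using assms by (intro mult_right_mono) auto
    then show "cor m D \<theta> j * x j \<le> lam * \<bar>x j\<bar>" by (metis abs_le_D1 abs_mult)
  qed
  then have b: "dot {..<m} \<theta> (app {..<p} D x) \<le> lam * (\<Sum>j<p. \<bar>x j\<bar>)"
    by (simp add: dot_app_cor sum_distrib_left)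
  have "dot {..<m} \<theta> y = dot {..<m} \<theta> r + dot {..<m} \<theta> (app {..<p} D x)"
    by (simp add: r_def dot_linear)
  then show "dot {..<m} \<theta> y - 1/2 * dot {..<m} \<theta> \<theta> \<le>
    lasso_val m p lam y D x"
    using a b by (simp add: r_def)
qed

end

lemma sqrt_dot_app_le: "sqrt (dot I (app J A x) (app J A x)) \<le> sqrt (\<Sum>i\<in>I. \<Sum>j\<in>J. (A i j)\<^sup>2) * sqrt (dot J x x)"
proof -
  have "dot I (app J A x) (app J A x) \<le> (\<Sum>i\<in>I. (\<Sum>j\<in>J. (A i j)\<^sup>2) * dot J x x)"
    unfolding dot_self app_def by (intro sum_mono Cauchy_Schwarz_ineq_sum)
  then show ?thesis by (simp add: sum_distrib_right[symmetric] real_sqrt_mult[symmetric])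
qed

lemma sqrt_dot_add_le: "sqrt (dot I (\<lambda>i. u i + v i) (\<lambda>i. u i + v i)) \<le> sqrt (dot I u u) + sqrt (dot I v v)"
  using L2_set_triangle_ineq[of u v I] by (simp add: L2_set_dot)

text \<open>Competitors \<open>x\<close> whose value exceeds \<open>M^2 / 2\<close>, the bound given
  by \<open>x = 0\<close>, are harmless. For the others \<open>lam * |x|_1 \<le> M^2 / 2\<close>, so
  replacing \<open>D\<close> by \<open>D'\<close> moves the residual by at most
  \<open>\<eta> * |x|_1 \<le> M * q\<close>. A residual of norm at most \<open>M\<close> then has
  its half square increased by at most \<open>(2 + q) * M^2 * q / 2\<close>, and
  \<open>q \<le> 1\<close> gives the factor 3/2.\<close>

lemma lasso_obj_lipschitz:
  assumes lam: "lam > 0" and M: "M > 0" "sqrt (dot {..<m} y y) \<le> M"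
    and \<eta>: "frob_norm m p (\<lambda>i j. D i j - D' i j) \<le> \<eta>" "q = \<eta> * M / (2 * lam)" "q \<le> 1"
  shows "lasso_obj m p lam y D' \<le> lasso_obj m p lam y D + 3/2 * M\<^sup>2 * q"
proof -
  have "0 \<le> frob_norm m p (\<lambda>i j. D i j - D' i j)" by (simp add: frob_norm_def sum_nonneg)
  then have "0 \<le> \<eta>" using \<eta>(1) by linarith
  then have q0: "0 \<le> q" unfolding \<eta>(2) using M(1) lam by simp
  have yy: "dot {..<m} y y \<le> M\<^sup>2" by (rule sqrt_le_D[OF M(2)])
  have "lasso_obj m p lam y D' - 3/2 * M\<^sup>2 * q \<le> lasso_obj m p lam y D"
  proof (rule lasso_obj_greatest)
    show "0 \<le> lam" using lam by simp
    fix x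
    define r where "r = (\<lambda>i. y i - app {..<p} D x i)"
    define l where "l = (\<Sum>j<p. \<bar>x j\<bar>)"
    have l0: "0 \<le> l" by (simp add: l_def sum_nonneg)
    show "lasso_obj m p lam y D' - 3/2 * M\<^sup>2 * q \<le>
      1/2 * dot {..<m} (\<lambda>i. y i - app {..<p} D x i) (\<lambda>i. y i - app {..<p} D x i) + lam * (\<Sum>j<p. \<bar>x j\<bar>)"
      unfolding r_def[symmetric] l_def[symmetric]
    proof (cases "(1/2) * dot {..<m} r r + lam * l \<le> M\<^sup>2 / 2")
      case False
      have "lasso_obj m p lam y D' \<le> M\<^sup>2 / 2" using lasso_obj_le_half[of lam m p y D'] lam yy by simp
      then show "lasso_obj m p lam y D' - 3/2 * M\<^sup>2 * q \<le> 1/2 * dot {..<m} r r + lam * l"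
        using False mult_nonneg_nonneg[OF zero_le_power2[of M] q0] by linarith
    next
      case True
      define N where "N = sqrt (dot {..<m} r r)"
      have N2: "N\<^sup>2 = dot {..<m} r r" and N0: "N \<ge> 0" by (simp_all add: N_def)
      have ll: "0 \<le> lam * l" using lam l0 by simp
      have "N\<^sup>2 \<le> M\<^sup>2" using True ll N2 by linarith
      then have NM: "N \<le> M" by (rule power2_le_imp_le) (use M(1) in simp)
      have lb: "lam * l \<le> M\<^sup>2 / 2" using True dot_self_nonneg[of "{..<m}" r] by linarith
      define d where "d = app {..<p} (\<lambda>i j. D i j - D' i j) x"
      have "sqrt (dot {..<m} d d) \<le> frob_norm m p (\<lambda>i j. D i j - D' i j) * sqrt (dot {..<p} x x)"
        unfolding d_def frob_norm_def by (rule sqrt_dot_app_le)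
      also have "\<dots> \<le> \<eta> * l"
      proof (rule mult_mono[OF \<eta>(1) _ \<open>0 \<le> \<eta>\<close>])
        show "sqrt (dot {..<p} x x) \<le> l"
          using L2_set_le_sum_abs[of x "{..<p}"] by (simp only: L2_set_dot l_def)
      qed (rule real_sqrt_ge_zero[OF dot_self_nonneg])
      also have "\<dots> \<le> M * q"
      proof -
        have "\<eta> * (lam * l) \<le> \<eta> * (M\<^sup>2 / 2)" using lb \<open>0 \<le> \<eta>\<close> by (intro mult_left_mono) auto
        also have "\<dots> = M * q * lam" using lam by (simp add: \<eta>(2) power2_eq_square)
        finally have "(\<eta> * l) * lam \<le> (M * q) * lam" by (simp add: mult_ac)
        then show ?thesis using lam by simp
      qed
      finally have dd: "sqrt (dot {..<m} d d) \<le> M * q" .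
      have eq: "(\<lambda>i. y i - app {..<p} D' x i) = (\<lambda>i. r i + d i)"
        by (rule ext) (simp add: r_def d_def app_def algebra_simps sum_subtractf)
      have "sqrt (dot {..<m} (\<lambda>i. r i + d i) (\<lambda>i. r i + d i)) \<le> N + M * q"
        using sqrt_dot_add_le[of "{..<m}" r d] dd by (simp add: N_def)
      then have "dot {..<m} (\<lambda>i. r i + d i) (\<lambda>i. r i + d i) \<le> (N + M * q)\<^sup>2"
        by (rule sqrt_le_D)
      also have "\<dots> = N\<^sup>2 + 2 * N * (M * q) + M\<^sup>2 * q\<^sup>2" by (simp add: power2_sum power_mult_distrib)
      also have "\<dots> \<le> N\<^sup>2 + 2 * M * (M * q) + M\<^sup>2 * q"
      proof -
        have "N * (M * q) \<le> M * (M * q)" using NM M q0 by (intro mult_right_mono) auto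
        moreover have "q\<^sup>2 \<le> q" using q0 \<eta>(3) by (simp add: power2_eq_square mult_left_le_one_le)
        then have "M\<^sup>2 * q\<^sup>2 \<le> M\<^sup>2 * q" by (intro mult_left_mono) auto
        ultimately show ?thesis by simp
      qed
      also have "\<dots> = N\<^sup>2 + 3 * M\<^sup>2 * q" by (simp add: power2_eq_square)
      finally show "lasso_obj m p lam y D' - 3/2 * M\<^sup>2 * q \<le> 1/2 * dot {..<m} r r + lam * l"
        using lasso_obj_le[of lam m p y D' x] lam unfolding eq l_def[symmetric] N2 by simp
    qed
  qed
  then show ?thesis by simp
qed

text \<open>The infimum runs over uncountably many \<open>x\<close>, so measurability is not
  automatic. Each objective is continuous in \<open>y\<close> for the product topology, hence the
  strict sublevel sets of the infimum are unions of open sets.\<close>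

lemma lasso_obj_measurable:
  assumes "lam \<ge> 0"
  shows "(\<lambda>y. lasso_obj m p lam y D) \<in> borel_measurable borel"
proof (rule borel_measurableI_less)
  fix a
  define g where "g = (\<lambda>x y. (1/2) * (\<Sum>i<m. (y i - (\<Sum>j<p. D i j * x j))\<^sup>2) + lam * (\<Sum>j<p. \<bar>x j\<bar>))"
  have "lasso_obj m p lam y D < a \<longleftrightarrow> (\<exists>x. g x y < a)" for y
  proof -
    have "lasso_obj m p lam y D = (INF x. g x y)" by (simp add: lasso_obj_def g_def)
    moreover have "bdd_below (range (\<lambda>x. g x y))"
      using lasso_bdd_below[OF assms, of m y p D] by (simp add: g_def dot_self app_def)
    ultimately show ?thesis by (metis UNIV_I UNIV_not_empty cINF_less_iff)
  qed
  then have "{y \<in> space borel. lasso_obj m p lam y D < a} = (\<Union>x. {y. g x y < a})" by auto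
  moreover have "continuous_on UNIV (\<lambda>y. g x y)" for x
    unfolding g_def by (intro continuous_intros continuous_on_product_coordinates)
  then have "open (\<Union>x. {y. g x y < a})"
    by (intro open_UN ballI open_Collect_less continuous_on_const)
  ultimately show "{y \<in> space borel. lasso_obj m p lam y D < a} \<in> sets borel" by simp
qed

locale lasso_support = gram_inverse J "gram m D D" H \<mu> for J :: "nat set" and m D H \<mu> +
  fixes p :: nat and lam :: real
  assumes Jp: "J \<subseteq> {..<p}" and lam: "lam > 0"
begin

definition resp :: "(nat \<Rightarrow> real) \<Rightarrow> (nat \<Rightarrow> real) \<Rightarrow> nat \<Rightarrow> real" where
  "resp y sg = (\<lambda>i. cor m D y i - lam * sg i)"

text \<open>\<open>phi\<close> is the lasso value on the support \<open>J\<close> when the signs of the solution are \<open>sg\<close>.\<close>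

definition phi :: "(nat \<Rightarrow> real) \<Rightarrow> (nat \<Rightarrow> real) \<Rightarrow> real" where
  "phi y sg = (1/2) * dot {..<m} y y - (1/2) * dot J (resp y sg) (app J H (resp y sg))"

text \<open>The stationary point for the sign pattern \<open>sg\<close>: it solves
  \<open>G x = D_J^T y - lam * sg\<close> on \<open>J\<close>. Nothing forces its own signs to be
  \<open>sg\<close>.\<close>

definition xhat :: "(nat \<Rightarrow> real) \<Rightarrow> (nat \<Rightarrow> real) \<Rightarrow> nat \<Rightarrow> real" where
  "xhat y sg = app J H (resp y sg)"

lemma resid_sq:
  "dot {..<m} (\<lambda>i. y i - app J D (xhat y sg) i) (\<lambda>i. y i - app J D (xhat y sg) i) =
    dot {..<m} y y - dot J (resp y sg) (xhat y sg) - 2 * lam * dot J sg (xhat y sg)"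
  and resid_y: "dot {..<m} (\<lambda>i. y i - app J D (xhat y sg) i) y =
    dot {..<m} y y - dot J (resp y sg) (xhat y sg) - lam * dot J sg (xhat y sg)"
proof -
  let ?x = "xhat y sg" and ?b = "resp y sg"
  have c: "dot J (cor m D y) ?x = dot J ?b ?x + lam * dot J sg ?x"
    by (simp add: resp_def dot_linear)
  have g: "dot J (app J (gram m D D) ?x) ?x = dot J ?b ?x"
    by (rule dot_cong) (auto simp: xhat_def app_GH)
  have 1: "dot {..<m} y (app J D ?x) = dot J ?b ?x + lam * dot J sg ?x"
    using c by (simp add: dot_app_cor)
  have 2: "dot {..<m} (app J D ?x) (app J D ?x) = dot J ?b ?x"
    using g by (simp add: dot_app_cor cor_app)
  show "dot {..<m} (\<lambda>i. y i - app J D ?x i) (\<lambda>i. y i - app J D ?x i) =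
    dot {..<m} y y - dot J ?b ?x - 2 * lam * dot J sg ?x"
    using 1 2 by (simp add: dot_linear dot_commute[of _ "app J D ?x" y])
  show "dot {..<m} (\<lambda>i. y i - app J D ?x i) y = dot {..<m} y y - dot J ?b ?x - lam * dot J sg ?x"
    using 1 by (simp add: dot_linear dot_commute[of _ "app J D ?x" y])
qed

text \<open>The residual of \<open>xhat\<close> is dual feasible, so the lower bound needs no sign consistency of \<open>xhat\<close>.\<close>

lemma phi_le_lasso_obj:
  assumes y: "\<And>i. i < m \<Longrightarrow> y i = app J D x i + z i"
    and unit: "\<And>j. j < p \<Longrightarrow> gram m D D j j = 1"
    and sg: "\<And>j. j \<in> J \<Longrightarrow> \<bar>sg j\<bar> \<le> 1"
    and off: "\<And>j. j < p \<Longrightarrow> j \<notin> J \<Longrightarrow> (\<Sum>i\<in>J. \<bar>gram m D D j i\<bar>) \<le> \<mu>"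
    and z: "sqrt (dot {..<m} z z) \<le> lam * (1 - 2 * \<mu>)"
    and mu0: "0 \<le> \<mu>"
  shows "phi y sg \<le> lasso_obj m p lam y D"
proof -
  let ?x = "xhat y sg"
  define \<theta> where "\<theta> = (\<lambda>i. y i - app J D ?x i)"
  have phi: "phi y sg = dot {..<m} \<theta> y - (1/2) * dot {..<m} \<theta> \<theta>"
    unfolding \<theta>_def resid_sq resid_y by (simp add: phi_def xhat_def field_simps)
  define w where "w = app J H (cor m D z)"
  define v where "v = app J H sg"
  have cory: "cor m D y j = app J (gram m D D) x j + cor m D z j" for j
  proof -
    have "cor m D y j = cor m D (\<lambda>i. app J D x i + z i) j"
      unfolding cor_def by (rule dot_cong) (auto simp: y)
    then show ?thesis by (simp add: cor_linear cor_app)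
  qed
  have xh: "?x i = x i + w i - lam * v i" if "i \<in> J" for i
    unfolding xhat_def resp_def w_def v_def cory by (simp add: app_linear app_HG[OF that])
  \<comment> \<open>The coefficients \<open>x\<close> cancel. What remains is the part of
    \<open>z\<close> orthogonal to the columns in \<open>J\<close> and the fixed vector
    \<open>lam * D_J H sg\<close>; the two are bounded separately.\<close>
  have \<theta>: "\<theta> i = (z i - app J D w i) + lam * app J D v i" if "i < m" for i
  proof -
    have "app J D ?x i = app J D (\<lambda>j. x j + w j - lam * v j) i"
      using app_cong[of J ?x "\<lambda>j. x j + w j - lam * v j" D] xh by auto
    then show ?thesis using y[OF that] by (simp add: \<theta>_def app_linear)
  qed
  define e where "e = (\<lambda>i. z i - app J D w i)"
  have ee: "dot {..<m} e e \<le> dot {..<m} z z"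
  proof -
    have zw: "dot {..<m} z (app J D w) = dot J (cor m D z) w" by (simp add: dot_app_cor)
    have ww: "dot {..<m} (app J D w) (app J D w) = dot J (cor m D z) w"
      by (simp add: dot_app_cor cor_app) (auto intro!: dot_cong simp: w_def app_GH)
    have "dot {..<m} e e = dot {..<m} z z - dot J (cor m D z) w"
      using zw ww by (simp add: e_def dot_linear dot_commute[of _ "app J D w" z])
    then show ?thesis using H_nonneg[of "cor m D z"] by (simp add: w_def)
  qed
  have "\<bar>cor m D \<theta> j\<bar> \<le> lam" if j: "j < p" for j
  proof (cases "j \<in> J")
    case True
    have "cor m D \<theta> j = cor m D y j - app J (gram m D D) ?x j"
      by (simp add: \<theta>_def cor_linear cor_app)
    also have "\<dots> = lam * sg j" using True by (simp add: xhat_def app_GH resp_def)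
    finally show ?thesis using sg[OF True] lam by (simp add: abs_mult)
  next
    case False
    have "cor m D \<theta> j = cor m D (\<lambda>i. e i + lam * app J D v i) j"
      unfolding cor_def by (rule dot_cong) (auto simp: \<theta> e_def)
    also have "\<dots> = cor m D e j + lam * app J (gram m D D) v j"
      by (simp add: cor_linear cor_app)
    finally have 1: "\<bar>cor m D \<theta> j\<bar> \<le> \<bar>cor m D e j\<bar> + lam * \<bar>app J (gram m D D) v j\<bar>"
      using lam by (simp add: abs_mult abs_triangle_ineq[THEN order.trans])
    have "\<bar>cor m D e j\<bar> \<le> sqrt (gram m D D j j) * sqrt (dot {..<m} e e)"
      unfolding cor_def gram_def by (rule abs_dot_le_sqrt)
    also have "\<dots> \<le> lam * (1 - 2 * \<mu>)" using z ee unit[OF j] by (simp add: order.trans[OF real_sqrt_le_mono])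
    finally have 2: "\<bar>cor m D e j\<bar> \<le> lam * (1 - 2 * \<mu>)" .
    have "(1 - \<mu>) * \<bar>app J (gram m D D) v j\<bar> \<le> (1 - \<mu>) * (\<Sum>i\<in>J. \<bar>gram m D D j i\<bar> * \<bar>v i\<bar>)"
      using mu by (intro mult_left_mono) (auto simp: app_def abs_mult[symmetric])
    also have "\<dots> = (\<Sum>i\<in>J. \<bar>gram m D D j i\<bar> * ((1 - \<mu>) * \<bar>v i\<bar>))"
      by (simp add: sum_distrib_left mult_ac)
    also have "\<dots> \<le> (\<Sum>i\<in>J. \<bar>gram m D D j i\<bar> * 1)"
      unfolding v_def using sg H_sup[of _ sg 1] by (intro sum_mono mult_left_mono) auto
    also have "\<dots> \<le> \<mu>" using off[OF j False] by simp
    finally have 3: "(1 - \<mu>) * \<bar>app J (gram m D D) v j\<bar> \<le> \<mu>" .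
    \<comment> \<open>The preceding bound amounts to \<open>\<mu> / (1 - \<mu>)\<close>, while
      \<open>2 * \<mu>\<close> is needed. This takes \<open>\<mu> \<le> 1/2\<close>, which the bound
      on \<open>z\<close> forces because a norm is nonnegative.\<close>
    have "\<mu> * \<bar>app J (gram m D D) v j\<bar> \<le> \<mu> * 1"
    proof (cases "\<mu> = 0")
      case False
      have "\<mu> \<le> 1 / 2"
      proof (rule ccontr)
        assume "\<not> \<mu> \<le> 1/2"
        then have "lam * (1 - 2 * \<mu>) < 0" using lam by (simp add: mult_less_0_iff)
        then show False using z real_sqrt_ge_zero[OF dot_self_nonneg[of "{..<m}" z]] by linarith
      qed
      have "(1/2) * \<bar>app J (gram m D D) v j\<bar> \<le> (1 - \<mu>) * \<bar>app J (gram m D D) v j\<bar>"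
        using \<open>\<mu> \<le> 1/2\<close> by (intro mult_right_mono) auto
      then have "\<bar>app J (gram m D D) v j\<bar> \<le> 1" using 3 \<open>\<mu> \<le> 1/2\<close> by linarith
      then show ?thesis using mu0 by (intro mult_left_mono) auto
    qed simp
    then have "\<bar>app J (gram m D D) v j\<bar> \<le> 2 * \<mu>" using 3 by (simp add: algebra_simps)
    then have "lam * \<bar>app J (gram m D D) v j\<bar> \<le> lam * (2 * \<mu>)" using lam by (intro mult_left_mono) auto
    then show ?thesis using 1 2 by (simp add: algebra_simps)
  qed
  then show ?thesis unfolding phi by (intro lasso_obj_ge_dual) (use lam in auto)
qed

text \<open>The deviation of \<open>xhat\<close> from the true coefficients solves a system with
  matrix \<open>G\<close> and right side at most \<open>|z| + lam\<close> in each entry, so by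
  \<open>H_sup\<close> it is at most \<open>xlow\<close> and cannot reverse a sign. Then the l1 norm
  of \<open>xhat\<close> is \<open><sg, xhat>\<close>, and \<open>phi\<close> is the value actually
  attained at \<open>xhat\<close> extended by zero.\<close>

lemma lasso_obj_le_phi:
  assumes y: "\<And>i. i < m \<Longrightarrow> y i = app J D x i + z i"
    and sg: "\<And>j. j \<in> J \<Longrightarrow> sg j = sgn (x j)"
    and low: "\<And>j. j \<in> J \<Longrightarrow> xlow \<le> \<bar>x j\<bar>"
    and z: "sqrt (dot {..<m} z z) + lam \<le> (1 - \<mu>) * xlow"
    and xlow: "xlow > 0"
  shows "lasso_obj m p lam y D \<le> phi y sg"
proof -
  let ?x = "xhat y sg"
  define x' where "x' = (\<lambda>j. if j \<in> J then ?x j else 0)"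
  have cory: "cor m D y j = app J (gram m D D) x j + cor m D z j" for j
  proof -
    have "cor m D y j = cor m D (\<lambda>i. app J D x i + z i) j"
      unfolding cor_def by (rule dot_cong) (auto simp: y)
    then show ?thesis by (simp add: cor_linear cor_app)
  qed
  have pos: "\<bar>?x i\<bar> = sg i * ?x i" if i: "i \<in> J" for i
  proof -
    define d where "d = app J H (\<lambda>j. cor m D z j - lam * sg j) i"
    have xi: "?x i = x i + d"
      unfolding xhat_def resp_def cory d_def by (simp add: app_linear app_HG[OF i])
    have "(1 - \<mu>) * \<bar>d\<bar> \<le> sqrt (dot {..<m} z z) + lam"
      unfolding d_def
    proof (rule H_sup[OF i])
      fix j assume j: "j \<in> J"
      have "\<bar>cor m D z j\<bar> \<le> sqrt (gram m D D j j) * sqrt (dot {..<m} z z)"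
        unfolding cor_def gram_def by (rule abs_dot_le_sqrt)
      then have "\<bar>cor m D z j\<bar> \<le> sqrt (dot {..<m} z z)" using diagG[OF j] by simp
      moreover have "\<bar>lam * sg j\<bar> \<le> lam" using lam sg[OF j] by (simp add: abs_mult sgn_real_def)
      ultimately show "\<bar>cor m D z j - lam * sg j\<bar> \<le> sqrt (dot {..<m} z z) + lam"
        by linarith
    qed
    then have "(1 - \<mu>) * \<bar>d\<bar> \<le> (1 - \<mu>) * xlow" using z by simp
    then have "\<bar>d\<bar> \<le> \<bar>x i\<bar>" using mu low[OF i] by simp
    then show ?thesis unfolding sg[OF i] xi by (auto simp: sgn_real_def abs_if split: if_splits)
  qed
  have ax: "app {..<p} D x' = app J D ?x"
    unfolding app_def x'_def using Jp
    by (intro ext sum.mono_neutral_cong_right) auto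
  have "(\<Sum>j<p. \<bar>x' j\<bar>) = (\<Sum>j\<in>J. \<bar>?x j\<bar>)"
    unfolding x'_def using Jp by (intro sum.mono_neutral_cong_right) auto
  also have "\<dots> = dot J sg ?x" by (simp add: dot_def pos)
  finally have l1: "(\<Sum>j<p. \<bar>x' j\<bar>) = dot J sg ?x" .
  have "lasso_obj m p lam y D \<le> (1/2) * dot {..<m} (\<lambda>i. y i - app {..<p} D x' i) (\<lambda>i. y i - app {..<p} D x' i) + lam * (\<Sum>j<p. \<bar>x' j\<bar>)"
    using lam by (intro lasso_obj_le) auto
  also have "\<dots> = phi y sg"
    unfolding ax l1 resid_sq by (simp add: phi_def xhat_def field_simps)
  finally show ?thesis .
qed

end

text \<open>A matrix and its transpose have the same operator norm: for \<open>c = D_J^T v\<close>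
  one has \<open>|c|^2 = <v, D_J c>\<close>, and Cauchy-Schwarz with the bound on
  \<open>D_J c\<close> lets one factor \<open>|c|^2\<close> be cancelled.\<close>

lemma cor_sq_le:
  assumes op: "\<And>x. dot {..<m} (app J D x) (app J D x) \<le> b * dot J x x" and b: "0 \<le> b"
  shows "dot J (cor m D v) (cor m D v) \<le> b * dot {..<m} v v"
proof -
  define c where "c = cor m D v"
  have "dot J c c = dot {..<m} v (app J D c)" by (simp add: dot_app_cor c_def)
  then have "(dot J c c)\<^sup>2 \<le> dot {..<m} v v * dot {..<m} (app J D c) (app J D c)"
    using dot_Cauchy_Schwarz[of "{..<m}" v "app J D c"] by simp
  also have "\<dots> \<le> dot {..<m} v v * (b * dot J c c)" by (intro mult_left_mono op) auto
  finally have *: "dot J c c * dot J c c \<le> (b * dot {..<m} v v) * dot J c c"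
    by (simp add: power2_eq_square mult_ac)
  show ?thesis unfolding c_def[symmetric]
  proof (cases "dot J c c = 0")
    case True
    then show "dot J c c \<le> b * dot {..<m} v v" using b by simp
  next
    case False
    then have "0 < dot J c c" using dot_self_nonneg[of J c] by linarith
    then show "dot J c c \<le> b * dot {..<m} v v" using * by simp
  qed
qed

lemma sum_gram_sq_le:
  assumes J: "finite J"
    and diag: "\<And>i. i \<in> J \<Longrightarrow> gram m D D i i = 1"
    and row: "\<And>i. i \<in> J \<Longrightarrow> (\<Sum>j\<in>J - {i}. \<bar>gram m D D i j\<bar>) \<le> \<mu>"
    and \<mu>: "0 \<le> \<mu>"
  shows "dot J (cor m D v) (cor m D v) \<le> (1 + \<mu>) * dot {..<m} v v"
proof (rule cor_sq_le)
  fix x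
  have "dot {..<m} (app J D x) (app J D x) = dot J x (app J (gram m D D) x)"
    by (simp add: dot_app_cor cor_app dot_commute)
  also have "\<dots> \<le> (1 + \<mu>) * dot J x x" by (intro gram_coercive J gram_sym diag row)
  finally show "dot {..<m} (app J D x) (app J D x) \<le> (1 + \<mu>) * dot J x x" .
qed (use \<mu> in simp)

lemma sum_abs_le_sqrt_card:
  assumes "finite J" "card J \<le> s"
  shows "(\<Sum>i\<in>J. \<bar>f i\<bar>) \<le> sqrt (real s) * sqrt (\<Sum>i\<in>J. (f i)\<^sup>2)"
proof -
  have "(\<Sum>i\<in>J. 1 * \<bar>f i\<bar>)\<^sup>2 \<le> (\<Sum>i\<in>J. 1\<^sup>2) * (\<Sum>i\<in>J. \<bar>f i\<bar>\<^sup>2)"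
    by (rule Cauchy_Schwarz_ineq_sum)
  also have "\<dots> \<le> real s * (\<Sum>i\<in>J. (f i)\<^sup>2)"
    using assms by (auto intro!: mult_right_mono sum_nonneg)
  finally have "(\<Sum>i\<in>J. \<bar>f i\<bar>)\<^sup>2 \<le> real s * (\<Sum>i\<in>J. (f i)\<^sup>2)" by simp
  then show ?thesis unfolding real_sqrt_mult[symmetric] by (rule real_le_rsqrt)
qed

text \<open>With \<open>D = D0 - \<delta>\<close>, the Gram matrix of \<open>D\<close> is that of
  \<open>D0\<close> minus \<open>D0^T \<delta>\<close> and \<open>\<delta>^T D\<close>. Column
  \<open>j\<close> of the former is controlled by \<open>\<delta>_j\<close> and the operator norm of
  \<open>D0\<close> on \<open>J\<close>, at most \<open>sqrt (1 + \<mu>) \<le> 5/4\<close>; that of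
  the latter by \<open>\<delta>\<close> on \<open>J\<close>. As \<open>j\<close> lies outside
  \<open>J\<close>, the two share the budget \<open>\<rho>\<^sup>2\<close>, and
  \<open>sqrt s\<close> is the price of passing from l2 to l1.\<close>

lemma sum_gram_perturbed_le:
  fixes D D0 :: mat
  assumes J: "J \<subseteq> {..<p}" "j < p" "j \<notin> J" "card J \<le> s"
    and unit: "\<And>j. j < p \<Longrightarrow> gram m D D j j = 1" "\<And>j. j < p \<Longrightarrow> gram m D0 D0 j j = 1"
    and coh: "\<And>J j. J \<subseteq> {..<p} \<Longrightarrow> card J \<le> s \<Longrightarrow> j < p \<Longrightarrow> j \<notin> J \<Longrightarrow> (\<Sum>i\<in>J. \<bar>gram m D0 D0 i j\<bar>) \<le> \<mu>"
    and \<mu>: "0 \<le> \<mu>" "\<mu> \<le> 1/4"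
    and \<delta>: "\<delta> = (\<lambda>k j. D0 k j - D k j)"
    and \<rho>: "(\<Sum>j<p. gram m \<delta> \<delta> j j) \<le> \<rho>\<^sup>2" "0 \<le> \<rho>"
  shows "(\<Sum>i\<in>J. \<bar>gram m D D i j\<bar>) \<le> \<mu> + 2 * sqrt (real s) * \<rho>"
proof -
  have fin: "finite J" using J(1) finite_subset by blast
  have split: "gram m D D i j = gram m D0 D0 i j - gram m D0 \<delta> i j - gram m \<delta> D i j" for i
    unfolding gram_def \<delta> by (simp add: dot_linear)
  have "(\<Sum>i\<in>J. \<bar>gram m D D i j\<bar>) \<le> (\<Sum>i\<in>J. \<bar>gram m D0 D0 i j\<bar> + \<bar>gram m D0 \<delta> i j\<bar> + \<bar>gram m \<delta> D i j\<bar>)"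
    unfolding split by (intro sum_mono) linarith
  also have "\<dots> = (\<Sum>i\<in>J. \<bar>gram m D0 D0 i j\<bar>) + (\<Sum>i\<in>J. \<bar>gram m D0 \<delta> i j\<bar>) + (\<Sum>i\<in>J. \<bar>gram m \<delta> D i j\<bar>)"
    by (simp add: sum.distrib)
  finally have 1: "(\<Sum>i\<in>J. \<bar>gram m D D i j\<bar>) \<le> \<mu> + (\<Sum>i\<in>J. \<bar>gram m D0 \<delta> i j\<bar>) + (\<Sum>i\<in>J. \<bar>gram m \<delta> D i j\<bar>)"
    using coh[OF J(1,4,2,3)] by linarith
  define a where "a = sqrt (\<Sum>i\<in>J. gram m \<delta> \<delta> i i)"
  define b where "b = sqrt (gram m \<delta> \<delta> j j)"
  have a2: "a\<^sup>2 = (\<Sum>i\<in>J. gram m \<delta> \<delta> i i)" and b2: "b\<^sup>2 = gram m \<delta> \<delta> j j" and ab0: "0 \<le> a" "0 \<le> b"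
    unfolding a_def b_def gram_def by (simp_all add: sum_nonneg)
  have ab: "a\<^sup>2 + b\<^sup>2 \<le> \<rho>\<^sup>2"
  proof -
    have "a\<^sup>2 + b\<^sup>2 = (\<Sum>i\<in>insert j J. gram m \<delta> \<delta> i i)" using fin J(3) a2 b2 by simp
    also have "\<dots> \<le> (\<Sum>i<p. gram m \<delta> \<delta> i i)" using J by (intro sum_mono2) (auto simp: gram_def)
    finally show ?thesis using \<rho>(1) by simp
  qed
  have row: "(\<Sum>k\<in>J - {i}. \<bar>gram m D0 D0 i k\<bar>) \<le> \<mu>" if i: "i \<in> J" for i
  proof -
    have "card (J - {i}) \<le> s" using J(4) card_Diff1_le[of J i] by linarith
    then have "(\<Sum>k\<in>J - {i}. \<bar>gram m D0 D0 k i\<bar>) \<le> \<mu>" using J i by (intro coh) auto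
    then show ?thesis by (simp only: gram_sym)
  qed
  have 2: "(\<Sum>i\<in>J. \<bar>gram m D0 \<delta> i j\<bar>) \<le> sqrt (real s) * (5/4 * b)"
  proof -
    have "(\<Sum>i\<in>J. (gram m D0 \<delta> i j)\<^sup>2) \<le> (1 + \<mu>) * b\<^sup>2"
      using sum_gram_sq_le[OF fin _ row \<mu>(1), where v = "\<lambda>k. \<delta> k j"] unit(2) J(1)
      unfolding b2 by (auto simp: cor_def gram_def dot_self subset_iff)
    also have "\<dots> \<le> (5/4)\<^sup>2 * b\<^sup>2" using \<mu> by (intro mult_right_mono) (auto simp: power2_eq_square)
    also have "\<dots> = (5/4 * b)\<^sup>2" by (simp only: power_mult_distrib)
    finally have le: "(\<Sum>i\<in>J. (gram m D0 \<delta> i j)\<^sup>2) \<le> (5/4 * b)\<^sup>2" .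
    have "sqrt (\<Sum>i\<in>J. (gram m D0 \<delta> i j)\<^sup>2) \<le> 5/4 * b"
      by (rule real_le_lsqrt[OF _ le]) (use ab0 in simp)
    then show ?thesis
      using sum_abs_le_sqrt_card[OF fin J(4), of "\<lambda>i. gram m D0 \<delta> i j"]
      by (meson mult_left_mono order.trans real_sqrt_ge_zero of_nat_0_le_iff)
  qed
  have 3: "(\<Sum>i\<in>J. \<bar>gram m \<delta> D i j\<bar>) \<le> sqrt (real s) * a"
  proof -
    have "(\<Sum>i\<in>J. (gram m \<delta> D i j)\<^sup>2) \<le> (\<Sum>i\<in>J. gram m \<delta> \<delta> i i)"
    proof (rule sum_mono)
      fix i
      show "(gram m \<delta> D i j)\<^sup>2 \<le> gram m \<delta> \<delta> i i"
        using dot_Cauchy_Schwarz[of "{..<m}" "\<lambda>k. \<delta> k i" "\<lambda>k. D k j"] unit(1)[OF J(2)] by (simp add: gram_def)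
    qed
    then have "sqrt (\<Sum>i\<in>J. (gram m \<delta> D i j)\<^sup>2) \<le> a" unfolding a_def by (rule real_sqrt_le_mono)
    then show ?thesis
      using sum_abs_le_sqrt_card[OF fin J(4), of "\<lambda>i. gram m \<delta> D i j"]
      by (meson mult_left_mono order.trans real_sqrt_ge_zero of_nat_0_le_iff)
  qed
  have "(a + 5/4 * b)\<^sup>2 \<le> (2 * \<rho>)\<^sup>2"
  proof -
    \<comment> \<open>Cauchy-Schwarz against the vector (1, 5/4), whose squared length 41/16 is
      below 4.\<close>
    have "0 \<le> (5/4 * a - b)\<^sup>2" by simp
    then have "(a + 5/4 * b)\<^sup>2 \<le> (41/16) * (a\<^sup>2 + b\<^sup>2)" by (simp add: power2_eq_square algebra_simps)
    also have "\<dots> \<le> (41/16) * \<rho>\<^sup>2" by (rule mult_left_mono[OF ab]) simp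
    also have "\<dots> \<le> 4 * \<rho>\<^sup>2" by (intro mult_right_mono) auto
    finally show ?thesis by (simp add: power_mult_distrib)
  qed
  then have "a + 5/4 * b \<le> 2 * \<rho>" by (rule power2_le_imp_le) (use \<rho>(2) in simp)
  then have "sqrt (real s) * (a + 5/4 * b) \<le> sqrt (real s) * (2 * \<rho>)" by (intro mult_left_mono) auto
  then show ?thesis using 1 2 3 by (simp add: algebra_simps)
qed

section \<open>The expected gap for a fixed perturbation\<close>

text \<open>\<open>quad_mean\<close> is the conditional mean, given the support \<open>J\<close>, of \<open>b\<^sup>T H b\<close> for the response
  \<open>b = D\<^sub>J\<^sup>T y - lam sgn x\<close>; here \<open>C\<close> is the cross Gram matrix of \<open>D\<close> and the true dictionary.\<close>

definition quad_mean :: "real \<Rightarrow> real \<Rightarrow> real \<Rightarrow> real \<Rightarrow> 'a set \<Rightarrow> ('a \<Rightarrow> 'a \<Rightarrow> real) \<Rightarrow>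
    ('a \<Rightarrow> 'a \<Rightarrow> real) \<Rightarrow> ('a \<Rightarrow> 'a \<Rightarrow> real) \<Rightarrow> real" where
  "quad_mean Ex2 Eabs Eeps lam J C G H =
     Ex2 * (\<Sum>i\<in>J. \<Sum>j\<in>J. H i j * (\<Sum>k\<in>J. C i k * C j k)) + Eeps * (\<Sum>i\<in>J. \<Sum>j\<in>J. H i j * G i j)
     + lam\<^sup>2 * (\<Sum>i\<in>J. H i i) - 2 * lam * Eabs * (\<Sum>i\<in>J. \<Sum>j\<in>J. H i j * C i j)"

lemma abs_mult_le_weighted:
  fixes a b t :: real
  assumes "t > 0"
  shows "\<bar>a * b\<bar> \<le> (t * a\<^sup>2 + b\<^sup>2 / t) / 2"
proof -
  have "0 \<le> (sqrt t * \<bar>a\<bar> - \<bar>b\<bar> / sqrt t)\<^sup>2" by simp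
  also have "\<dots> = t * a\<^sup>2 + b\<^sup>2 / t - 2 * \<bar>a * b\<bar>"
    using assms by (simp add: power2_diff power_mult_distrib power_divide abs_mult)
  finally show ?thesis by simp
qed

context gram_inverse
begin

lemma sum_delta_minus:
  fixes f :: "'a \<Rightarrow> 'a \<Rightarrow> real"
  assumes "\<And>i. i \<in> J \<Longrightarrow> f i i = 0"
  shows "(\<Sum>i\<in>J. \<Sum>j\<in>J. f i j) = (\<Sum>i\<in>J. \<Sum>j\<in>J - {i}. f i j)"
proof (rule sum.cong[OF refl])
  fix i assume "i \<in> J"
  then show "(\<Sum>j\<in>J. f i j) = (\<Sum>j\<in>J - {i}. f i j)" using assms fin by (subst sum.remove) auto
qed

lemma sum_HG: "(\<Sum>i\<in>J. \<Sum>j\<in>J. H i j * G i j) = card J"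
proof -
  have "(\<Sum>j\<in>J. H i j * G i j) = 1" if "i \<in> J" for i
    using HG[OF that that] that by (simp add: symG[OF _ that] cong: sum.cong)
  then show ?thesis by simp
qed

text \<open>Column \<open>k\<close> of \<open>C\<close> is \<open>g_k + u_k\<close>, and
  \<open>H\<close> maps the column \<open>g_k\<close> of \<open>G\<close> to the unit vector
  \<open>e_k\<close>. The trace of \<open>C^T H C\<close> therefore reduces to diagonal entries of
  \<open>U\<close> and a term quadratic in \<open>U\<close>.\<close>

lemma quad_mean_expand:
  fixes C U :: "'a \<Rightarrow> 'a \<Rightarrow> real"
  assumes C: "\<And>i k. i \<in> J \<Longrightarrow> k \<in> J \<Longrightarrow> C i k = G i k + U i k"
  shows "(\<Sum>i\<in>J. \<Sum>j\<in>J. H i j * (\<Sum>k\<in>J. C i k * C j k)) =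
     card J + 2 * (\<Sum>k\<in>J. U k k) + (\<Sum>k\<in>J. dot J (\<lambda>i. U i k) (app J H (\<lambda>i. U i k)))"
proof -
  have "(\<Sum>i\<in>J. \<Sum>j\<in>J. H i j * (\<Sum>k\<in>J. C i k * C j k)) = (\<Sum>k\<in>J. dot J (\<lambda>i. C i k) (app J H (\<lambda>i. C i k)))"
  proof -
    have "(\<Sum>i\<in>J. \<Sum>j\<in>J. H i j * (\<Sum>k\<in>J. C i k * C j k)) = (\<Sum>i\<in>J. \<Sum>j\<in>J. \<Sum>k\<in>J. C i k * (H i j * C j k))"
      by (simp add: sum_distrib_left mult_ac)
    also have "\<dots> = (\<Sum>i\<in>J. \<Sum>k\<in>J. \<Sum>j\<in>J. C i k * (H i j * C j k))"
      by (intro sum.cong refl sum.swap)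
    also have "\<dots> = (\<Sum>k\<in>J. \<Sum>i\<in>J. \<Sum>j\<in>J. C i k * (H i j * C j k))" by (rule sum.swap)
    finally show ?thesis by (simp add: dot_def app_def sum_distrib_left)
  qed
  also have "\<dots> = (\<Sum>k\<in>J. 1 + 2 * U k k + dot J (\<lambda>i. U i k) (app J H (\<lambda>i. U i k)))"
  proof (rule sum.cong[OF refl])
    fix k assume k: "k \<in> J"
    have HGk: "app J H (\<lambda>i. G i k) i = of_bool (i = k)" if "i \<in> J" for i
      using HG[OF that k] by (simp add: app_def)
    have e: "dot J v (app J H (\<lambda>i. G i k)) = v k" for v
    proof -
      have "dot J v (app J H (\<lambda>i. G i k)) = (\<Sum>i\<in>J. v i * of_bool (i = k))"
        unfolding dot_def by (intro sum.cong) (auto simp: HGk)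
      then show ?thesis using delta_sum'[OF k] by simp
    qed
    have "dot J (\<lambda>i. C i k) (app J H (\<lambda>i. C i k)) =
        dot J (\<lambda>i. G i k + U i k) (app J H (\<lambda>i. G i k + U i k))"
      using C k app_cong[of J "\<lambda>i. C i k" "\<lambda>i. G i k + U i k" H] by (intro dot_cong) auto
    also have "\<dots> = dot J (\<lambda>i. G i k + U i k) (\<lambda>i. app J H (\<lambda>i. G i k) i + app J H (\<lambda>i. U i k) i)"
      by (intro dot_cong) (auto simp: app_linear)
    also have "\<dots> = G k k + U k k + dot J (\<lambda>i. G i k) (app J H (\<lambda>i. U i k))
        + dot J (\<lambda>i. U i k) (app J H (\<lambda>i. U i k))"
      by (simp add: dot_linear e)
    also have "dot J (\<lambda>i. G i k) (app J H (\<lambda>i. U i k)) = U k k"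
      by (subst dot_app_sym) (auto simp: symH dot_commute[of J "app J H (\<lambda>i. G i k)"] e)
    finally show "dot J (\<lambda>i. C i k) (app J H (\<lambda>i. C i k)) = 1 + 2 * U k k + dot J (\<lambda>i. U i k) (app J H (\<lambda>i. U i k))"
      using diagG[OF k] by simp
  qed
  also have "\<dots> = card J + 2 * (\<Sum>k\<in>J. U k k) + (\<Sum>k\<in>J. dot J (\<lambda>i. U i k) (app J H (\<lambda>i. U i k)))"
    by (simp add: sum.distrib sum_distrib_left)
  finally show ?thesis .
qed

lemma quad_mean_self:
  "quad_mean Ex2 Eabs Eeps lam J G G H =
    (Ex2 + Eeps - 2 * lam * Eabs) * card J + lam\<^sup>2 * (\<Sum>i\<in>J. H i i)"
  unfolding quad_mean_def sum_HG using quad_mean_expand[of G "\<lambda>_ _. 0"]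
  by (simp add: dot_def app_def algebra_simps)

lemma H_minus_id_sum:
  "(1 - \<mu>)\<^sup>2 * (\<Sum>j\<in>J. \<Sum>i\<in>J. (H i j - of_bool (i = j))\<^sup>2) \<le> (\<Sum>i\<in>J. \<Sum>j\<in>J - {i}. (G i j)\<^sup>2)"
proof -
  have "(1 - \<mu>)\<^sup>2 * (\<Sum>j\<in>J. \<Sum>i\<in>J. (H i j - of_bool (i = j))\<^sup>2) \<le> (\<Sum>j\<in>J. \<Sum>i\<in>J. (G i j - of_bool (i = j))\<^sup>2)"
    unfolding sum_distrib_left[of "(1 - \<mu>)\<^sup>2" "\<lambda>j. \<Sum>i\<in>J. (H i j - of_bool (i = j))\<^sup>2"]
    by (intro sum_mono H_minus_id)
  also have "\<dots> = (\<Sum>j\<in>J. \<Sum>i\<in>J - {j}. (G i j - of_bool (i = j))\<^sup>2)"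
    by (rule sum_delta_minus) (simp add: diagG)
  also have "\<dots> = (\<Sum>j\<in>J. \<Sum>i\<in>J - {j}. (G j i)\<^sup>2)"
  proof (intro sum.cong refl)
    fix i j assume "j \<in> J" "i \<in> J - {j}"
    then show "(G i j - of_bool (i = j))\<^sup>2 = (G j i)\<^sup>2" using symG[of i j] by simp
  qed
  finally show ?thesis .
qed

end

text \<open>From \<open>H0 - H = H (G - G0) H0\<close>, the trace difference is the trace of
  \<open>K H0 H\<close> with \<open>K = G - G0\<close>. Since \<open>K\<close> has zero diagonal,
  only \<open>H0 H - I\<close> counts, and this is of the order of the off-diagonal Gram entries.
  The difference is thus of second order, which a plain perturbation bound for the inverse would
  miss.\<close>

lemma two_gram_trace_diff:
  fixes J :: "nat set" and G G0 H H0 :: mat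
  assumes 1: "gram_inverse J G H (1/3)" and 2: "gram_inverse J G0 H0 (1/3)"
    and t: "t > 0"
  shows "\<bar>(\<Sum>i\<in>J. H0 i i) - (\<Sum>i\<in>J. H i i)\<bar> \<le>
    (15/8) * (\<Sum>i\<in>J. \<Sum>j\<in>J - {i}. (G i j - G0 i j)\<^sup>2) / t
     + (9/8) * t * (\<Sum>i\<in>J. \<Sum>j\<in>J - {i}. (G i j)\<^sup>2) + (3/4) * t * (\<Sum>i\<in>J. \<Sum>j\<in>J - {i}. (G0 i j)\<^sup>2)"
proof -
  interpret A: gram_inverse J G H "1/3" by fact
  interpret B: gram_inverse J G0 H0 "1/3" by fact
  define K where "K = (\<lambda>i j. G i j - G0 i j)"
  define X where "X = (\<lambda>l k. app J H0 (\<lambda>i. H i k - of_bool (i = k)) l)"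
  define Y where "Y = (\<lambda>l k. H0 l k - of_bool (l = k))"
  have W: "(\<Sum>i\<in>J. H0 l i * H i k) = of_bool (l = k) + X l k + Y l k" if "l \<in> J" "k \<in> J" for l k
  proof -
    have "X l k = (\<Sum>i\<in>J. H0 l i * H i k) - (\<Sum>i\<in>J. H0 l i * of_bool (i = k))"
      unfolding X_def app_def by (simp add: algebra_simps sum_subtractf)
    then show ?thesis using A.delta_sum'[OF that(2), of "\<lambda>i. H0 l i"] by (simp add: Y_def)
  qed
  have "(\<Sum>i\<in>J. H0 i i) - (\<Sum>i\<in>J. H i i) = (\<Sum>i\<in>J. \<Sum>l\<in>J. (\<Sum>k\<in>J. H i k * K k l) * H0 l i)"
  proof -
    have "(\<Sum>l\<in>J. (\<Sum>k\<in>J. H i k * K k l) * H0 l i) = H0 i i - H i i" if i: "i \<in> J" for i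
    proof -
      have "(\<Sum>l\<in>J. (\<Sum>k\<in>J. H i k * K k l) * H0 l i) =
        (\<Sum>l\<in>J. (\<Sum>k\<in>J. H i k * G k l) * H0 l i) - (\<Sum>l\<in>J. (\<Sum>k\<in>J. H i k * G0 k l) * H0 l i)"
        by (simp add: K_def algebra_simps sum_subtractf)
      also have "(\<Sum>l\<in>J. (\<Sum>k\<in>J. H i k * G k l) * H0 l i) = H0 i i"
        using A.delta_sum[OF i, of "\<lambda>l. H0 l i"] by (simp add: A.HG[OF i] cong: sum.cong)
      also have "(\<Sum>l\<in>J. (\<Sum>k\<in>J. H i k * G0 k l) * H0 l i) = (\<Sum>k\<in>J. H i k * (\<Sum>l\<in>J. G0 k l * H0 l i))"
        unfolding sum_distrib_left sum_distrib_right by (subst sum.swap) (simp add: mult_ac)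
      also have "\<dots> = H i i"
        using A.delta_sum'[OF i, of "\<lambda>k. H i k"] by (simp add: B.GH[OF _ i] cong: sum.cong)
      finally show ?thesis .
    qed
    then show ?thesis by (simp add: sum_subtractf)
  qed
  also have "\<dots> = (\<Sum>l\<in>J. \<Sum>k\<in>J. K k l * (\<Sum>i\<in>J. H0 l i * H i k))"
  proof -
    have "(\<Sum>i\<in>J. \<Sum>l\<in>J. (\<Sum>k\<in>J. H i k * K k l) * H0 l i) = (\<Sum>l\<in>J. \<Sum>i\<in>J. \<Sum>k\<in>J. K k l * (H0 l i * H i k))"
      unfolding sum_distrib_right by (subst sum.swap) (simp add: mult_ac)
    also have "\<dots> = (\<Sum>l\<in>J. \<Sum>k\<in>J. \<Sum>i\<in>J. K k l * (H0 l i * H i k))"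
      by (intro sum.cong refl sum.swap)
    finally show ?thesis by (simp add: sum_distrib_left)
  qed
  also have "\<dots> = (\<Sum>l\<in>J. \<Sum>k\<in>J. K l k * X l k + K l k * Y l k)"
  proof (intro sum.cong refl)
    fix l k assume lk: "l \<in> J" "k \<in> J"
    have "K k l * of_bool (l = k) = 0" using lk A.diagG B.diagG by (auto simp: K_def)
    moreover have "K k l = K l k" using lk by (simp add: K_def A.symG[of k l] B.symG[of k l])
    ultimately show "K k l * (\<Sum>i\<in>J. H0 l i * H i k) = K l k * X l k + K l k * Y l k"
      by (auto simp only: W[OF lk] distrib_left add_0_left)
  qed
  finally have eq: "(\<Sum>i\<in>J. H0 i i) - (\<Sum>i\<in>J. H i i) = (\<Sum>l\<in>J. \<Sum>k\<in>J. K l k * X l k + K l k * Y l k)" .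
  have "\<bar>(\<Sum>i\<in>J. H0 i i) - (\<Sum>i\<in>J. H i i)\<bar> \<le> (\<Sum>l\<in>J. \<Sum>k\<in>J. \<bar>K l k * X l k + K l k * Y l k\<bar>)"
    unfolding eq by (intro order.trans[OF sum_abs] sum_mono order_refl)
  \<comment> \<open>The weights are tuned to the coherence 1/3: as \<open>H0\<close> has operator
    norm at most 3/2, in Frobenius norm \<open>X\<close> is at most 9/4 and \<open>Y\<close> at most
    3/2 times an off-diagonal Gram part. This gives 9/8 + 3/4 = 15/8 for \<open>K\<close>.\<close>
  also have "\<dots> \<le> (\<Sum>l\<in>J. \<Sum>k\<in>J. (15/8) * (K l k)\<^sup>2 / t + (2/9) * t * (X l k)\<^sup>2 + (1/3) * t * (Y l k)\<^sup>2)"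
  proof (intro sum_mono)
    fix l k
    have "\<bar>K l k * X l k\<bar> \<le> ((9/4) / t * (K l k)\<^sup>2 + (X l k)\<^sup>2 / ((9/4) / t)) / 2"
      by (rule abs_mult_le_weighted) (use t in simp)
    also have "\<dots> = (9/8) * (K l k)\<^sup>2 / t + (2/9) * t * (X l k)\<^sup>2" using t by (simp add: field_simps)
    finally have a: "\<bar>K l k * X l k\<bar> \<le> (9/8) * (K l k)\<^sup>2 / t + (2/9) * t * (X l k)\<^sup>2" .
    have "\<bar>K l k * Y l k\<bar> \<le> ((3/2) / t * (K l k)\<^sup>2 + (Y l k)\<^sup>2 / ((3/2) / t)) / 2"
      by (rule abs_mult_le_weighted) (use t in simp)
    also have "\<dots> = (3/4) * (K l k)\<^sup>2 / t + (1/3) * t * (Y l k)\<^sup>2" using t by (simp add: field_simps)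
    finally have b: "\<bar>K l k * Y l k\<bar> \<le> (3/4) * (K l k)\<^sup>2 / t + (1/3) * t * (Y l k)\<^sup>2" .
    have "(9/8) * (K l k)\<^sup>2 / t + (3/4) * (K l k)\<^sup>2 / t = (15/8) * (K l k)\<^sup>2 / t"
      using t by (simp add: field_simps)
    with a b show "\<bar>K l k * X l k + K l k * Y l k\<bar> \<le> (15/8) * (K l k)\<^sup>2 / t + (2/9) * t * (X l k)\<^sup>2 + (1/3) * t * (Y l k)\<^sup>2"
      using abs_triangle_ineq[of "K l k * X l k" "K l k * Y l k"] by linarith
  qed
  also have "\<dots> = (15/8) * (\<Sum>l\<in>J. \<Sum>k\<in>J. (K l k)\<^sup>2) / t + (2/9) * t * (\<Sum>l\<in>J. \<Sum>k\<in>J. (X l k)\<^sup>2)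
       + (1/3) * t * (\<Sum>l\<in>J. \<Sum>k\<in>J. (Y l k)\<^sup>2)"
    by (simp add: sum.distrib sum_distrib_left sum_divide_distrib)
  also have "(\<Sum>l\<in>J. \<Sum>k\<in>J. (K l k)\<^sup>2) = (\<Sum>i\<in>J. \<Sum>j\<in>J - {i}. (G i j - G0 i j)\<^sup>2)"
    unfolding K_def by (rule A.sum_delta_minus) (simp add: A.diagG B.diagG)
  also have "(2/9) * t * (\<Sum>l\<in>J. \<Sum>k\<in>J. (X l k)\<^sup>2) \<le> (9/8) * t * (\<Sum>i\<in>J. \<Sum>j\<in>J - {i}. (G i j)\<^sup>2)"
  proof -
    have e: "(1 - 1/3::real)\<^sup>2 = 4/9" by (simp add: power2_eq_square)
    have "(\<Sum>l\<in>J. \<Sum>k\<in>J. (X l k)\<^sup>2) = (\<Sum>k\<in>J. \<Sum>l\<in>J. (X l k)\<^sup>2)" by (rule sum.swap)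
    also have "\<dots> \<le> (\<Sum>k\<in>J. (9/4) * (\<Sum>i\<in>J. (H i k - of_bool (i = k))\<^sup>2))"
    proof (rule sum_mono)
      fix k
      show "(\<Sum>l\<in>J. (X l k)\<^sup>2) \<le> (9/4) * (\<Sum>i\<in>J. (H i k - of_bool (i = k))\<^sup>2)"
        using B.H_norm[of "\<lambda>i. H i k - of_bool (i = k)"] unfolding X_def dot_self e by linarith
    qed
    also have "\<dots> = (9/4) * (\<Sum>k\<in>J. \<Sum>i\<in>J. (H i k - of_bool (i = k))\<^sup>2)"
      by (simp only: sum_distrib_left)
    also have "\<dots> \<le> (9/4) * ((9/4) * (\<Sum>i\<in>J. \<Sum>j\<in>J - {i}. (G i j)\<^sup>2))"
      using A.H_minus_id_sum[unfolded e] by linarith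
    finally have "(\<Sum>l\<in>J. \<Sum>k\<in>J. (X l k)\<^sup>2) \<le> (81/16) * (\<Sum>i\<in>J. \<Sum>j\<in>J - {i}. (G i j)\<^sup>2)" by simp
    then have "(2/9) * t * (\<Sum>l\<in>J. \<Sum>k\<in>J. (X l k)\<^sup>2) \<le> (2/9) * t * ((81/16) * (\<Sum>i\<in>J. \<Sum>j\<in>J - {i}. (G i j)\<^sup>2))"
      using t by (intro mult_left_mono) auto
    then show ?thesis by simp
  qed
  also have "(1/3) * t * (\<Sum>l\<in>J. \<Sum>k\<in>J. (Y l k)\<^sup>2) \<le> (3/4) * t * (\<Sum>i\<in>J. \<Sum>j\<in>J - {i}. (G0 i j)\<^sup>2)"
  proof -
    have "(\<Sum>l\<in>J. \<Sum>k\<in>J. (Y l k)\<^sup>2) = (\<Sum>k\<in>J. \<Sum>l\<in>J. (Y l k)\<^sup>2)" by (rule sum.swap)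
    also have "\<dots> \<le> (9/4) * (\<Sum>i\<in>J. \<Sum>j\<in>J - {i}. (G0 i j)\<^sup>2)"
      using B.H_minus_id_sum unfolding Y_def by (simp add: power2_eq_square)
    finally have "(1/3) * t * (\<Sum>l\<in>J. \<Sum>k\<in>J. (Y l k)\<^sup>2) \<le> (1/3) * t * ((9/4) * (\<Sum>i\<in>J. \<Sum>j\<in>J - {i}. (G0 i j)\<^sup>2))"
      using t by (intro mult_left_mono) auto
    then show ?thesis by simp
  qed
  finally show ?thesis by simp
qed

text \<open>Products of Frobenius norms are split by weighted AM-GM, so that the bound is a sum over
  elements and pairs of \<open>J\<close> and can be averaged over all supports.\<close>

lemma quad_mean_gap:
  fixes J :: "nat set" and G G0 H H0 C U :: mat and n :: "nat \<Rightarrow> real"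
  assumes 1: "gram_inverse J G H (1/3)" and 2: "gram_inverse J G0 H0 (1/3)"
    and C: "\<And>i k. i \<in> J \<Longrightarrow> k \<in> J \<Longrightarrow> C i k = G i k + U i k"
    and Ud: "\<And>k. k \<in> J \<Longrightarrow> U k k = - n k / 2" and n0: "\<And>k. k \<in> J \<Longrightarrow> 0 \<le> n k"
    and par: "0 \<le> Ex2" "0 \<le> Eabs" "0 < lam" and t: "t > 0" "t' > 0"
  shows "(1/2) * (quad_mean Ex2 Eabs Eeps lam J G0 G0 H0 - quad_mean Ex2 Eabs Eeps lam J C G H) \<ge>
    (\<Sum>k\<in>J. (1/2) * Ex2 * (n k - (3/8) * (n k)\<^sup>2) - (3/4) * lam * Eabs * n k)
    - (\<Sum>i\<in>J. \<Sum>j\<in>J - {i}. (3/4) * Ex2 * (U i j)\<^sup>2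
        + (3/4) * lam * Eabs * (t * (G i j)\<^sup>2 + (U i j)\<^sup>2 / t)
        + (1/2) * lam\<^sup>2 * ((15/8) * (G i j - G0 i j)\<^sup>2 / t' + (9/8) * t' * (G i j)\<^sup>2 + (3/4) * t' * (G0 i j)\<^sup>2))"
proof -
  interpret A: gram_inverse J G H "1/3" by fact
  interpret B: gram_inverse J G0 H0 "1/3" by fact
  let ?off = "\<lambda>f. \<Sum>i\<in>J. \<Sum>j\<in>J - {i}. f i j :: real"
  define Q where "Q = (\<Sum>k\<in>J. dot J (\<lambda>i. U i k) (app J H (\<lambda>i. U i k)))"
  define V where "V = (\<Sum>i\<in>J. \<Sum>j\<in>J. H i j * U i j)"
  have HC: "(\<Sum>i\<in>J. \<Sum>j\<in>J. H i j * C i j) = card J + V"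
  proof -
    have "(\<Sum>i\<in>J. \<Sum>j\<in>J. H i j * C i j) = (\<Sum>i\<in>J. \<Sum>j\<in>J. H i j * G i j + H i j * U i j)"
      by (intro sum.cong refl) (simp add: C algebra_simps)
    then show ?thesis by (simp add: sum.distrib A.sum_HG V_def)
  qed
  have sumU: "(\<Sum>k\<in>J. U k k) = - (\<Sum>k\<in>J. n k) / 2"
    by (simp add: Ud sum_negf sum_divide_distrib)
  have split_remove: "(\<Sum>j\<in>J. f j) = f i + (\<Sum>j\<in>J - {i}. f j)" if "i \<in> J" for i and f :: "nat \<Rightarrow> real"
    using that A.fin by (rule sum.remove[rotated])
  have Q: "Q \<le> (3/2) * ((\<Sum>k\<in>J. (n k)\<^sup>2 / 4) + ?off (\<lambda>i j. (U i j)\<^sup>2))"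
  proof -
    have "Q \<le> (\<Sum>k\<in>J. (3/2) * (\<Sum>i\<in>J. (U i k)\<^sup>2))"
      unfolding Q_def
    proof (rule sum_mono)
      fix k
      show "dot J (\<lambda>i. U i k) (app J H (\<lambda>i. U i k)) \<le> (3/2) * (\<Sum>i\<in>J. (U i k)\<^sup>2)"
        using A.H_form[of "\<lambda>i. U i k"] by (simp add: dot_self)
    qed
    also have "\<dots> = (3/2) * (\<Sum>i\<in>J. \<Sum>k\<in>J. (U i k)\<^sup>2)"
      unfolding sum_distrib_left[symmetric] by (subst sum.swap) simp
    also have "(\<Sum>i\<in>J. \<Sum>k\<in>J. (U i k)\<^sup>2) = (\<Sum>i\<in>J. (n i)\<^sup>2 / 4 + (\<Sum>k\<in>J - {i}. (U i k)\<^sup>2))"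
    proof (intro sum.cong refl)
      fix i assume i: "i \<in> J"
      show "(\<Sum>k\<in>J. (U i k)\<^sup>2) = (n i)\<^sup>2 / 4 + (\<Sum>k\<in>J - {i}. (U i k)\<^sup>2)"
        by (subst split_remove[OF i]) (simp add: Ud[OF i] power_divide)
    qed
    finally show ?thesis by (simp add: sum.distrib)
  qed
  have V: "- V \<le> (3/4) * (\<Sum>k\<in>J. n k) + (3/4) * ?off (\<lambda>i j. t * (G i j)\<^sup>2 + (U i j)\<^sup>2 / t)"
  proof -
    have "- V = (\<Sum>i\<in>J. H i i * (n i / 2) + (\<Sum>j\<in>J - {i}. - (H i j * U i j)))"
      unfolding V_def sum_negf[symmetric]
    proof (intro sum.cong refl)
      fix i assume i: "i \<in> J"
      show "(\<Sum>j\<in>J. - (H i j * U i j)) = H i i * (n i / 2) + (\<Sum>j\<in>J - {i}. - (H i j * U i j))"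
        by (subst split_remove[OF i]) (simp add: Ud[OF i])
    qed
    also have "\<dots> \<le> (\<Sum>i\<in>J. (3/2) * (n i / 2) + (\<Sum>j\<in>J - {i}. (1/3) * t * (H i j)\<^sup>2 + (3/4) * ((U i j)\<^sup>2 / t)))"
    proof (intro sum_mono add_mono)
      fix i assume i: "i \<in> J"
      show "H i i * (n i / 2) \<le> 3 / 2 * (n i / 2)"
        using A.H_entry[OF i] n0[OF i] by (intro mult_right_mono) auto
    next
      fix i j
      \<comment> \<open>The weight 2/3 compensates the factor 3/2 by which off-diagonal
        \<open>H\<close> may exceed off-diagonal \<open>G\<close> in Frobenius norm, so that both
        squares end with the coefficient 3/4.\<close>
      have "\<bar>H i j * U i j\<bar> \<le> ((2/3) * t * (H i j)\<^sup>2 + (U i j)\<^sup>2 / ((2/3) * t)) / 2"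
        by (rule abs_mult_le_weighted) (use t in simp)
      also have "\<dots> = (1/3) * t * (H i j)\<^sup>2 + (3/4) * ((U i j)\<^sup>2 / t)"
        using t by (simp add: field_simps)
      finally show "- (H i j * U i j) \<le> (1/3) * t * (H i j)\<^sup>2 + (3/4) * ((U i j)\<^sup>2 / t)"
        by linarith
    qed
    finally have V1: "- V \<le> (3/4) * (\<Sum>k\<in>J. n k) + (1/3) * t * ?off (\<lambda>i j. (H i j)\<^sup>2) + (3/4) * ?off (\<lambda>i j. (U i j)\<^sup>2 / t)"
      by (simp add: sum.distrib sum_distrib_left)
    have "?off (\<lambda>i j. (H i j)\<^sup>2) \<le> (9/4) * ?off (\<lambda>i j. (G i j)\<^sup>2)"
    proof -
      have "?off (\<lambda>i j. (H i j)\<^sup>2) = (\<Sum>j\<in>J. \<Sum>i\<in>J - {j}. (H i j - of_bool (i = j))\<^sup>2)"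
      proof (intro sum.cong refl)
        fix i j assume "i \<in> J" "j \<in> J - {i}"
        then show "(H i j)\<^sup>2 = (H j i - of_bool (j = i))\<^sup>2" using A.symH[of i j] by simp
      qed
      also have "\<dots> \<le> (\<Sum>j\<in>J. \<Sum>i\<in>J. (H i j - of_bool (i = j))\<^sup>2)"
        using A.fin by (intro sum_mono sum_mono2) auto
      also have "\<dots> \<le> (9/4) * ?off (\<lambda>i j. (G i j)\<^sup>2)"
        using A.H_minus_id_sum by (simp add: power2_eq_square)
      finally show ?thesis .
    qed
    then have "(1/3) * t * ?off (\<lambda>i j. (H i j)\<^sup>2) \<le> (1/3) * t * ((9/4) * ?off (\<lambda>i j. (G i j)\<^sup>2))"
      using t by (intro mult_left_mono) auto
    then have "- V \<le> (3/4) * (\<Sum>k\<in>J. n k) + (1/3) * t * ((9/4) * ?off (\<lambda>i j. (G i j)\<^sup>2)) + (3/4) * ?off (\<lambda>i j. (U i j)\<^sup>2 / t)"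
      using V1 by linarith
    then show ?thesis by (simp add: sum.distrib sum_distrib_left algebra_simps)
  qed
  have QE: "(\<Sum>i\<in>J. \<Sum>j\<in>J. H i j * (\<Sum>k\<in>J. C i k * C j k)) = card J - (\<Sum>k\<in>J. n k) + Q"
    using A.quad_mean_expand[of C U] C by (simp add: sumU Q_def)
  define T where "T = (\<Sum>i\<in>J. H0 i i) - (\<Sum>i\<in>J. H i i)"
  define T' where "T' = (15/8) * ?off (\<lambda>i j. (G i j - G0 i j)\<^sup>2) / t'
     + (9/8) * t' * ?off (\<lambda>i j. (G i j)\<^sup>2) + (3/4) * t' * ?off (\<lambda>i j. (G0 i j)\<^sup>2)"
  have T: "- T' \<le> T" using two_gram_trace_diff[OF 1 2 t(2)] unfolding T_def T'_def by linarith
  \<comment> \<open>The noise moment drops out, since the trace of \<open>H G\<close> is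
    \<open>card J\<close> for either dictionary. The gain, the sum of the \<open>n k\<close>, comes
    from the diagonal of \<open>U\<close>.\<close>
  have eq: "(1/2) * (quad_mean Ex2 Eabs Eeps lam J G0 G0 H0 - quad_mean Ex2 Eabs Eeps lam J C G H) =
     (1/2) * Ex2 * ((\<Sum>k\<in>J. n k) - Q) + lam * Eabs * V + (1/2) * lam\<^sup>2 * T"
    unfolding B.quad_mean_self unfolding quad_mean_def QE HC A.sum_HG T_def
    by (simp add: field_simps)
  define q where "q = (3/2) * ((\<Sum>k\<in>J. (n k)\<^sup>2 / 4) + ?off (\<lambda>i j. (U i j)\<^sup>2))"
  define v where "v = (3/4) * (\<Sum>k\<in>J. n k) + (3/4) * ?off (\<lambda>i j. t * (G i j)\<^sup>2 + (U i j)\<^sup>2 / t)"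
  have "Ex2 * Q \<le> Ex2 * q" using Q par unfolding q_def by (intro mult_left_mono) auto
  moreover have "(lam * Eabs) * (- V) \<le> (lam * Eabs) * v" using V par unfolding v_def by (intro mult_left_mono) auto
  moreover have "lam\<^sup>2 * (- T') \<le> lam\<^sup>2 * T" using T by (intro mult_left_mono) auto
  ultimately have "(1/2) * (Ex2 * ((\<Sum>k\<in>J. n k) - q)) - lam * Eabs * v - (1/2) * (lam\<^sup>2 * T') \<le>
    (1/2) * (quad_mean Ex2 Eabs Eeps lam J G0 G0 H0 - quad_mean Ex2 Eabs Eeps lam J C G H)"
    unfolding eq unfolding mult_minus_right right_diff_distrib by linarith
  also have "(1/2) * (Ex2 * ((\<Sum>k\<in>J. n k) - q)) - lam * Eabs * v - (1/2) * (lam\<^sup>2 * T') =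
    (\<Sum>k\<in>J. (1/2) * Ex2 * (n k - (3/8) * (n k)\<^sup>2) - (3/4) * lam * Eabs * n k)
    - ?off (\<lambda>i j. (3/4) * Ex2 * (U i j)\<^sup>2
        + (3/4) * lam * Eabs * (t * (G i j)\<^sup>2 + (U i j)\<^sup>2 / t)
        + (1/2) * lam\<^sup>2 * ((15/8) * (G i j - G0 i j)\<^sup>2 / t' + (9/8) * t' * (G i j)\<^sup>2 + (3/4) * t' * (G0 i j)\<^sup>2))"
    unfolding q_def v_def T'_def
    by (simp only: sum.distrib sum_subtractf sum_distrib_left[symmetric] sum_divide_distrib[symmetric]) 
       (simp add: algebra_simps add_divide_distrib)
  finally show ?thesis .
qed

section \<open>Averaging over all supports of size \<open>s\<close>\<close>

lemma card_supersets_of_card: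
  assumes "finite A" "T \<subseteq> A" "card T \<le> s"
  shows "card {S. S \<subseteq> A \<and> card S = s \<and> T \<subseteq> S} = (card A - card T) choose (s - card T)"
proof -
  have finT: "finite T" using assms finite_subset by blast
  have "bij_betw (\<lambda>S. S - T) {S. S \<subseteq> A \<and> card S = s \<and> T \<subseteq> S} {B. B \<subseteq> A - T \<and> card B = s - card T}"
  proof (rule bij_betwI[where g = "\<lambda>B. B \<union> T"])
    show "(\<lambda>S. S - T) \<in> {S. S \<subseteq> A \<and> card S = s \<and> T \<subseteq> S} \<rightarrow> {B. B \<subseteq> A - T \<and> card B = s - card T}"
      using finT by (auto simp: card_Diff_subset)
    show "(\<lambda>B. B \<union> T) \<in> {B. B \<subseteq> A - T \<and> card B = s - card T} \<rightarrow> {S. S \<subseteq> A \<and> card S = s \<and> T \<subseteq> S}"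
    proof (rule Pi_I)
      fix B assume B: "B \<in> {B. B \<subseteq> A - T \<and> card B = s - card T}"
      then have "card (B \<union> T) = card B + card T"
        using assms finT by (intro card_Un_disjoint) (auto intro: finite_subset)
      then show "B \<union> T \<in> {S. S \<subseteq> A \<and> card S = s \<and> T \<subseteq> S}" using B assms by auto
    qed
  qed auto
  then have "card {S. S \<subseteq> A \<and> card S = s \<and> T \<subseteq> S} = card {B. B \<subseteq> A - T \<and> card B = s - card T}"
    by (rule bij_betw_same_card)
  also have "\<dots> = card (A - T) choose (s - card T)" using assms by (intro n_subsets) auto
  finally show ?thesis using assms finT by (simp add: card_Diff_subset)
qed

text \<open>Double counting: a fixed index lies in the fraction \<open>s / p\<close> of all
  supports.\<close>

lemma sum_subsets_linear:
  fixes \<alpha> :: "nat \<Rightarrow> real"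
  assumes s: "1 \<le> s" "s \<le> p"
  shows "(\<Sum>S | S \<subseteq> {..<p} \<and> card S = s. \<Sum>j\<in>S. \<alpha> j) = (p choose s) * (s / p) * (\<Sum>j<p. \<alpha> j)"
proof -
  have "(\<Sum>S | S \<subseteq> {..<p} \<and> card S = s. \<Sum>j\<in>S. \<alpha> j) =
     (\<Sum>S | S \<subseteq> {..<p} \<and> card S = s. \<Sum>j | j \<in> {..<p} \<and> j \<in> S. \<alpha> j)"
    by (intro sum.cong refl) auto
  also have "\<dots> = (\<Sum>j<p. \<Sum>S | S \<in> {S. S \<subseteq> {..<p} \<and> card S = s} \<and> j \<in> S. \<alpha> j)"
    by (rule sum.swap_restrict) auto
  also have "\<dots> = (\<Sum>j<p. (p choose s) * (s / p) * \<alpha> j)"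
  proof (rule sum.cong[OF refl])
    fix j assume "j \<in> {..<p}"
    then have "card {S. S \<subseteq> {..<p} \<and> card S = s \<and> {j} \<subseteq> S} = (p - 1) choose (s - 1)"
      using card_supersets_of_card[of "{..<p}" "{j}" s] s by simp
    moreover have "real p * real ((p - 1) choose (s - 1)) = real s * real (p choose s)"
      using times_binomial_minus1_eq[of s p] s by (metis of_nat_mult not_one_le_zero gr0I)
    ultimately show "(\<Sum>S | S \<in> {S. S \<subseteq> {..<p} \<and> card S = s} \<and> j \<in> S. \<alpha> j) = (p choose s) * (s / p) * \<alpha> j"
      using s by (simp add: field_simps)
  qed
  finally show ?thesis by (simp add: sum_distrib_left)
qed

text \<open>A fixed pair of distinct indices lies in the fraction
  \<open>s (s - 1) / (p (p - 1))\<close> of all supports, at most \<open>(s / p)\<^sup>2\<close>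
  because \<open>s \<le> p\<close>. The second factor \<open>s / p\<close> is what keeps the
  off-diagonal errors small.\<close>

lemma sum_subsets_pairs_le:
  fixes \<beta> :: "nat \<Rightarrow> nat \<Rightarrow> real"
  assumes s: "1 \<le> s" "s \<le> p" and \<beta>: "\<And>i j. 0 \<le> \<beta> i j"
  shows "(\<Sum>S | S \<subseteq> {..<p} \<and> card S = s. \<Sum>i\<in>S. \<Sum>j\<in>S - {i}. \<beta> i j)
    \<le> (p choose s) * (s / p)\<^sup>2 * (\<Sum>i<p. \<Sum>j\<in>{..<p} - {i}. \<beta> i j)"
proof -
  let ?S = "{S. S \<subseteq> {..<p} \<and> card S = s}"
  define P where "P = Sigma {..<p} (\<lambda>i. {..<p} - {i})"
  have finP: "finite P" by (auto simp: P_def)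
  have "(\<Sum>S\<in>?S. \<Sum>i\<in>S. \<Sum>j\<in>S - {i}. \<beta> i j) = (\<Sum>S\<in>?S. \<Sum>ij | ij \<in> P \<and> {fst ij, snd ij} \<subseteq> S. \<beta> (fst ij) (snd ij))"
  proof (rule sum.cong[OF refl])
    fix S assume "S \<in> ?S"
    then have fin: "finite S" and "S \<subseteq> {..<p}" by (auto intro: finite_subset)
    then have "Sigma S (\<lambda>i. S - {i}) = {ij. ij \<in> P \<and> {fst ij, snd ij} \<subseteq> S}" by (auto simp: P_def)
    moreover have "(\<Sum>i\<in>S. \<Sum>j\<in>S - {i}. \<beta> i j) = (\<Sum>(i, j)\<in>Sigma S (\<lambda>i. S - {i}). \<beta> i j)"
      using fin by (intro sum.Sigma) auto
    ultimately show "(\<Sum>i\<in>S. \<Sum>j\<in>S - {i}. \<beta> i j) = (\<Sum>ij | ij \<in> P \<and> {fst ij, snd ij} \<subseteq> S. \<beta> (fst ij) (snd ij))"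
      by (simp add: case_prod_beta)
  qed
  also have "\<dots> = (\<Sum>ij\<in>P. \<Sum>S | S \<in> ?S \<and> {fst ij, snd ij} \<subseteq> S. \<beta> (fst ij) (snd ij))"
    by (rule sum.swap_restrict) (auto simp: finP)
  also have "\<dots> \<le> (\<Sum>ij\<in>P. (p choose s) * (s / p)\<^sup>2 * \<beta> (fst ij) (snd ij))"
  proof (rule sum_mono)
    fix ij assume ij: "ij \<in> P"
    then have ne: "fst ij \<noteq> snd ij" and T1: "{fst ij, snd ij} \<subseteq> {..<p}" by (auto simp: P_def)
    then have c2: "card {fst ij, snd ij} = 2" by simp
    note T = T1 c2
    have p2: "p \<ge> 2" using card_mono[OF _ T1] c2 by simp
    have "real (card {S. S \<subseteq> {..<p} \<and> card S = s \<and> {fst ij, snd ij} \<subseteq> S}) \<le> (p choose s) * (s / p)\<^sup>2"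
    proof (cases "s \<ge> 2")
      \<comment> \<open>For \<open>s = 1\<close> no support contains a pair; the binomial count
        below would meet truncated subtraction here.\<close>
      case False
      have "card S \<ge> 2" if "S \<subseteq> {..<p}" "{fst ij, snd ij} \<subseteq> S" for S
        using card_mono[OF finite_subset[OF that(1)] that(2)] T by simp
      then have "{S. S \<subseteq> {..<p} \<and> card S = s \<and> {fst ij, snd ij} \<subseteq> S} = {}" using False by blast
      then show ?thesis by (simp only: card.empty) simp
    next
      case True
      have c: "card {S. S \<subseteq> {..<p} \<and> card S = s \<and> {fst ij, snd ij} \<subseteq> S} = (p - 2) choose (s - 2)"
        using card_supersets_of_card[of "{..<p}" "{fst ij, snd ij}" s] T True by simp
      have 1: "real p * real ((p - 1) choose (s - 1)) = real s * real (p choose s)"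
        using times_binomial_minus1_eq[of s p] s by (metis of_nat_mult not_one_le_zero gr0I)
      have 2: "(real p - 1) * real ((p - 2) choose (s - 2)) = (real s - 1) * real ((p - 1) choose (s - 1))"
      proof -
        have "(s - 1) * ((p - 1) choose (s - 1)) = (p - 1) * ((p - 1 - 1) choose (s - 1 - 1))"
          using True by (intro times_binomial_minus1_eq) auto
        then have "real ((s - 1) * ((p - 1) choose (s - 1))) = real ((p - 1) * ((p - 2) choose (s - 2)))"
          by (simp add: numeral_2_eq_2)
        then show ?thesis using True p2 by (simp add: of_nat_diff)
      qed
      have "real p * (real p * ((real p - 1) * real ((p - 2) choose (s - 2)))) = (real s - 1) * real p * (real s * real (p choose s))"
        unfolding 2 1[symmetric] by simp
      also have "\<dots> \<le> (real p - 1) * real s * (real s * real (p choose s))"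
        using s by (intro mult_right_mono) (auto simp: algebra_simps)
      finally have "(real p - 1) * (real p * real p * real ((p - 2) choose (s - 2))) \<le> (real p - 1) * (real s * real s * real (p choose s))"
        by (simp add: mult_ac)
      then have "real p * real p * real ((p - 2) choose (s - 2)) \<le> real s * real s * real (p choose s)"
        using p2 by simp
      then show ?thesis unfolding c using p2 by (simp add: field_simps power2_eq_square)
    qed
    then have "real (card {S. S \<subseteq> {..<p} \<and> card S = s \<and> {fst ij, snd ij} \<subseteq> S}) * \<beta> (fst ij) (snd ij) \<le> (p choose s) * (s / p)\<^sup>2 * \<beta> (fst ij) (snd ij)"
      by (rule mult_right_mono) (rule \<beta>)
    then show "(\<Sum>S | S \<in> ?S \<and> {fst ij, snd ij} \<subseteq> S. \<beta> (fst ij) (snd ij)) \<le> (p choose s) * (s / p)\<^sup>2 * \<beta> (fst ij) (snd ij)"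
      by (simp add: conj_assoc)
  qed
  also have "\<dots> = (p choose s) * (s / p)\<^sup>2 * (\<Sum>i<p. \<Sum>j\<in>{..<p} - {i}. \<beta> i j)"
    unfolding P_def by (simp add: sum_distrib_left[symmetric] sum.Sigma case_prod_beta)
  finally show ?thesis .
qed

text \<open>The operator norm bound for the transpose of \<open>D\<close>, applied to each column of
  \<open>E\<close>.\<close>

lemma gram_op_sq_le:
  assumes op: "\<And>x. dot {..<m} (app {..<p} D x) (app {..<p} D x) \<le> b * dot {..<p} x x" and b: "0 \<le> b"
  shows "(\<Sum>i<p. \<Sum>j<p. (gram m D E i j)\<^sup>2) \<le> b * (\<Sum>j<p. gram m E E j j)"
proof -
  have "(\<Sum>i<p. \<Sum>j<p. (gram m D E i j)\<^sup>2) = (\<Sum>j<p. dot {..<p} (cor m D (\<lambda>k. E k j)) (cor m D (\<lambda>k. E k j)))"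
    by (subst sum.swap) (simp add: dot_self cor_def gram_def)
  also have "\<dots> \<le> (\<Sum>j<p. b * gram m E E j j)"
    unfolding gram_def by (intro sum_mono cor_sq_le op b)
  finally show ?thesis by (simp add: sum_distrib_left)
qed

lemma L2_set_pairs: "L2_set (\<lambda>(i, j). f i j) (A \<times> B) = sqrt (\<Sum>i\<in>A. \<Sum>j\<in>B. (f i j)\<^sup>2)"
  by (simp add: L2_set_def sum.cartesian_product case_prod_beta)

text \<open>The gain \<open>Ex2 * \<sigma> * \<rho>\<^sup>2 / 2\<close> loses less than 3/8 of
  \<open>Ex2 * \<sigma> * \<rho>\<^sup>2\<close> to all terms free of \<open>g\<close>, which leaves
  1/8. The terms with \<open>g\<close> have the coefficient 3/2 and, because
  \<open>lam\<^sup>2 \<le> lam * Eabs / 4\<close>, a further 15/16; their sum stays below 3.\<close>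

lemma gap_numeric:
  fixes Ex2 Eabs lam B \<rho> \<sigma> g :: real
  assumes "0 < Ex2" "0 \<le> Eabs" "0 < lam" "1 \<le> B" "0 \<le> g" "0 < \<rho>" "0 < \<sigma>"
    and \<sigma>: "\<sigma> * B\<^sup>2 \<le> 1/16" and \<rho>: "\<rho> \<le> 1/14" and 1: "lam * Eabs \<le> Ex2 / 4" and 2: "lam\<^sup>2 \<le> lam * Eabs / 4"
  shows "(1/8) * Ex2 * \<sigma> * \<rho>\<^sup>2 - 3 * lam * Eabs * B\<^sup>2 * \<sigma>\<^sup>2 * g * \<rho> \<le>
    \<sigma> * ((1/2) * Ex2 * \<rho>\<^sup>2 * (1 - (3/8) * \<rho>\<^sup>2) - (3/4) * lam * Eabs * \<rho>\<^sup>2)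
    - \<sigma>\<^sup>2 * ((3/4) * Ex2 * (B * \<rho>)\<^sup>2 + (3/2) * lam * Eabs * ((B * \<rho>) * (g + 2 * B * \<rho>))
        + (15/8) * lam\<^sup>2 * ((2 * B * \<rho>) * (g + 2 * B * \<rho>)))"
proof -
  define a where "a = \<sigma> * \<rho>\<^sup>2"
  have a0: "0 \<le> a" using assms unfolding a_def by simp
  define w where "w = lam * Eabs"
  have w0: "0 \<le> w" using assms unfolding w_def by simp
  have r2: "\<rho>\<^sup>2 \<le> 1/196"
  proof -
    have "\<rho>\<^sup>2 \<le> (1/14)\<^sup>2" using \<open>0 < \<rho>\<close> \<rho> by (intro power_mono) auto
    then show ?thesis by (simp add: power2_eq_square)
  qed
  have t1: "Ex2 * a * \<rho>\<^sup>2 \<le> Ex2 * a * (1/196)" using r2 a0 \<open>0 < Ex2\<close> by (intro mult_left_mono) auto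
  have t2: "Ex2 * a * (\<sigma> * B\<^sup>2) \<le> Ex2 * a * (1/16)" using \<sigma> a0 \<open>0 < Ex2\<close> by (intro mult_left_mono) auto
  have t3: "w * a * (\<sigma> * B\<^sup>2) \<le> w * a * (1/16)" using \<sigma> a0 w0 by (intro mult_left_mono) auto
  have t4: "w * a \<le> Ex2 / 4 * a" using 1 a0 unfolding w_def by (intro mult_right_mono) auto
  define c where "c = \<sigma>\<^sup>2 * B * \<rho> * g"
  have c0: "0 \<le> c" using assms unfolding c_def by simp
  have t5: "lam\<^sup>2 * c \<le> w / 4 * c" using 2 c0 unfolding w_def by (intro mult_right_mono) auto
  define d where "d = a * (\<sigma> * B\<^sup>2)"
  have d0: "0 \<le> d" using a0 assms unfolding d_def by simp
  have t6: "lam\<^sup>2 * d \<le> w / 4 * d" using 2 d0 unfolding w_def by (intro mult_right_mono) auto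
  have t7: "w * c * 1 \<le> w * c * B" using w0 c0 \<open>1 \<le> B\<close> by (intro mult_left_mono) auto
  have wc0: "0 \<le> w * c" using w0 c0 by simp
  have Ea0: "0 \<le> Ex2 * a" using a0 \<open>0 < Ex2\<close> by simp
  have wa0: "0 \<le> w * a" using a0 w0 by simp
  have lhs: "(1/8) * Ex2 * \<sigma> * \<rho>\<^sup>2 - 3 * lam * Eabs * B\<^sup>2 * \<sigma>\<^sup>2 * g * \<rho> = (1/8) * (Ex2 * a) - 3 * (w * c * B)"
    by (simp add: a_def w_def c_def power2_eq_square)
  have rhs: "\<sigma> * ((1/2) * Ex2 * \<rho>\<^sup>2 * (1 - (3/8) * \<rho>\<^sup>2) - (3/4) * lam * Eabs * \<rho>\<^sup>2)
    - \<sigma>\<^sup>2 * ((3/4) * Ex2 * (B * \<rho>)\<^sup>2 + (3/2) * lam * Eabs * ((B * \<rho>) * (g + 2 * B * \<rho>))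
        + (15/8) * lam\<^sup>2 * ((2 * B * \<rho>) * (g + 2 * B * \<rho>)))
    = (1/2) * (Ex2 * a) - (3/16) * (Ex2 * a * \<rho>\<^sup>2) - (3/4) * (w * a) - (3/4) * (Ex2 * a * (\<sigma> * B\<^sup>2))
      - (3/2) * (w * c) - 3 * (w * a * (\<sigma> * B\<^sup>2)) - (15/4) * (lam\<^sup>2 * c) - (15/2) * (lam\<^sup>2 * d)"
    unfolding a_def w_def c_def d_def by (simp add: power2_eq_square algebra_simps)
  have t8: "w / 4 * d = (1/4) * (w * a * (\<sigma> * B\<^sup>2))" by (simp add: d_def)
  have t9: "w / 4 * c = (1/4) * (w * c)" "Ex2 / 4 * a = (1/4) * (Ex2 * a)" by simp_all
  show ?thesis unfolding lhs rhs using t1 t2 t3 t4 t5 t6 t7 wc0 Ea0 wa0 unfolding t8 t9 by linarith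
qed

text \<open>Diagonal terms are averaged exactly, off-diagonal ones from above. The resulting sums
  over all indices are bounded by operator norm times Frobenius norm, with \<open>B\<close> serving
  for the operator norms of both dictionaries.\<close>

lemma averaged_quad_mean_gap:
  fixes D D0 :: mat and H H0 :: "nat set \<Rightarrow> mat"
  assumes s: "1 \<le> s" "s \<le> p"
    and unit: "\<And>j. j < p \<Longrightarrow> gram m D D j j = 1" "\<And>j. j < p \<Longrightarrow> gram m D0 D0 j j = 1"
    and \<delta>: "\<delta> = (\<lambda>k j. D0 k j - D k j)" and \<rho>: "(\<Sum>j<p. gram m \<delta> \<delta> j j) = \<rho>\<^sup>2" "0 < \<rho>" "\<rho> \<le> 1/14"
    and op: "\<And>x. dot {..<m} (app {..<p} D x) (app {..<p} D x) \<le> B\<^sup>2 * dot {..<p} x x"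
            "\<And>x. dot {..<m} (app {..<p} D0 x) (app {..<p} D0 x) \<le> B\<^sup>2 * dot {..<p} x x"
    and B: "1 \<le> B" "real s / real p * B\<^sup>2 \<le> 1/16"
    and inv: "\<And>S. S \<subseteq> {..<p} \<Longrightarrow> card S = s \<Longrightarrow> gram_inverse S (gram m D D) (H S) (1/3)"
            "\<And>S. S \<subseteq> {..<p} \<Longrightarrow> card S = s \<Longrightarrow> gram_inverse S (gram m D0 D0) (H0 S) (1/3)"
    and par: "0 < Ex2" "0 \<le> Eabs" "0 < lam" "lam * Eabs \<le> Ex2 / 4" "lam\<^sup>2 \<le> lam * Eabs / 4"
  shows "(\<Sum>S | S \<subseteq> {..<p} \<and> card S = s. (1/2) * (quad_mean Ex2 Eabs Eeps lam S (gram m D0 D0) (gram m D0 D0) (H0 S)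
       - quad_mean Ex2 Eabs Eeps lam S (gram m D D0) (gram m D D) (H S)))
    \<ge> (p choose s) * ((1/8) * Ex2 * (s / p) * \<rho>\<^sup>2 - 3 * lam * Eabs * B\<^sup>2 * (s / p)\<^sup>2 * gram_dev m p D0 * \<rho>)"
proof -
  define n where "n = (\<lambda>j. gram m \<delta> \<delta> j j)"
  define g where "g = gram_dev m p D0"
  \<comment> \<open>Bounds for three Frobenius norms: \<open>Us\<close> for
    \<open>D^T \<delta>\<close>, \<open>Ks\<close> for the difference of the Gram matrices, and
    \<open>Es = g + Ks\<close> for the off-diagonal part of either Gram matrix.\<close>
  define Es where "Es = g + 2 * B * \<rho>"
  define Us where "Us = B * \<rho>"
  define Ks where "Ks = 2 * B * \<rho>"
  have g: "0 \<le> g" by (simp add: g_def gram_dev_def sum_nonneg)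
  have pos: "0 < Es" "0 < Us" "0 < Ks" using g B \<rho> by (auto simp: Es_def Us_def Ks_def add_nonneg_pos)
  \<comment> \<open>These ratios balance the weighted AM-GM split: after averaging, the sums of
    squares recombine into the products \<open>Us * Es\<close> and \<open>Ks * Es\<close>.\<close>
  define t where "t = Us / Es"
  define t' where "t' = Ks / Es"
  have tpos: "0 < t" "0 < t'" using pos by (simp_all add: t_def t'_def)
  define \<alpha> where "\<alpha> = (\<lambda>k. (1/2) * Ex2 * (n k - (3/8) * (n k)\<^sup>2) - (3/4) * lam * Eabs * n k)"
  define \<beta> where "\<beta> = (\<lambda>i j. (3/4) * Ex2 * (gram m D \<delta> i j)\<^sup>2
        + (3/4) * lam * Eabs * (t * (gram m D D i j)\<^sup>2 + (gram m D \<delta> i j)\<^sup>2 / t)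
        + (1/2) * lam\<^sup>2 * ((15/8) * (gram m D D i j - gram m D0 D0 i j)\<^sup>2 / t' + (9/8) * t' * (gram m D D i j)\<^sup>2
           + (3/4) * t' * (gram m D0 D0 i j)\<^sup>2))"
  have \<beta>0: "0 \<le> \<beta> i j" for i j using par tpos unfolding \<beta>_def by (intro add_nonneg_nonneg mult_nonneg_nonneg) auto
  have n0: "0 \<le> n j" for j by (simp add: n_def gram_def)
  \<comment> \<open>Unit columns: expanding \<open>|d_k + \<delta>_k|^2 = 1\<close> fixes the inner
    product of \<open>d_k\<close> and \<open>\<delta>_k\<close>.\<close>
  have Ud: "gram m D \<delta> k k = - n k / 2" if "k < p" for k
  proof -
    have "gram m D0 D0 k k = gram m D D k k + 2 * gram m D \<delta> k k + n k"
      unfolding \<delta> n_def gram_def by (simp add: dot_linear dot_commute[of _ "\<lambda>i. D0 i k" "\<lambda>i. D i k"])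
    then show ?thesis using unit[OF that] by simp
  qed
  have "(1/2) * (quad_mean Ex2 Eabs Eeps lam S (gram m D0 D0) (gram m D0 D0) (H0 S)
       - quad_mean Ex2 Eabs Eeps lam S (gram m D D0) (gram m D D) (H S))
     \<ge> (\<Sum>k\<in>S. \<alpha> k) - (\<Sum>i\<in>S. \<Sum>j\<in>S - {i}. \<beta> i j)" if S: "S \<subseteq> {..<p}" "card S = s" for S
    unfolding \<alpha>_def \<beta>_def
  proof (rule quad_mean_gap[OF inv(1)[OF S] inv(2)[OF S] _ _ n0])
    show "gram m D D0 i k = gram m D D i k + gram m D \<delta> i k" for i k
      unfolding \<delta> gram_def by (simp add: dot_linear)
  qed (use S Ud par tpos in auto)
  then have "(\<Sum>S | S \<subseteq> {..<p} \<and> card S = s. (\<Sum>k\<in>S. \<alpha> k) - (\<Sum>i\<in>S. \<Sum>j\<in>S - {i}. \<beta> i j)) \<le>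
    (\<Sum>S | S \<subseteq> {..<p} \<and> card S = s. (1/2) * (quad_mean Ex2 Eabs Eeps lam S (gram m D0 D0) (gram m D0 D0) (H0 S)
       - quad_mean Ex2 Eabs Eeps lam S (gram m D D0) (gram m D D) (H S)))"
    by (intro sum_mono) auto
  moreover have "(\<Sum>S | S \<subseteq> {..<p} \<and> card S = s. (\<Sum>k\<in>S. \<alpha> k) - (\<Sum>i\<in>S. \<Sum>j\<in>S - {i}. \<beta> i j))
     \<ge> (p choose s) * (s / p) * (\<Sum>j<p. \<alpha> j) - (p choose s) * (s / p)\<^sup>2 * (\<Sum>i<p. \<Sum>j\<in>{..<p} - {i}. \<beta> i j)"
    using sum_subsets_linear[OF s, of \<alpha>] sum_subsets_pairs_le[OF s, of \<beta>] \<beta>0 by (simp add: sum_subtractf)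
  moreover have "(\<Sum>j<p. \<alpha> j) \<ge> (1/2) * Ex2 * \<rho>\<^sup>2 * (1 - (3/8) * \<rho>\<^sup>2) - (3/4) * lam * Eabs * \<rho>\<^sup>2"
  proof -
    have "(n k)\<^sup>2 \<le> \<rho>\<^sup>2 * n k" if "k < p" for k
    proof -
      have "n k \<le> \<rho>\<^sup>2" unfolding \<rho>(1)[symmetric] n_def using that
        by (intro member_le_sum) (auto simp: gram_def)
      then show ?thesis using n0[of k] by (simp add: power2_eq_square mult_right_mono)
    qed
    then have "(\<Sum>k<p. (n k)\<^sup>2) \<le> (\<Sum>k<p. \<rho>\<^sup>2 * n k)" by (intro sum_mono) auto
    also have "\<dots> = \<rho>\<^sup>2 * \<rho>\<^sup>2" by (simp add: sum_distrib_left[symmetric] \<rho>(1) n_def)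
    finally have "(1/2) * Ex2 * (3/8) * (\<Sum>k<p. (n k)\<^sup>2) \<le> (1/2) * Ex2 * (3/8) * (\<rho>\<^sup>2 * \<rho>\<^sup>2)"
      using par by (intro mult_left_mono) auto
    moreover have "(\<Sum>j<p. \<alpha> j) = (1/2) * Ex2 * \<rho>\<^sup>2 - (1/2) * Ex2 * (3/8) * (\<Sum>k<p. (n k)\<^sup>2) - (3/4) * lam * Eabs * \<rho>\<^sup>2"
      unfolding \<alpha>_def \<rho>(1)[symmetric] n_def[symmetric]
      unfolding sum_distrib_left sum_subtractf[symmetric]
      by (intro sum.cong refl) (simp add: algebra_simps)
    ultimately show ?thesis by (simp add: algebra_simps)
  qed
  moreover have "(\<Sum>i<p. \<Sum>j\<in>{..<p} - {i}. \<beta> i j) \<le> (3/4) * Ex2 * Us\<^sup>2 + (3/2) * lam * Eabs * (Us * Es)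
        + (15/8) * lam\<^sup>2 * (Ks * Es)"
  proof -
    let ?off = "\<lambda>f. \<Sum>i<p. \<Sum>j\<in>{..<p} - {i}. f i j :: real"
    have off_le: "?off f \<le> (\<Sum>i<p. \<Sum>j<p. f i j)" if "\<And>i j. 0 \<le> f i j" for f
      using that by (intro sum_mono sum_mono2) auto
    have B0: "0 \<le> B\<^sup>2" by simp
    have U2f: "(\<Sum>i<p. \<Sum>j<p. (gram m D \<delta> i j)\<^sup>2) \<le> Us\<^sup>2"
      using gram_op_sq_le[OF op(1) B0, of \<delta>] \<rho>(1) by (simp add: Us_def power_mult_distrib)
    have U2f0: "(\<Sum>i<p. \<Sum>j<p. (gram m D0 \<delta> i j)\<^sup>2) \<le> Us\<^sup>2"
      using gram_op_sq_le[OF op(2) B0, of \<delta>] \<rho>(1) by (simp add: Us_def power_mult_distrib)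
    have U2: "?off (\<lambda>i j. (gram m D \<delta> i j)\<^sup>2) \<le> Us\<^sup>2" using off_le[of "\<lambda>i j. (gram m D \<delta> i j)\<^sup>2"] U2f by simp
    have K2f: "(\<Sum>i<p. \<Sum>j<p. (gram m D D i j - gram m D0 D0 i j)\<^sup>2) \<le> Ks\<^sup>2"
    proof -
      have "(gram m D D i j - gram m D0 D0 i j)\<^sup>2 \<le> 2 * (gram m D \<delta> i j)\<^sup>2 + 2 * (gram m D0 \<delta> j i)\<^sup>2" for i j
      proof -
        have "gram m D D i j - gram m D0 D0 i j = - (gram m D \<delta> i j + gram m D0 \<delta> j i)"
          unfolding \<delta> gram_def by (simp add: dot_linear dot_commute)
        then have "(gram m D D i j - gram m D0 D0 i j)\<^sup>2 = (gram m D \<delta> i j + gram m D0 \<delta> j i)\<^sup>2"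
          by (simp only: power2_minus)
        also have "\<dots> \<le> 2 * (gram m D \<delta> i j)\<^sup>2 + 2 * (gram m D0 \<delta> j i)\<^sup>2"
          using sum_squares_bound[of "gram m D \<delta> i j" "gram m D0 \<delta> j i"] by (simp add: power2_sum)
        finally show ?thesis .
      qed
      then have "(\<Sum>i<p. \<Sum>j<p. (gram m D D i j - gram m D0 D0 i j)\<^sup>2) \<le>
         (\<Sum>i<p. \<Sum>j<p. 2 * (gram m D \<delta> i j)\<^sup>2 + 2 * (gram m D0 \<delta> j i)\<^sup>2)"
        by (intro sum_mono) auto
      also have "\<dots> = 2 * (\<Sum>i<p. \<Sum>j<p. (gram m D \<delta> i j)\<^sup>2) + 2 * (\<Sum>i<p. \<Sum>j<p. (gram m D0 \<delta> j i)\<^sup>2)"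
        by (simp add: sum.distrib sum_distrib_left)
      also have "(\<Sum>i<p. \<Sum>j<p. (gram m D0 \<delta> j i)\<^sup>2) = (\<Sum>i<p. \<Sum>j<p. (gram m D0 \<delta> i j)\<^sup>2)" by (rule sum.swap)
      also have "2 * (\<Sum>i<p. \<Sum>j<p. (gram m D \<delta> i j)\<^sup>2) + 2 * (\<Sum>i<p. \<Sum>j<p. (gram m D0 \<delta> i j)\<^sup>2) \<le> 4 * Us\<^sup>2"
        using U2f U2f0 by linarith
      finally show ?thesis by (simp add: Us_def Ks_def power_mult_distrib)
    qed
    have K2: "?off (\<lambda>i j. (gram m D D i j - gram m D0 D0 i j)\<^sup>2) \<le> Ks\<^sup>2"
      using off_le[of "\<lambda>i j. (gram m D D i j - gram m D0 D0 i j)\<^sup>2"] K2f by simp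
    have gdev: "g = sqrt (\<Sum>i<p. \<Sum>j<p. (gram m D0 D0 i j - of_bool (i = j))\<^sup>2)"
      by (simp add: g_def gram_dev_def gram_def dot_def of_bool_def)
    have off_id: "?off (\<lambda>i j. (G i j)\<^sup>2) = ?off (\<lambda>i j. (G i j - of_bool (i = j))\<^sup>2)" for G :: mat
      by (intro sum.cong refl) auto
    have E02: "?off (\<lambda>i j. (gram m D0 D0 i j)\<^sup>2) \<le> Es\<^sup>2"
    proof -
      have "?off (\<lambda>i j. (gram m D0 D0 i j)\<^sup>2) \<le> g\<^sup>2"
        unfolding off_id[of "gram m D0 D0"] gdev using off_le[of "\<lambda>i j. (gram m D0 D0 i j - of_bool (i = j))\<^sup>2"] by (simp add: sum_nonneg)
      also have "\<dots> \<le> Es\<^sup>2" using g B \<rho> unfolding Es_def by (intro power_mono) auto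
      finally show ?thesis .
    qed
    have E2: "?off (\<lambda>i j. (gram m D D i j)\<^sup>2) \<le> Es\<^sup>2"
    proof -
      have "sqrt (\<Sum>i<p. \<Sum>j<p. (gram m D D i j - of_bool (i = j))\<^sup>2) =
        L2_set (\<lambda>x. (case x of (i, j) \<Rightarrow> gram m D0 D0 i j - of_bool (i = j)) + (case x of (i, j) \<Rightarrow> gram m D D i j - gram m D0 D0 i j)) ({..<p} \<times> {..<p})"
        unfolding L2_set_pairs[symmetric] by (intro L2_set_cong refl) auto
      also have "\<dots> \<le> g + sqrt (\<Sum>i<p. \<Sum>j<p. (gram m D D i j - gram m D0 D0 i j)\<^sup>2)"
        unfolding gdev L2_set_pairs[symmetric] by (rule L2_set_triangle_ineq)
      also have "sqrt (\<Sum>i<p. \<Sum>j<p. (gram m D D i j - gram m D0 D0 i j)\<^sup>2) \<le> Ks"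
        by (rule real_le_lsqrt[OF _ K2f]) (use pos(3) in simp)
      also have "g + Ks = Es" by (simp add: Es_def Ks_def)
      finally have "sqrt (\<Sum>i<p. \<Sum>j<p. (gram m D D i j - of_bool (i = j))\<^sup>2) \<le> Es" by simp
      then have "(\<Sum>i<p. \<Sum>j<p. (gram m D D i j - of_bool (i = j))\<^sup>2) \<le> Es\<^sup>2" by (rule sqrt_le_D)
      then show ?thesis unfolding off_id[of "gram m D D"] using off_le[of "\<lambda>i j. (gram m D D i j - of_bool (i = j))\<^sup>2"] by simp
    qed
    have "?off \<beta> = (3/4) * Ex2 * ?off (\<lambda>i j. (gram m D \<delta> i j)\<^sup>2)
        + (3/4) * lam * Eabs * (t * ?off (\<lambda>i j. (gram m D D i j)\<^sup>2) + ?off (\<lambda>i j. (gram m D \<delta> i j)\<^sup>2) / t)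
        + (1/2) * lam\<^sup>2 * ((15/8) * ?off (\<lambda>i j. (gram m D D i j - gram m D0 D0 i j)\<^sup>2) / t'
           + (9/8) * t' * ?off (\<lambda>i j. (gram m D D i j)\<^sup>2) + (3/4) * t' * ?off (\<lambda>i j. (gram m D0 D0 i j)\<^sup>2))"
      unfolding \<beta>_def by (simp only: sum.distrib sum_distrib_left[symmetric] sum_divide_distrib[symmetric])
    also have "\<dots> \<le> (3/4) * Ex2 * Us\<^sup>2
        + (3/4) * lam * Eabs * (t * Es\<^sup>2 + Us\<^sup>2 / t)
        + (1/2) * lam\<^sup>2 * ((15/8) * Ks\<^sup>2 / t' + (9/8) * t' * Es\<^sup>2 + (3/4) * t' * Es\<^sup>2)"
      using par tpos by (intro add_mono mult_left_mono divide_right_mono U2 E2 K2 E02) auto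
    also have "\<dots> = (3/4) * Ex2 * Us\<^sup>2 + (3/2) * lam * Eabs * (Us * Es) + (15/8) * lam\<^sup>2 * (Ks * Es)"
      unfolding t_def t'_def using pos by (simp add: field_simps power2_eq_square)
    finally show ?thesis .
  qed
  moreover have "0 \<le> (p choose s) * (s / p :: real)" "0 \<le> (p choose s) * (s / p :: real)\<^sup>2" by simp_all
  ultimately have A: "(\<Sum>S | S \<subseteq> {..<p} \<and> card S = s. (1/2) * (quad_mean Ex2 Eabs Eeps lam S (gram m D0 D0) (gram m D0 D0) (H0 S)
       - quad_mean Ex2 Eabs Eeps lam S (gram m D D0) (gram m D D) (H S)))
     \<ge> (p choose s) * (s / p) * ((1/2) * Ex2 * \<rho>\<^sup>2 * (1 - (3/8) * \<rho>\<^sup>2) - (3/4) * lam * Eabs * \<rho>\<^sup>2)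
       - (p choose s) * (s / p)\<^sup>2 * ((3/4) * Ex2 * Us\<^sup>2 + (3/2) * lam * Eabs * (Us * Es) + (15/8) * lam\<^sup>2 * (Ks * Es))"
    by (meson diff_mono mult_left_mono order.trans)
  have "(1/8) * Ex2 * (s / p) * \<rho>\<^sup>2 - 3 * lam * Eabs * B\<^sup>2 * (s / p)\<^sup>2 * g * \<rho> \<le>
    (s / p) * ((1/2) * Ex2 * \<rho>\<^sup>2 * (1 - (3/8) * \<rho>\<^sup>2) - (3/4) * lam * Eabs * \<rho>\<^sup>2)
    - (s / p)\<^sup>2 * ((3/4) * Ex2 * Us\<^sup>2 + (3/2) * lam * Eabs * (Us * Es) + (15/8) * lam\<^sup>2 * (Ks * Es))"
    unfolding Us_def Es_def Ks_def using s B g par \<rho> by (intro gap_numeric) auto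
  then have "(p choose s) * ((1/8) * Ex2 * (s / p) * \<rho>\<^sup>2 - 3 * lam * Eabs * B\<^sup>2 * (s / p)\<^sup>2 * g * \<rho>) \<le>
    (p choose s) * ((s / p) * ((1/2) * Ex2 * \<rho>\<^sup>2 * (1 - (3/8) * \<rho>\<^sup>2) - (3/4) * lam * Eabs * \<rho>\<^sup>2)
    - (s / p)\<^sup>2 * ((3/4) * Ex2 * Us\<^sup>2 + (3/2) * lam * Eabs * (Us * Es) + (15/8) * lam\<^sup>2 * (Ks * Es)))"
    by (intro mult_left_mono) auto
  also have "\<dots> = (p choose s) * (s / p) * ((1/2) * Ex2 * \<rho>\<^sup>2 * (1 - (3/8) * \<rho>\<^sup>2) - (3/4) * lam * Eabs * \<rho>\<^sup>2)
       - (p choose s) * (s / p)\<^sup>2 * ((3/4) * Ex2 * Us\<^sup>2 + (3/2) * lam * Eabs * (Us * Es) + (15/8) * lam\<^sup>2 * (Ks * Es))"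
    by (simp only: right_diff_distrib mult.assoc)
  finally show ?thesis using A unfolding g_def by linarith
qed

section \<open>Kronecker structured constraint sets\<close>

definition frob_ip :: "nat \<Rightarrow> nat \<Rightarrow> mat \<Rightarrow> mat \<Rightarrow> real" where
  "frob_ip m p A B = (\<Sum>i<m. \<Sum>j<p. A i j * B i j)"

lemma frob_norm_sq: "(frob_norm m p A)\<^sup>2 = frob_ip m p A A"
  by (simp add: frob_norm_def frob_ip_def sum_nonneg power2_eq_square[symmetric])

lemma frob_norm_ip: "frob_norm m p A = sqrt (frob_ip m p A A)"
  by (simp add: frob_norm_def frob_ip_def power2_eq_square)

lemma frob_norm_nonneg [simp]: "0 \<le> frob_norm m p A"
  by (simp add: frob_norm_def sum_nonneg)

lemma frob_norm_L2: "frob_norm m p A = L2_set (\<lambda>x. A (fst x) (snd x)) ({..<m} \<times> {..<p})"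
  by (simp add: L2_set_def frob_norm_def sum.cartesian_product case_prod_beta)

lemma frob_norm_cong: "(\<And>i j. i < m \<Longrightarrow> j < p \<Longrightarrow> A i j = B i j) \<Longrightarrow> frob_norm m p A = frob_norm m p B"
  unfolding frob_norm_L2 by (intro L2_set_cong) auto

lemma frob_norm_add_le: "frob_norm m p (\<lambda>i j. A i j + B i j) \<le> frob_norm m p A + frob_norm m p B"
  unfolding frob_norm_L2 by (rule L2_set_triangle_ineq)

lemma frob_norm_zero [simp]: "frob_norm m p (\<lambda>i j. 0) = 0"
  by (simp add: frob_norm_def)

lemma frob_norm_sum_le: "frob_norm m p (\<lambda>i j. \<Sum>k\<in>I. A k i j) \<le> (\<Sum>k\<in>I. frob_norm m p (A k))"
proof (cases "finite I")
  case True
  then show ?thesis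
  proof (induction I rule: finite_induct)
    case (insert a I)
    then show ?case using frob_norm_add_le[of m p "A a" "\<lambda>i j. \<Sum>k\<in>I. A k i j"] by simp
  qed simp
qed simp

lemma frob_norm_scale: "frob_norm m p (\<lambda>i j. c * A i j) = \<bar>c\<bar> * frob_norm m p A"
proof -
  have "frob_ip m p (\<lambda>i j. c * A i j) (\<lambda>i j. c * A i j) = c\<^sup>2 * frob_ip m p A A"
    by (simp add: frob_ip_def sum_distrib_left power2_eq_square mult_ac)
  then show ?thesis by (simp add: frob_norm_ip real_sqrt_mult)
qed

lemma frob_norm_diff_commute: "frob_norm m p (\<lambda>i j. A i j - B i j) = frob_norm m p (\<lambda>i j. B i j - A i j)"
  by (simp add: frob_norm_def power2_commute)

lemma frob_norm_diff_triangle: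
  "frob_norm m p (\<lambda>i j. A i j - C i j) \<le> frob_norm m p (\<lambda>i j. A i j - B i j) + frob_norm m p (\<lambda>i j. B i j - C i j)"
  using frob_norm_add_le[of m p "\<lambda>i j. A i j - B i j" "\<lambda>i j. B i j - C i j"] by simp

lemma abs_entry_le_frob_norm: "i < m \<Longrightarrow> j < p \<Longrightarrow> \<bar>A i j\<bar> \<le> frob_norm m p A"
proof -
  assume ij: "i < m" "j < p"
  have "\<bar>A i j\<bar> \<le> L2_set (\<lambda>x. \<bar>A (fst x) (snd x)\<bar>) ({..<m} \<times> {..<p})"
    using member_le_L2_set[of "{..<m} \<times> {..<p}" "(i, j)" "\<lambda>x. \<bar>A (fst x) (snd x)\<bar>"] ij by simp
  then show ?thesis by (simp add: frob_norm_L2 L2_set_def)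
qed

lemma frob_norm_le_bound:
  assumes "\<And>i j. i < m \<Longrightarrow> j < p \<Longrightarrow> \<bar>A i j\<bar> \<le> h"
  shows "frob_norm m p A \<le> real (m * p) * h"
proof -
  have "frob_norm m p A \<le> (\<Sum>x\<in>{..<m} \<times> {..<p}. \<bar>A (fst x) (snd x)\<bar>)"
    unfolding frob_norm_L2 by (rule L2_set_le_sum_abs)
  also have "\<dots> \<le> (\<Sum>x\<in>{..<m} \<times> {..<p}. h)" using assms by (intro sum_mono) auto
  finally show ?thesis by simp
qed

section \<open>Kronecker products and their parametrisation by normalised factors\<close>

lemma sum_div_mod:
  fixes m n :: nat
  shows "(\<Sum>i<m * n. f (i div n) (i mod n)) = (\<Sum>a<m. \<Sum>b<n. f a b :: 'a :: comm_monoid_add)"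
proof -
  have "(\<Sum>i<m * n. f (i div n) (i mod n)) = (\<Sum>(a, b)\<in>{..<m} \<times> {..<n}. f a b)"
  proof (rule sum.reindex_bij_witness[where i = "\<lambda>(a, b). a * n + b" and j = "\<lambda>i. (i div n, i mod n)"])
    fix x assume x: "x \<in> {..<m} \<times> {..<n}"
    obtain a b where ab: "x = (a, b)" "a < m" "b < n" using x by auto
    have "a * n + b < Suc a * n" using ab by simp
    also have "\<dots> \<le> m * n" using ab by (intro mult_right_mono) auto
    finally show "(case x of (a, b) \<Rightarrow> a * n + b) \<in> {..<m * n}" using ab by simp
  next
    fix i assume "i \<in> {..<m * n}"
    then show "(i div n, i mod n) \<in> {..<m} \<times> {..<n}"
      by (cases n) (auto simp: less_mult_imp_div_less)
  qed (auto simp: case_prod_beta)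
  then show ?thesis by (simp add: sum.cartesian_product)
qed

lemma frob_ip_kron2:
  "frob_ip (m1 * m2) (p1 * p2) (kron2 A m2 p2 B) (kron2 A' m2 p2 B') = frob_ip m1 p1 A A' * frob_ip m2 p2 B B'"
proof -
  have "frob_ip (m1 * m2) (p1 * p2) (kron2 A m2 p2 B) (kron2 A' m2 p2 B') =
    (\<Sum>i<m1 * m2. \<Sum>j<p1 * p2. (A (i div m2) (j div p2) * A' (i div m2) (j div p2)) * (B (i mod m2) (j mod p2) * B' (i mod m2) (j mod p2)))"
    by (simp add: frob_ip_def kron2_def mult_ac)
  also have "\<dots> = (\<Sum>i<m1 * m2. \<Sum>a<p1. \<Sum>b<p2. (A (i div m2) a * A' (i div m2) a) * (B (i mod m2) b * B' (i mod m2) b))"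
    by (intro sum.cong refl sum_div_mod)
  also have "\<dots> = (\<Sum>c<m1. \<Sum>d<m2. \<Sum>a<p1. \<Sum>b<p2. (A c a * A' c a) * (B d b * B' d b))"
    by (rule sum_div_mod)
  also have "\<dots> = (\<Sum>c<m1. \<Sum>d<m2. (\<Sum>a<p1. A c a * A' c a) * (\<Sum>b<p2. B d b * B' d b))"
    by (simp add: sum_product)
  also have "\<dots> = frob_ip m1 p1 A A' * frob_ip m2 p2 B B'"
    by (simp add: frob_ip_def sum_product)
  finally show ?thesis .
qed

lemma frob_norm_kron2:
  "frob_norm (m1 * m2) (p1 * p2) (kron2 A m2 p2 B) = frob_norm m1 p1 A * frob_norm m2 p2 B"
  by (simp add: frob_norm_ip frob_ip_kron2 real_sqrt_mult)

lemma div_mod_less: "i < a * (b::nat) \<Longrightarrow> i div b < a" "i < a * (b::nat) \<Longrightarrow> i mod b < b"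
  by (auto simp: less_mult_imp_div_less) (cases "b = 0"; simp)

text \<open>Norm at most 1, rather than exactly 1, leaves room for a zero summand and for absorbing
  a scalar into one factor. Entries outside the block vanish so that every entry of a factor is
  bounded by 1.\<close>

definition unit_factors :: "nat list \<Rightarrow> nat list \<Rightarrow> mat list \<Rightarrow> bool" where
  "unit_factors ms ps As \<longleftrightarrow> length As = length ms \<and> length ps = length ms \<and>
     (\<forall>n<length ms. frob_norm (ms ! n) (ps ! n) (As ! n) \<le> 1 \<and>
        (\<forall>i j. ms ! n \<le> i \<or> ps ! n \<le> j \<longrightarrow> (As ! n) i j = 0))"

lemma unit_factors_Cons: "unit_factors (m # ms) (p # ps) (A # As) \<longleftrightarrow>
    frob_norm m p A \<le> 1 \<and> (\<forall>i j. m \<le> i \<or> p \<le> j \<longrightarrow> A i j = 0) \<and> unit_factors ms ps As"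
  by (auto simp: unit_factors_def All_less_Suc2)

lemma unit_factors_Nil [simp]: "unit_factors [] [] []"
  by (simp add: unit_factors_def)

text \<open>The Frobenius norm is multiplicative on Kronecker products, so the norms pulled out of
  the factors multiply to the norm of the whole product.\<close>

lemma kron_list_normalise:
  assumes "length As = length ms" "length ps = length ms"
  shows "\<exists>Bs. unit_factors ms ps Bs \<and> (\<forall>i<prod_list ms. \<forall>j<prod_list ps.
    kron_list As ms ps i j = frob_norm (prod_list ms) (prod_list ps) (kron_list As ms ps) * kron_list Bs ms ps i j)"
  using assms
proof (induction As ms ps rule: kron_list.induct)
  case 1
  show ?case by (intro exI[of _ "[]"]) (auto simp: frob_norm_def)
next
  case (2 A As m ms p ps)
  then obtain Bs where Bs: "unit_factors ms ps Bs" "\<And>i j. i < prod_list ms \<Longrightarrow> j < prod_list ps \<Longrightarrow>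
    kron_list As ms ps i j = frob_norm (prod_list ms) (prod_list ps) (kron_list As ms ps) * kron_list Bs ms ps i j"
    by auto
  define f where "f = frob_norm m p A"
  define B where "B = (\<lambda>i j. if i < m \<and> j < p then A i j / f else 0)"
  \<comment> \<open>If \<open>f = 0\<close>, then \<open>A\<close> vanishes on the block, and so
    does \<open>B\<close>, because division by zero yields 0.\<close>
  have AB: "A i j = f * B i j" if "i < m" "j < p" for i j
    using abs_entry_le_frob_norm[OF that, of A] that by (auto simp: B_def f_def)
  have "frob_norm m p B = frob_norm m p (\<lambda>i j. (1/f) * A i j)"
    by (intro frob_norm_cong) (auto simp: B_def)
  also have "\<dots> = \<bar>1/f\<bar> * f" unfolding frob_norm_scale by (simp add: f_def)
  also have "\<dots> \<le> 1" by (cases "f = 0") (auto simp: f_def)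
  finally have "unit_factors (m # ms) (p # ps) (B # Bs)"
    unfolding unit_factors_Cons using Bs by (auto simp: B_def)
  moreover have "kron_list (A # As) (m # ms) (p # ps) i j =
     frob_norm (prod_list (m # ms)) (prod_list (p # ps)) (kron_list (A # As) (m # ms) (p # ps)) * kron_list (B # Bs) (m # ms) (p # ps) i j"
    if "i < prod_list (m # ms)" "j < prod_list (p # ps)" for i j
    using that Bs(2)[of "i mod prod_list ms" "j mod prod_list ps"] AB[of "i div prod_list ms" "j div prod_list ps"]
    by (simp add: kron2_def frob_norm_kron2[unfolded kron2_def] f_def[symmetric] div_mod_less)
  ultimately show ?case by blast
qed auto

lemma frob_norm_kron_list_le:
  "unit_factors ms ps As \<Longrightarrow> frob_norm (prod_list ms) (prod_list ps) (kron_list As ms ps) \<le> 1"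
proof (induction As ms ps rule: kron_list.induct)
  case (2 A As m ms p ps)
  then have "frob_norm m p A * frob_norm (prod_list ms) (prod_list ps) (kron_list As ms ps) \<le> 1 * 1"
    by (intro mult_mono) (auto simp: unit_factors_Cons)
  then show ?case by (simp add: frob_norm_kron2)
qed (auto simp: unit_factors_def frob_norm_def)

text \<open>Telescoping: a difference of products is \<open>A - B\<close> times the first tail plus
  \<open>B\<close> times the difference of the tails, and factors of norm at most 1 cost
  nothing.\<close>

lemma frob_norm_kron_list_diff_le:
  assumes "unit_factors ms ps As" "unit_factors ms ps Bs"
  shows "frob_norm (prod_list ms) (prod_list ps) (\<lambda>i j. kron_list As ms ps i j - kron_list Bs ms ps i j)
    \<le> (\<Sum>n<length ms. frob_norm (ms ! n) (ps ! n) (\<lambda>i j. (As ! n) i j - (Bs ! n) i j))"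
  using assms
proof (induction As ms ps arbitrary: Bs rule: kron_list.induct)
  case 1
  then show ?case by (auto simp: unit_factors_def)
next
  case (2 A As m ms p ps)
  then obtain B Bs' where Bs: "Bs = B # Bs'" by (cases Bs) (auto simp: unit_factors_def)
  let ?M = "prod_list ms" and ?P = "prod_list ps"
  have eq: "(\<lambda>i j. kron2 A ?M ?P (kron_list As ms ps) i j - kron2 B ?M ?P (kron_list Bs' ms ps) i j) =
    (\<lambda>i j. kron2 (\<lambda>i j. A i j - B i j) ?M ?P (kron_list As ms ps) i j
       + kron2 B ?M ?P (\<lambda>i j. kron_list As ms ps i j - kron_list Bs' ms ps i j) i j)"
    by (simp add: kron2_def algebra_simps)
  have "frob_norm (m * ?M) (p * ?P) (\<lambda>i j. kron2 A ?M ?P (kron_list As ms ps) i j - kron2 B ?M ?P (kron_list Bs' ms ps) i j)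
     \<le> frob_norm (m * ?M) (p * ?P) (kron2 (\<lambda>i j. A i j - B i j) ?M ?P (kron_list As ms ps))
      + frob_norm (m * ?M) (p * ?P) (kron2 B ?M ?P (\<lambda>i j. kron_list As ms ps i j - kron_list Bs' ms ps i j))"
    unfolding eq by (rule frob_norm_add_le)
  also have "\<dots> = frob_norm m p (\<lambda>i j. A i j - B i j) * frob_norm ?M ?P (kron_list As ms ps)
      + frob_norm m p B * frob_norm ?M ?P (\<lambda>i j. kron_list As ms ps i j - kron_list Bs' ms ps i j)"
    by (simp only: frob_norm_kron2)
  also have "\<dots> \<le> frob_norm m p (\<lambda>i j. A i j - B i j) * 1
      + 1 * (\<Sum>n<length ms. frob_norm (ms ! n) (ps ! n) (\<lambda>i j. (As ! n) i j - (Bs' ! n) i j))"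
    using 2 frob_norm_kron_list_le[of ms ps As] unfolding Bs
    by (intro add_mono mult_mono) (auto simp: unit_factors_Cons)
  finally show ?case unfolding Bs by (simp add: sum.lessThan_Suc_shift del: sum.lessThan_Suc)
qed (auto simp: unit_factors_def)

lemma kron_list_scale_hd:
  "kron_list ((\<lambda>i j. a * A i j) # As) (m # ms) (p # ps) i j = a * kron_list (A # As) (m # ms) (p # ps) i j"
  by (simp add: kron2_def)

text \<open>A parameter \<open>\<theta> (k, n, i, j)\<close> is the entry \<open>(i, j)\<close> of the \<open>n\<close>-th factor of the \<open>k\<close>-th summand; all factors
  lie in unit Frobenius balls and \<open>synth\<close> carries the common scale \<open>c\<close>.\<close>

definition fac :: "nat \<Rightarrow> (nat \<times> nat \<times> nat \<times> nat \<Rightarrow> real) \<Rightarrow> nat \<Rightarrow> mat list" where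
  "fac N \<theta> k = map (\<lambda>n i j. \<theta> (k, n, i, j)) [0..<N]"

definition synth :: "real \<Rightarrow> nat \<Rightarrow> nat list \<Rightarrow> nat list \<Rightarrow> (nat \<times> nat \<times> nat \<times> nat \<Rightarrow> real) \<Rightarrow> mat" where
  "synth c r ms ps \<theta> = (\<lambda>i j. if i < prod_list ms \<and> j < prod_list ps
     then c * (\<Sum>k<r. kron_list (fac (length ms) \<theta> k) ms ps i j) else 0)"

text \<open>The bound on every coordinate, including those that belong to no factor, places the set
  inside a Tychonoff cube, where compactness is available.\<close>

definition params :: "nat \<Rightarrow> nat list \<Rightarrow> nat list \<Rightarrow> (nat \<times> nat \<times> nat \<times> nat \<Rightarrow> real) set" where
  "params r ms ps = {\<theta>. (\<forall>x. \<bar>\<theta> x\<bar> \<le> 1) \<and> (\<forall>k<r. unit_factors ms ps (fac (length ms) \<theta> k))}"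

text \<open>A summand of norm \<open>f \<le> c\<close> is \<open>c\<close> times a product of unit
  factors whose first factor is shrunk by \<open>f / c\<close>; conversely the scale
  \<open>c\<close> is absorbed by the first factor, which exists because \<open>ms\<close> is
  nonempty.\<close>

lemma cK_set_eq:
  assumes c: "c > 0" and len: "length ps = length ms" "ms \<noteq> []"
  shows "cK_set ms ps r c = oblique (prod_list ms) (prod_list ps) \<inter> synth c r ms ps ` params r ms ps"
proof (intro equalityI subsetI)
  obtain m ms' p ps' where mp: "ms = m # ms'" "ps = p # ps'"
    using len by (metis length_0_conv neq_Nil_conv)
  fix D
  {
    assume D: "D \<in> cK_set ms ps r c"
    then obtain F where F: "\<And>k. k < r \<Longrightarrow> length (F k) = length ms"
      "\<And>k. k < r \<Longrightarrow> frob_norm (prod_list ms) (prod_list ps) (kron_list (F k) ms ps) \<le> c"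
      "\<And>i j. i < prod_list ms \<Longrightarrow> j < prod_list ps \<Longrightarrow> D i j = (\<Sum>k<r. kron_list (F k) ms ps i j)"
      and obl: "D \<in> oblique (prod_list ms) (prod_list ps)" unfolding cK_set_def by blast
    have "\<exists>Bs. unit_factors ms ps Bs \<and> (\<forall>i<prod_list ms. \<forall>j<prod_list ps.
        kron_list (F k) ms ps i j = c * kron_list Bs ms ps i j)" if k: "k < r" for k
    proof -
      define f where "f = frob_norm (prod_list ms) (prod_list ps) (kron_list (F k) ms ps)"
      obtain Bs where Bs: "unit_factors ms ps Bs" "\<And>i j. i < prod_list ms \<Longrightarrow> j < prod_list ps \<Longrightarrow>
          kron_list (F k) ms ps i j = f * kron_list Bs ms ps i j"
        using kron_list_normalise[of "F k" ms ps] F(1)[OF k] len unfolding f_def by auto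
      obtain B Bs' where BB: "Bs = B # Bs'" using Bs(1) mp by (cases Bs) (auto simp: unit_factors_def)
      have fc: "0 \<le> f / c" "f / c \<le> 1" using F(2)[OF k] c by (auto simp: f_def)
      have "frob_norm m p (\<lambda>i j. (f / c) * B i j) \<le> 1"
      proof -
        have "\<bar>f / c\<bar> * frob_norm m p B \<le> 1 * 1"
          using fc Bs(1) unfolding mp BB unit_factors_Cons by (intro mult_mono) auto
        then show ?thesis by (simp only: frob_norm_scale mult_1)
      qed
      then have "unit_factors ms ps ((\<lambda>i j. (f / c) * B i j) # Bs')"
        using Bs(1) unfolding mp BB unit_factors_Cons by simp
      moreover have "kron_list (F k) ms ps i j = c * kron_list ((\<lambda>i j. (f / c) * B i j) # Bs') ms ps i j"
        if "i < prod_list ms" "j < prod_list ps" for i j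
        using Bs(2)[OF that] c unfolding mp BB kron_list_scale_hd by simp
      ultimately show ?thesis by blast
    qed
    then obtain Bs where Bs: "\<And>k. k < r \<Longrightarrow> unit_factors ms ps (Bs k)"
      "\<And>k i j. k < r \<Longrightarrow> i < prod_list ms \<Longrightarrow> j < prod_list ps \<Longrightarrow> kron_list (F k) ms ps i j = c * kron_list (Bs k) ms ps i j"
      by metis
    define \<theta> where "\<theta> = (\<lambda>(k, n, i, j). if k < r \<and> n < length ms then (Bs k ! n) i j else 0)"
    have fac: "fac (length ms) \<theta> k = Bs k" if "k < r" for k
      unfolding fac_def using Bs(1)[OF that] that by (intro nth_equalityI) (auto simp: unit_factors_def \<theta>_def)
    have "\<bar>\<theta> (k, n, i, j)\<bar> \<le> 1" for k n i j
    proof (cases "k < r \<and> n < length ms \<and> i < ms ! n \<and> j < ps ! n")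
      case True
      then have "\<bar>(Bs k ! n) i j\<bar> \<le> frob_norm (ms ! n) (ps ! n) (Bs k ! n)" by (intro abs_entry_le_frob_norm) auto
      then show ?thesis using True Bs(1)[of k] unfolding unit_factors_def \<theta>_def by fastforce
    next
      case False
      then show ?thesis using Bs(1)[of k] unfolding unit_factors_def \<theta>_def by (auto simp: not_less)
    qed
    then have "\<theta> \<in> params r ms ps" using Bs(1) by (auto simp: params_def fac)
    moreover have "D = synth c r ms ps \<theta>"
    proof (intro ext)
      fix i j
      show "D i j = synth c r ms ps \<theta> i j"
      proof (cases "i < prod_list ms \<and> j < prod_list ps")
        case True
        then show ?thesis using F(3) Bs(2) by (simp add: synth_def fac sum_distrib_left)
      next
        case False
        then show ?thesis using obl by (auto simp: synth_def oblique_def not_less)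
      qed
    qed
    ultimately show "D \<in> oblique (prod_list ms) (prod_list ps) \<inter> synth c r ms ps ` params r ms ps"
      using obl by blast
  next
    assume "D \<in> oblique (prod_list ms) (prod_list ps) \<inter> synth c r ms ps ` params r ms ps"
    then obtain \<theta> where obl: "D \<in> oblique (prod_list ms) (prod_list ps)" and \<theta>: "\<theta> \<in> params r ms ps" "D = synth c r ms ps \<theta>"
      by blast
    define F where "F = (\<lambda>k. (\<lambda>i j. c * hd (fac (length ms) \<theta> k) i j) # tl (fac (length ms) \<theta> k))"
    have ne: "fac (length ms) \<theta> k \<noteq> []" for k using len by (simp add: fac_def)
    have lenF: "length (F k) = length ms" for k
      unfolding F_def using ne[of k] len(2) by (simp add: fac_def)
    have FK: "kron_list (F k) ms ps i j = c * kron_list (fac (length ms) \<theta> k) ms ps i j" for k i j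
      unfolding F_def mp kron_list_scale_hd using ne[of k] unfolding mp by simp
    have "frob_norm (prod_list ms) (prod_list ps) (kron_list (F k) ms ps) \<le> c" if "k < r" for k
    proof -
      have "frob_norm (prod_list ms) (prod_list ps) (kron_list (F k) ms ps) =
        frob_norm (prod_list ms) (prod_list ps) (\<lambda>i j. c * kron_list (fac (length ms) \<theta> k) ms ps i j)"
        by (simp only: FK[abs_def])
      also have "\<dots> = c * frob_norm (prod_list ms) (prod_list ps) (kron_list (fac (length ms) \<theta> k) ms ps)"
        using c by (simp add: frob_norm_scale)
      also have "\<dots> \<le> c * 1" using \<theta>(1) that c by (intro mult_left_mono frob_norm_kron_list_le) (auto simp: params_def)
      finally show ?thesis by simp
    qed
    then show "D \<in> cK_set ms ps r c"
      unfolding cK_set_def using obl lenF FK \<theta>(2)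
      by (auto intro!: exI[of _ F] simp: synth_def sum_distrib_left)
  }
qed

lemma frob_norm_synth_diff_le:
  assumes "\<theta> \<in> params r ms ps" "\<theta>' \<in> params r ms ps" "0 \<le> c" "length ps = length ms"
    and close: "\<And>k n i j. k < r \<Longrightarrow> n < length ms \<Longrightarrow> i < ms ! n \<Longrightarrow> j < ps ! n \<Longrightarrow> \<bar>\<theta> (k, n, i, j) - \<theta>' (k, n, i, j)\<bar> \<le> h"
  shows "frob_norm (prod_list ms) (prod_list ps) (\<lambda>i j. synth c r ms ps \<theta> i j - synth c r ms ps \<theta>' i j)
    \<le> c * (real (r * (\<Sum>n<length ms. ms ! n * ps ! n)) * h)"
proof -
  let ?M = "prod_list ms" and ?P = "prod_list ps" and ?N = "length ms"
  have "frob_norm ?M ?P (\<lambda>i j. synth c r ms ps \<theta> i j - synth c r ms ps \<theta>' i j) =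
    frob_norm ?M ?P (\<lambda>i j. c * (\<Sum>k<r. kron_list (fac ?N \<theta> k) ms ps i j - kron_list (fac ?N \<theta>' k) ms ps i j))"
    by (intro frob_norm_cong) (simp add: synth_def sum_subtractf algebra_simps)
  also have "\<dots> = c * frob_norm ?M ?P (\<lambda>i j. \<Sum>k<r. kron_list (fac ?N \<theta> k) ms ps i j - kron_list (fac ?N \<theta>' k) ms ps i j)"
    using assms(3) by (simp only: frob_norm_scale abs_of_nonneg)
  also have "\<dots> \<le> c * (\<Sum>k<r. \<Sum>n<?N. real (ms ! n * ps ! n) * h)"
  proof (rule mult_left_mono[OF _ assms(3)], rule order.trans[OF frob_norm_sum_le], rule sum_mono)
    fix k assume k: "k \<in> {..<r}"
    have "frob_norm ?M ?P (\<lambda>i j. kron_list (fac ?N \<theta> k) ms ps i j - kron_list (fac ?N \<theta>' k) ms ps i j) \<le>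
      (\<Sum>n<?N. frob_norm (ms ! n) (ps ! n) (\<lambda>i j. (fac ?N \<theta> k ! n) i j - (fac ?N \<theta>' k ! n) i j))"
      using assms(1,2) k by (intro frob_norm_kron_list_diff_le) (auto simp: params_def)
    also have "\<dots> \<le> (\<Sum>n<?N. real (ms ! n * ps ! n) * h)"
      using k close by (intro sum_mono frob_norm_le_bound) (auto simp: fac_def)
    finally show "frob_norm ?M ?P (\<lambda>i j. kron_list (fac ?N \<theta> k) ms ps i j - kron_list (fac ?N \<theta>' k) ms ps i j)
       \<le> (\<Sum>n<?N. real (ms ! n * ps ! n) * h)" .
  qed
  also have "(\<Sum>k<r. \<Sum>n<?N. real (ms ! n * ps ! n) * h) = real (r * (\<Sum>n<?N. ms ! n * ps ! n)) * h"
    by (simp add: sum_distrib_right sum_distrib_left mult_ac)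
  finally show ?thesis .
qed

text \<open>The parameters are rounded to a grid of width \<open>h = \<eta> / (c * d)\<close>, and
  one matrix is kept for each rounding pattern that occurs in \<open>S\<close>. The net therefore
  lies inside \<open>S\<close>; this matters because the expected gap is known only at distance
  exactly \<open>\<rho>\<close> from \<open>D0\<close>.\<close>

lemma synth_net:
  assumes S: "S \<subseteq> synth c r ms ps ` params r ms ps" and c: "0 < c" and len: "length ps = length ms"
    and d: "d = r * (\<Sum>n<length ms. ms ! n * ps ! n)" "1 \<le> d" and \<eta>: "0 < \<eta>" "\<eta> \<le> c * d"
  shows "\<exists>Q\<subseteq>S. finite Q \<and> real (card Q) \<le> (4 * c * d / \<eta>) ^ d \<and>
    (\<forall>D\<in>S. \<exists>D'\<in>Q. frob_norm (prod_list ms) (prod_list ps) (\<lambda>i j. D i j - D' i j) \<le> \<eta>)"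
proof -
  define h where "h = \<eta> / (c * d)"
  have h: "0 < h" "h \<le> 1" using c d \<eta> by (auto simp: h_def field_simps)
  define I where "I = Sigma {..<r} (\<lambda>k. Sigma {..<length ms} (\<lambda>n. {..<ms ! n} \<times> {..<ps ! n}))"
  have I: "finite I" "card I = d" by (auto simp: I_def d(1) card_SigmaI)
  define V where "V = {\<lfloor>- 1 / h\<rfloor>..\<lfloor>1 / h\<rfloor>}"
  have cardV: "real (card V) \<le> 4 / h"
  proof -
    \<comment> \<open>The number of grid values is at most \<open>2 / h + 2\<close>, and
      \<open>h \<le> 1\<close> turns this into \<open>4 / h\<close>.\<close>
    have "real_of_int (\<lfloor>1 / h\<rfloor> - \<lfloor>- 1 / h\<rfloor> + 1) \<le> 1 / h + (1 / h + 1) + 1" by linarith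
    also have "\<dots> \<le> 4 / h" using h by (simp add: field_simps)
    finally have 1: "real_of_int (\<lfloor>1 / h\<rfloor> - \<lfloor>- 1 / h\<rfloor> + 1) \<le> 4 / h" .
    have "- 1 / h \<le> 1 / h" using h by (simp add: field_simps)
    then have "\<lfloor>- 1 / h\<rfloor> \<le> \<lfloor>1 / h\<rfloor>" by (rule floor_mono)
    then have "real (card V) = real_of_int (\<lfloor>1 / h\<rfloor> - \<lfloor>- 1 / h\<rfloor> + 1)" by (simp add: V_def)
    then show ?thesis using 1 by linarith
  qed
  define code where "code = (\<lambda>\<theta>. restrict (\<lambda>x. \<lfloor>\<theta> x / h :: real\<rfloor>) I)"
  have codeV: "code \<theta> \<in> I \<rightarrow>\<^sub>E V" if "\<theta> \<in> params r ms ps" for \<theta>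
  proof -
    have "- 1 / h \<le> \<theta> x / h \<and> \<theta> x / h \<le> 1 / h" for x
    proof -
      have "\<bar>\<theta> x\<bar> \<le> 1" using that unfolding params_def by blast
      then have "- 1 \<le> \<theta> x" "\<theta> x \<le> 1" by linarith+
      then show ?thesis using h by (intro conjI divide_right_mono) auto
    qed
    then have "\<lfloor>\<theta> x / h\<rfloor> \<in> V" for x unfolding V_def atLeastAtMost_iff by (intro conjI floor_mono) blast+
    then show ?thesis unfolding code_def by (intro restrict_PiE_iff[THEN iffD2]) blast
  qed
  have "\<forall>D\<in>S. \<exists>\<theta>\<in>params r ms ps. D = synth c r ms ps \<theta>" using S by blast
  then obtain th where th: "\<And>D. D \<in> S \<Longrightarrow> th D \<in> params r ms ps" "\<And>D. D \<in> S \<Longrightarrow> D = synth c r ms ps (th D)"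
    by metis
  define cd where "cd = (\<lambda>D. code (th D))"
  define rep where "rep = (\<lambda>w. SOME D. D \<in> S \<and> cd D = w)"
  have rep: "rep (cd D) \<in> S \<and> cd (rep (cd D)) = cd D" if "D \<in> S" for D
    unfolding rep_def by (rule someI[where x = D]) (use that in simp)
  define Q where "Q = rep ` cd ` S"
  have sub: "cd ` S \<subseteq> I \<rightarrow>\<^sub>E V" using codeV th by (auto simp: cd_def)
  have fin: "finite (I \<rightarrow>\<^sub>E V)" using I by (intro finite_PiE) (auto simp: V_def)
  have finS: "finite (cd ` S)" using sub fin finite_subset by blast
  have "card Q \<le> card (cd ` S)" unfolding Q_def by (rule card_image_le[OF finS])
  also have "\<dots> \<le> card (I \<rightarrow>\<^sub>E V)" by (rule card_mono[OF fin sub])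
  also have "\<dots> = card V ^ d" using I by (simp add: card_PiE)
  finally have "real (card Q) \<le> real (card V) ^ d" by (metis of_nat_le_iff of_nat_power)
  also have "\<dots> \<le> (4 / h) ^ d" using cardV by (intro power_mono) auto
  also have "4 / h = 4 * c * d / \<eta>" by (simp add: h_def)
  finally have "real (card Q) \<le> (4 * c * d / \<eta>) ^ d" .
  moreover have "\<exists>D'\<in>Q. frob_norm (prod_list ms) (prod_list ps) (\<lambda>i j. D i j - D' i j) \<le> \<eta>" if D: "D \<in> S" for D
  proof (rule bexI[of _ "rep (cd D)"])
    define E where "E = rep (cd D)"
    have E: "E \<in> S" "cd E = cd D" using rep[OF D] by (simp_all add: E_def)
    have "\<bar>th D x - th E x\<bar> \<le> h" if "x \<in> I" for x
    proof -
      have "\<lfloor>th D x / h\<rfloor> = \<lfloor>th E x / h\<rfloor>" using E(2) that by (metis cd_def code_def restrict_apply')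
      then have "\<bar>th D x / h - th E x / h\<bar> \<le> 1" by linarith
      then show ?thesis using h by (simp add: diff_divide_distrib[symmetric] abs_divide)
    qed
    then have "frob_norm (prod_list ms) (prod_list ps) (\<lambda>i j. synth c r ms ps (th D) i j - synth c r ms ps (th E) i j) \<le> c * (real d * h)"
      unfolding d(1) using th D E c len by (intro frob_norm_synth_diff_le) (auto simp: I_def)
    also have "\<dots> = \<eta>" using c d(2) by (simp add: h_def)
    finally show "frob_norm (prod_list ms) (prod_list ps) (\<lambda>i j. D i j - rep (cd D) i j) \<le> \<eta>"
      unfolding E_def[symmetric] using th(2)[OF D] th(2)[OF E(1)] by simp
    show "rep (cd D) \<in> Q" using D by (auto simp: Q_def)
  qed
  moreover have "Q \<subseteq> S" using rep by (auto simp: Q_def)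
  ultimately show ?thesis using finS unfolding Q_def by (intro exI[of _ Q]) (auto simp: Q_def)
qed

section \<open>Continuity in the parameters and compactness\<close>

lemma continuous_on_kron_list:
  "continuous_on UNIV (\<lambda>\<theta> :: nat \<times> nat \<times> nat \<times> nat \<Rightarrow> real. kron_list (map (\<lambda>n i j. \<theta> (k, n, i, j)) ns) ms ps i j)"
proof (induction ns arbitrary: ms ps i j)
  case Nil
  show ?case by (cases ms; cases ps) (auto intro!: continuous_intros)
next
  case (Cons n ns)
  show ?case
  proof (cases "ms = [] \<or> ps = []")
    case True
    then show ?thesis by (cases ms; cases ps) (auto intro!: continuous_intros)
  next
    case False
    then obtain m ms' p ps' where "ms = m # ms'" "ps = p # ps'" by (metis neq_Nil_conv)
    then show ?thesis
      by (auto simp: kron2_def intro!: continuous_intros Cons.IH continuous_on_product_coordinates)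
  qed
qed

lemma continuous_on_synth: "continuous_on UNIV (\<lambda>\<theta>. synth c r ms ps \<theta> i j)"
  unfolding synth_def fac_def
  by (cases "i < prod_list ms \<and> j < prod_list ps") (auto intro!: continuous_intros continuous_on_kron_list)

lemma continuous_on_frob_synth: "continuous_on UNIV (\<lambda>\<theta>. frob_norm m p (\<lambda>i j. synth c r ms ps \<theta> i j - A i j))"
  unfolding frob_norm_def by (intro continuous_intros continuous_on_synth)

text \<open>Tychonoff's theorem, in the topology of pointwise convergence.\<close>

lemma compact_params_box: "compact {\<theta> :: 'a \<Rightarrow> real. \<forall>x. \<bar>\<theta> x\<bar> \<le> 1}"
proof -
  have "compactin (product_topology (\<lambda>_. euclidean) UNIV) (PiE (UNIV :: 'a set) (\<lambda>_. {-1..1::real}))"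
    unfolding compactin_PiE by simp
  then have "compact (PiE (UNIV :: 'a set) (\<lambda>_. {-1..1::real}))"
    by (simp add: euclidean_product_topology)
  moreover have "PiE (UNIV :: 'a set) (\<lambda>_. {-1..1::real}) = {\<theta>. \<forall>x. \<bar>\<theta> x\<bar> \<le> 1}"
    by (auto simp: abs_le_iff minus_le_iff)
  ultimately show ?thesis by simp
qed

text \<open>Compactness is used in parameter space, where unit columns, factor norms and the ball
  are all closed conditions. For \<open>\<Phi>\<close> only continuity in Frobenius distance within
  the constraint set is assumed, and \<open>synth\<close> carries it over to the parameters.\<close>

lemma synth_attains_min:
  fixes \<Phi> :: "mat \<Rightarrow> real"
  defines "K \<equiv> \<lambda>c r ms ps. oblique (prod_list ms) (prod_list ps) \<inter> synth c r ms ps ` params r ms ps"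
  assumes D0: "D0 \<in> K c r ms ps" and len: "length ps = length ms" and \<rho>: "0 \<le> \<rho>"
    and cont: "\<And>D e. D \<in> K c r ms ps \<Longrightarrow> 0 < e \<Longrightarrow> \<exists>d>0. \<forall>D'\<in>K c r ms ps.
      frob_norm (prod_list ms) (prod_list ps) (\<lambda>i j. D' i j - D i j) < d \<longrightarrow> \<bar>\<Phi> D' - \<Phi> D\<bar> < e"
  shows "\<exists>D\<in>K c r ms ps. frob_norm (prod_list ms) (prod_list ps) (\<lambda>i j. D i j - D0 i j) \<le> \<rho> \<and>
    (\<forall>D'\<in>K c r ms ps. frob_norm (prod_list ms) (prod_list ps) (\<lambda>i j. D' i j - D0 i j) \<le> \<rho> \<longrightarrow> \<Phi> D \<le> \<Phi> D')"
proof -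
  let ?M = "prod_list ms" and ?P = "prod_list ps" and ?s = "synth c r ms ps"
  define T where "T = {\<theta> \<in> params r ms ps. ?s \<theta> \<in> oblique ?M ?P \<and> frob_norm ?M ?P (\<lambda>i j. ?s \<theta> i j - D0 i j) \<le> \<rho>}"
  have T_eq: "T = {\<theta>. \<forall>x. \<bar>\<theta> x\<bar> \<le> 1} \<inter>
     ((\<Inter>k\<in>{..<r}. \<Inter>n\<in>{..<length ms}. {\<theta>. frob_norm (ms ! n) (ps ! n) (\<lambda>i j. \<theta> (k, n, i, j)) \<le> 1} \<inter>
        (\<Inter>x\<in>{(i, j). ms ! n \<le> i \<or> ps ! n \<le> j}. {\<theta>. \<theta> (k, n, fst x, snd x) = 0})) \<inter>
     (\<Inter>j\<in>{..<?P}. {\<theta>. (\<Sum>i<?M. (?s \<theta> i j)\<^sup>2) = 1}) \<inter> {\<theta>. frob_norm ?M ?P (\<lambda>i j. ?s \<theta> i j - D0 i j) \<le> \<rho>})"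
    unfolding T_def params_def unit_factors_def oblique_def
    using len by (auto simp: fac_def synth_def)
  have "closed ((\<Inter>k\<in>{..<r}. \<Inter>n\<in>{..<length ms}. {\<theta>. frob_norm (ms ! n) (ps ! n) (\<lambda>i j. \<theta> (k, n, i, j)) \<le> 1} \<inter>
        (\<Inter>x\<in>{(i, j). ms ! n \<le> i \<or> ps ! n \<le> j}. {\<theta>. \<theta> (k, n, fst x, snd x) = 0})) \<inter>
     (\<Inter>j\<in>{..<?P}. {\<theta>. (\<Sum>i<?M. (?s \<theta> i j)\<^sup>2) = 1}) \<inter> {\<theta>. frob_norm ?M ?P (\<lambda>i j. ?s \<theta> i j - D0 i j) \<le> \<rho>})"
    unfolding frob_norm_def
    by (intro closed_Int closed_INT ballI closed_Collect_le closed_Collect_eq continuous_intros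
        continuous_on_synth continuous_on_product_coordinates)
  then have comp: "compact T" unfolding T_eq by (intro compact_Int_closed compact_params_box)
  obtain \<theta>0 where "\<theta>0 \<in> params r ms ps" "D0 = ?s \<theta>0" "D0 \<in> oblique ?M ?P" using D0 unfolding K_def by blast
  then have ne: "T \<noteq> {}" using \<rho> unfolding T_def by auto
  have TK: "?s \<theta> \<in> K c r ms ps" if "\<theta> \<in> T" for \<theta> using that by (auto simp: T_def K_def)
  have "continuous_on T (\<lambda>\<theta>. \<Phi> (?s \<theta>))"
    unfolding continuous_on_def
  proof (intro ballI tendstoI)
    fix \<theta> and e :: real assume \<theta>: "\<theta> \<in> T" and e: "0 < e"
    from cont[OF TK[OF \<theta>] e] obtain d where d: "d > 0"
      "\<And>D'. D' \<in> K c r ms ps \<Longrightarrow> frob_norm ?M ?P (\<lambda>i j. D' i j - ?s \<theta> i j) < d \<Longrightarrow> \<bar>\<Phi> D' - \<Phi> (?s \<theta>)\<bar> < e"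
      by blast
    have "((\<lambda>\<theta>'. frob_norm ?M ?P (\<lambda>i j. ?s \<theta>' i j - ?s \<theta> i j)) \<longlongrightarrow> frob_norm ?M ?P (\<lambda>i j. ?s \<theta> i j - ?s \<theta> i j)) (at \<theta> within T)"
      using continuous_on_subset[OF continuous_on_frob_synth, of T] \<theta> unfolding continuous_on_def by blast
    then have "((\<lambda>\<theta>'. frob_norm ?M ?P (\<lambda>i j. ?s \<theta>' i j - ?s \<theta> i j)) \<longlongrightarrow> 0) (at \<theta> within T)" by simp
    then have "\<forall>\<^sub>F \<theta>' in at \<theta> within T. frob_norm ?M ?P (\<lambda>i j. ?s \<theta>' i j - ?s \<theta> i j) < d"
      using d(1) by (rule order_tendstoD)
    moreover have "\<forall>\<^sub>F \<theta>' in at \<theta> within T. \<theta>' \<in> T" by (simp add: eventually_at_filter)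
    ultimately show "\<forall>\<^sub>F \<theta>' in at \<theta> within T. dist (\<Phi> (?s \<theta>')) (\<Phi> (?s \<theta>)) < e"
      by eventually_elim (simp add: dist_real_def d(2) TK)
  qed
  from continuous_attains_inf[OF comp ne this] obtain \<theta> where \<theta>: "\<theta> \<in> T" "\<And>\<theta>'. \<theta>' \<in> T \<Longrightarrow> \<Phi> (?s \<theta>) \<le> \<Phi> (?s \<theta>')"
    by blast
  show ?thesis
  proof (intro bexI[of _ "?s \<theta>"] conjI ballI impI)
    show "?s \<theta> \<in> K c r ms ps" by (rule TK[OF \<theta>(1)])
    show "frob_norm ?M ?P (\<lambda>i j. ?s \<theta> i j - D0 i j) \<le> \<rho>" using \<theta>(1) by (simp add: T_def)
    fix D' assume "D' \<in> K c r ms ps" "frob_norm ?M ?P (\<lambda>i j. D' i j - D0 i j) \<le> \<rho>"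
    then obtain \<theta>' where "\<theta>' \<in> T" "D' = ?s \<theta>'" unfolding K_def T_def by blast
    then show "\<Phi> (?s \<theta>) \<le> \<Phi> D'" using \<theta>(2) by simp
  qed
qed

text \<open>Gram-Schmidt on the left vectors without normalisation: the coefficients removed from a
  left vector are moved to the right vectors, so the sum of products is unchanged.\<close>

lemma orthogonal_rank_decomposition:
  fixes a :: "nat \<Rightarrow> 'x \<Rightarrow> real" and b :: "nat \<Rightarrow> 'y \<Rightarrow> real"
  assumes "finite X"
  shows "\<exists>a' b'. (\<forall>k<r. \<forall>l<r. k \<noteq> l \<longrightarrow> dot X (a' k) (a' l) = 0) \<and>
    (\<forall>x y. (\<Sum>k<r. a k x * b k y) = (\<Sum>k<r. a' k x * b' k y))"
proof (induction r)
  case 0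
  show ?case by simp
next
  case (Suc r)
  then obtain a' b' where orth: "\<And>k l. k < r \<Longrightarrow> l < r \<Longrightarrow> k \<noteq> l \<Longrightarrow> dot X (a' k) (a' l) = 0"
    and eq: "\<And>x y. (\<Sum>k<r. a k x * b k y) = (\<Sum>k<r. a' k x * (b' k y :: real))" by blast
  define e where "e = (\<lambda>k. dot X (a r) (a' k) / dot X (a' k) (a' k))"
  define w where "w = (\<lambda>x. a r x - (\<Sum>k<r. e k * a' k x))"
  have wdot: "dot X w (a' l) = 0" if l: "l < r" for l
  proof -
    have "dot X (\<lambda>x. \<Sum>k<r. e k * a' k x) (a' l) = (\<Sum>k<r. e k * dot X (a' k) (a' l))"
      unfolding dot_def sum_distrib_left sum_distrib_right by (subst sum.swap) (simp add: mult_ac)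
    also have "\<dots> = (\<Sum>k<r. if k = l then e l * dot X (a' l) (a' l) else 0)"
      using orth l by (intro sum.cong) auto
    also have "\<dots> = e l * dot X (a' l) (a' l)" using l by simp
    also have "\<dots> = dot X (a r) (a' l)"
    proof (cases "dot X (a' l) (a' l) = 0")
      \<comment> \<open>A left vector of norm 0 gets coefficient 0 by division by zero;
        Cauchy-Schwarz shows that its inner product with \<open>a r\<close> is 0 as well.\<close>
      case True
      then show ?thesis using dot_Cauchy_Schwarz[of X "a r" "a' l"] by (simp add: e_def)
    qed (simp add: e_def)
    finally show ?thesis by (simp add: w_def dot_diff_left)
  qed
  define a2 where "a2 = a'(r := w)"
  define b2 where "b2 = (\<lambda>k y. if k = r then b r y else b' k y + e k * b r y)"
  have "dot X (a2 k) (a2 l) = 0" if "k < Suc r" "l < Suc r" "k \<noteq> l" for k l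
    using that orth wdot by (auto simp: a2_def less_Suc_eq dot_commute[of X _ w])
  moreover have "(\<Sum>k<Suc r. a k x * b k y) = (\<Sum>k<Suc r. a2 k x * b2 k y)" for x y
  proof -
    have "(\<Sum>k<Suc r. a2 k x * b2 k y) = (\<Sum>k<r. a' k x * b' k y + e k * a' k x * b r y) + w x * b r y"
      by (auto simp: a2_def b2_def algebra_simps intro!: sum.cong)
    also have "\<dots> = (\<Sum>k<r. a' k x * b' k y) + ((\<Sum>k<r. e k * a' k x) + w x) * b r y"
      by (simp add: sum.distrib sum_distrib_left algebra_simps)
    finally show ?thesis by (simp add: eq w_def)
  qed
  ultimately show ?case by blast
qed

section \<open>Separation rank and norm-bounded representations\<close>

lemma kron_list_replicate_zero:
  "ms \<noteq> [] \<Longrightarrow> length ps = length ms \<Longrightarrow> kron_list (replicate (length ms) (\<lambda>i j. 0)) ms ps i j = 0"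
  by (cases ms; cases ps) (auto simp: kron2_def)

text \<open>Padding with zero products, for which \<open>ms \<noteq> []\<close> matters: with no
  factors the Kronecker product is the constant 1.\<close>

lemma sep_rep_mono:
  assumes "sep_rep ms ps r A" "r \<le> r'" "ms \<noteq> []" "length ps = length ms"
  shows "sep_rep ms ps r' A"
proof -
  obtain F where F: "\<And>k. k < r \<Longrightarrow> length (F k) = length ms"
    "\<And>i j. i < prod_list ms \<Longrightarrow> j < prod_list ps \<Longrightarrow> A i j = (\<Sum>k<r. kron_list (F k) ms ps i j)"
    using assms(1) unfolding sep_rep_def by blast
  define F' where "F' = (\<lambda>k. if k < r then F k else replicate (length ms) (\<lambda>i j. 0))"
  have "(\<Sum>k<r'. kron_list (F' k) ms ps i j) = (\<Sum>k<r. kron_list (F k) ms ps i j)" for i j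
    using assms(2) kron_list_replicate_zero[OF assms(3,4)]
    by (intro sum.mono_neutral_cong_right) (auto simp: F'_def)
  then show ?thesis unfolding sep_rep_def using F by (intro exI[of _ F']) (auto simp: F'_def)
qed

lemma kron_list_elementary:
  assumes "length ps = length ms" "a < prod_list ms" "b < prod_list ps"
  shows "\<exists>As. length As = length ms \<and> (\<forall>i<prod_list ms. \<forall>j<prod_list ps.
    kron_list As ms ps i j = of_bool (i = a \<and> j = b))"
  using assms
proof (induction ms arbitrary: ps a b)
  case Nil
  then show ?case by (intro exI[of _ "[]"]) auto
next
  case (Cons m ms)
  then obtain p ps' where ps: "ps = p # ps'" by (cases ps) auto
  let ?M = "prod_list ms" and ?P = "prod_list ps'"
  obtain As where As: "length As = length ms" "\<And>i j. i < ?M \<Longrightarrow> j < ?P \<Longrightarrow>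
      kron_list As ms ps' i j = of_bool (i = a mod ?M \<and> j = b mod ?P)"
    using Cons.IH[of ps' "a mod ?M" "b mod ?P"] Cons.prems ps by (auto simp: div_mod_less)
  have dm: "(i = a) = (i div n = a div n \<and> i mod n = a mod n)" for i a n :: nat
    by (metis div_mult_mod_eq)
  show ?case
    unfolding ps
    by (intro exI[of _ "(\<lambda>i j. of_bool (i = a div ?M \<and> j = b div ?P)) # As"])
      (auto simp: As kron2_def div_mod_less dm[of _ a ?M] dm[of _ b ?P])
qed

text \<open>\<open>sep_rank\<close> is a \<open>LEAST\<close>, which carries information only if
  some representation exists. Matrix units are Kronecker products of matrix units, so one summand
  for each entry always suffices.\<close>

lemma sep_rep_exists:
  assumes "length ps = length ms" "ms \<noteq> []"
  shows "\<exists>r. sep_rep ms ps r A"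
proof -
  let ?M = "prod_list ms" and ?P = "prod_list ps"
  obtain m ms' p ps' where mp: "ms = m # ms'" "ps = p # ps'"
    using assms by (metis length_0_conv neq_Nil_conv)
  have "\<exists>As. length As = length ms \<and> (\<forall>i<?M. \<forall>j<?P. kron_list As ms ps i j = A a b * of_bool (i = a \<and> j = b))"
    if ab: "a < ?M" "b < ?P" for a b
  proof -
    obtain As where As: "length As = length ms"
      "\<And>i j. i < ?M \<Longrightarrow> j < ?P \<Longrightarrow> kron_list As ms ps i j = of_bool (i = a \<and> j = b)"
      using kron_list_elementary[OF assms(1) ab] by blast
    then obtain X As' where X: "As = X # As'" using mp by (cases As) auto
    show ?thesis
    proof (intro exI[of _ "(\<lambda>i j. A a b * X i j) # As'"] conjI allI impI)
      fix i j assume "i < ?M" "j < ?P"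
      then show "kron_list ((\<lambda>i j. A a b * X i j) # As') ms ps i j = A a b * of_bool (i = a \<and> j = b)"
        using As(2)[of i j] unfolding mp kron_list_scale_hd X by simp
    qed (use As X in auto)
  qed
  then obtain E where E: "\<And>a b. a < ?M \<Longrightarrow> b < ?P \<Longrightarrow> length (E a b) = length ms"
    "\<And>a b i j. a < ?M \<Longrightarrow> b < ?P \<Longrightarrow> i < ?M \<Longrightarrow> j < ?P \<Longrightarrow> kron_list (E a b) ms ps i j = A a b * of_bool (i = a \<and> j = b)"
    by metis
  have "A i j = (\<Sum>k<?M * ?P. kron_list (E (k div ?P) (k mod ?P)) ms ps i j)" if ij: "i < ?M" "j < ?P" for i j
  proof -
    have "(\<Sum>k<?M * ?P. kron_list (E (k div ?P) (k mod ?P)) ms ps i j) = (\<Sum>a<?M. \<Sum>b<?P. kron_list (E a b) ms ps i j)"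
      by (rule sum_div_mod)
    also have "\<dots> = (\<Sum>a<?M. \<Sum>b<?P. if i = a then if j = b then A a b else 0 else 0)"
      using E(2) ij by (intro sum.cong refl) auto
    also have "\<dots> = (\<Sum>a<?M. if i = a then \<Sum>b<?P. if j = b then A a b else 0 else 0)"
      by (intro sum.cong refl) auto
    also have "\<dots> = A i j" using ij by simp
    finally show ?thesis by simp
  qed
  then have "sep_rep ms ps (?M * ?P) A"
    unfolding sep_rep_def using E(1) by (intro exI[of _ "\<lambda>k. E (k div ?P) (k mod ?P)"]) (auto simp: div_mod_less)
  then show ?thesis by blast
qed

lemma K_set_alt:
  assumes "length ps = length ms" "ms \<noteq> []"
  shows "K_set ms ps r = {D \<in> oblique (prod_list ms) (prod_list ps). sep_rep ms ps r D}"
proof -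
  have "sep_rank ms ps D \<le> r \<longleftrightarrow> sep_rep ms ps r D" for D
  proof
    assume "sep_rank ms ps D \<le> r"
    moreover have "sep_rep ms ps (sep_rank ms ps D) D"
      unfolding sep_rank_def using sep_rep_exists[OF assms] by (rule LeastI_ex)
    ultimately show "sep_rep ms ps r D" using sep_rep_mono assms by blast
  next
    assume "sep_rep ms ps r D"
    then show "sep_rank ms ps D \<le> r" unfolding sep_rank_def by (rule Least_le)
  qed
  then show ?thesis by (simp add: K_set_def)
qed

lemma frob_norm_oblique: "D \<in> oblique m p \<Longrightarrow> frob_norm m p D = sqrt p"
  unfolding frob_norm_def by (subst sum.swap) (simp add: oblique_def)

lemma cK_set_subset_K_set:
  assumes "length ps = length ms" "ms \<noteq> []"
  shows "cK_set ms ps r c \<subseteq> K_set ms ps r"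
  unfolding K_set_alt[OF assms] cK_set_def sep_rep_def by blast

text \<open>A single summand agrees with \<open>D\<close> on the block and so has its norm, the
  square root of the number of columns.\<close>

lemma K_set_rank_one:
  assumes "length ps = length ms" "ms \<noteq> []"
  shows "K_set ms ps 1 = cK_set ms ps 1 (sqrt (prod_list ps))"
proof (intro equalityI cK_set_subset_K_set[OF assms] subsetI)
  fix D assume "D \<in> K_set ms ps 1"
  then obtain F where D: "D \<in> oblique (prod_list ms) (prod_list ps)" and F: "length (F 0) = length ms"
    "\<forall>i<prod_list ms. \<forall>j<prod_list ps. D i j = kron_list (F 0) ms ps i j"
    unfolding K_set_alt[OF assms] sep_rep_def by auto
  have "frob_norm (prod_list ms) (prod_list ps) (kron_list (F 0) ms ps) = sqrt (prod_list ps)"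
    using frob_norm_cong[of "prod_list ms" "prod_list ps" D "kron_list (F 0) ms ps"] F frob_norm_oblique[OF D] by simp
  then show "D \<in> cK_set ms ps 1 (sqrt (prod_list ps))"
    unfolding cK_set_def using D F by auto
qed

text \<open>With orthogonal left factors the summands are orthogonal, so by Pythagoras none of them is
  longer than the dictionary itself.\<close>

lemma K_set_two_factors:
  assumes "length ms = 2" "length ps = 2"
  shows "K_set ms ps r = cK_set ms ps r (sqrt (prod_list ps))"
proof (intro equalityI cK_set_subset_K_set subsetI)
  show l: "length ps = length ms" "ms \<noteq> []" using assms by auto
  obtain m1 m2 p1 p2 where mp: "ms = [m1, m2]" "ps = [p1, p2]"
    using assms by (auto simp: numeral_2_eq_2 length_Suc_conv)
  have kron: "kron_list [A, B] ms ps = kron2 A m2 p2 B" for A B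
    by (intro ext) (simp add: mp kron2_def)
  have prods: "prod_list ms = m1 * m2" "prod_list ps = p1 * p2" by (simp_all add: mp)
  fix D assume "D \<in> K_set ms ps r"
  then obtain F where D: "D \<in> oblique (prod_list ms) (prod_list ps)" and F: "\<And>k. k < r \<Longrightarrow> length (F k) = length ms"
    "\<And>i j. i < prod_list ms \<Longrightarrow> j < prod_list ps \<Longrightarrow> D i j = (\<Sum>k<r. kron_list (F k) ms ps i j)"
    unfolding K_set_alt[OF l] sep_rep_def by auto
  have F2: "F k = [F k ! 0, F k ! 1]" if "k < r" for k
    using F(1)[OF that] by (intro nth_equalityI) (auto simp: mp nth_Cons split: nat.splits)
  \<comment> \<open>The left factors are read as vectors over index pairs, so that Gram-Schmidt
    works in the Frobenius inner product.\<close>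
  have "\<exists>(a' :: nat \<Rightarrow> nat \<times> nat \<Rightarrow> real) (b' :: nat \<Rightarrow> nat \<times> nat \<Rightarrow> real).
    (\<forall>k<r. \<forall>l<r. k \<noteq> l \<longrightarrow> dot ({..<m1} \<times> {..<p1}) (a' k) (a' l) = 0) \<and>
    (\<forall>x y. (\<Sum>k<r. (F k ! 0) (fst x) (snd x) * (F k ! 1) (fst y) (snd y)) = (\<Sum>k<r. a' k x * b' k y))"
    by (rule orthogonal_rank_decomposition) simp
  then obtain a' b' :: "nat \<Rightarrow> nat \<times> nat \<Rightarrow> real" where orth: "\<And>k l. k < r \<Longrightarrow> l < r \<Longrightarrow> k \<noteq> l \<Longrightarrow> dot ({..<m1} \<times> {..<p1}) (a' k) (a' l) = 0"
    and eq: "\<And>x y. (\<Sum>k<r. (F k ! 0) (fst x) (snd x) * (F k ! 1) (fst y) (snd y)) = (\<Sum>k<r. a' k x * b' k y)"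
    by blast
  define A where "A = (\<lambda>k i j. a' k (i, j))"
  define B where "B = (\<lambda>k i j. b' k (i, j))"
  have ipA: "frob_ip m1 p1 (A k) (A l) = 0" if "k < r" "l < r" "k \<noteq> l" for k l
    using orth[OF that] by (simp add: frob_ip_def dot_def A_def sum.cartesian_product case_prod_beta)
  have DK: "D i j = (\<Sum>k<r. kron_list [A k, B k] ms ps i j)" if "i < prod_list ms" "j < prod_list ps" for i j
  proof -
    have "D i j = (\<Sum>k<r. (F k ! 0) (i div m2) (j div p2) * (F k ! 1) (i mod m2) (j mod p2))"
      unfolding F(2)[OF that]
    proof (rule sum.cong[OF refl])
      fix k assume "k \<in> {..<r}"
      then have "kron_list (F k) ms ps i j = kron_list [F k ! 0, F k ! 1] ms ps i j" using F2[of k] by simp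
      then show "kron_list (F k) ms ps i j = (F k ! 0) (i div m2) (j div p2) * (F k ! 1) (i mod m2) (j mod p2)"
        unfolding kron by (simp add: kron2_def)
    qed
    also have "\<dots> = (\<Sum>k<r. kron_list [A k, B k] ms ps i j)"
      using eq[of "(i div m2, j div p2)" "(i mod m2, j mod p2)"] unfolding kron by (simp add: kron2_def A_def B_def)
    finally show ?thesis .
  qed
  have ip: "frob_ip (prod_list ms) (prod_list ps) (kron_list [A k, B k] ms ps) (kron_list [A l, B l] ms ps) =
    frob_ip m1 p1 (A k) (A l) * frob_ip m2 p2 (B k) (B l)" for k l
    unfolding kron prods by (rule frob_ip_kron2)
  have "frob_norm (prod_list ms) (prod_list ps) (kron_list [A k, B k] ms ps) \<le> sqrt (prod_list ps)" if k: "k < r" for k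
  proof -
    let ?K = "\<lambda>k. kron_list [A k, B k] ms ps"
    have nn: "0 \<le> frob_ip (prod_list ms) (prod_list ps) (?K k) (?K k)" for k
      by (simp add: frob_norm_sq[symmetric])
    have "frob_ip (prod_list ms) (prod_list ps) D D = (\<Sum>i<prod_list ms. \<Sum>j<prod_list ps. \<Sum>k<r. \<Sum>l<r. ?K k i j * ?K l i j)"
      unfolding frob_ip_def by (intro sum.cong refl) (simp add: DK sum_product)
    also have "\<dots> = (\<Sum>k<r. \<Sum>l<r. frob_ip (prod_list ms) (prod_list ps) (?K k) (?K l))"
    proof -
      have sw: "(\<Sum>i\<in>I. \<Sum>j\<in>J. \<Sum>k\<in>R. f i j k) = (\<Sum>k\<in>R. \<Sum>i\<in>I. \<Sum>j\<in>J. f i j k)"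
        for I J R :: "nat set" and f :: "nat \<Rightarrow> nat \<Rightarrow> nat \<Rightarrow> real"
      proof -
        have "(\<Sum>i\<in>I. \<Sum>j\<in>J. \<Sum>k\<in>R. f i j k) = (\<Sum>i\<in>I. \<Sum>k\<in>R. \<Sum>j\<in>J. f i j k)"
          by (intro sum.cong refl sum.swap)
        also have "\<dots> = (\<Sum>k\<in>R. \<Sum>i\<in>I. \<Sum>j\<in>J. f i j k)" by (rule sum.swap)
        finally show ?thesis .
      qed
      have "(\<Sum>i<prod_list ms. \<Sum>j<prod_list ps. \<Sum>k<r. \<Sum>l<r. ?K k i j * ?K l i j) =
        (\<Sum>k<r. \<Sum>i<prod_list ms. \<Sum>j<prod_list ps. \<Sum>l<r. ?K k i j * ?K l i j)" by (rule sw)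
      also have "\<dots> = (\<Sum>k<r. \<Sum>l<r. \<Sum>i<prod_list ms. \<Sum>j<prod_list ps. ?K k i j * ?K l i j)"
        by (intro sum.cong refl sw)
      finally show ?thesis unfolding frob_ip_def .
    qed
    also have "\<dots> = (\<Sum>k<r. \<Sum>l<r. if k = l then frob_ip (prod_list ms) (prod_list ps) (?K k) (?K k) else 0)"
      by (intro sum.cong refl) (auto simp: ip ipA)
    also have "\<dots> = (\<Sum>k<r. frob_ip (prod_list ms) (prod_list ps) (?K k) (?K k))" by simp
    finally have "frob_ip (prod_list ms) (prod_list ps) D D = (\<Sum>k<r. frob_ip (prod_list ms) (prod_list ps) (?K k) (?K k))" .
    moreover have "frob_ip (prod_list ms) (prod_list ps) (?K k) (?K k) \<le> (\<Sum>k<r. frob_ip (prod_list ms) (prod_list ps) (?K k) (?K k))"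
      by (rule member_le_sum[where f = "\<lambda>k. frob_ip (prod_list ms) (prod_list ps) (?K k) (?K k)"]) (use k nn in auto)
    ultimately show ?thesis using frob_norm_oblique[OF D] unfolding frob_norm_ip
      by (metis real_sqrt_le_mono)
  qed
  then show "D \<in> cK_set ms ps r (sqrt (prod_list ps))"
    unfolding cK_set_def using D DK l(1) assms by (auto intro!: exI[of _ "\<lambda>k. [A k, B k]"])
qed

section \<open>The generative model\<close>

lemma sqrt_dot_app_le_frob:
  "sqrt (dot {..<m} (app {..<p} A x) (app {..<p} A x)) \<le> frob_norm m p A * sqrt (dot {..<p} x x)"
  unfolding frob_norm_def by (rule sqrt_dot_app_le)

text \<open>The supremum is meaningful because the Frobenius norm bounds the set. A general vector
  is rescaled to length 1, with length 0 treated apart.\<close>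

lemma spec_norm_bound:
  shows "0 \<le> spec_norm m p A"
    and "dot {..<m} (app {..<p} A x) (app {..<p} A x) \<le> (spec_norm m p A)\<^sup>2 * dot {..<p} x x"
proof -
  let ?V = "{sqrt (\<Sum>i<m. (\<Sum>j<p. A i j * x j)\<^sup>2) | x. (\<Sum>j<p. (x j)\<^sup>2) \<le> 1}"
  have V: "?V = {sqrt (dot {..<m} (app {..<p} A x) (app {..<p} A x)) | x. dot {..<p} x x \<le> 1}"
    by (simp add: dot_self app_def)
  have bdd: "bdd_above ?V"
    unfolding V
  proof (rule bdd_aboveI[of _ "frob_norm m p A"], clarify)
    fix x :: "nat \<Rightarrow> real" assume "dot {..<p} x x \<le> 1"
    then have "sqrt (dot {..<p} x x) \<le> 1" by simp
    then have "frob_norm m p A * sqrt (dot {..<p} x x) \<le> frob_norm m p A * 1" by (intro mult_left_mono) auto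
    then show "sqrt (dot {..<m} (app {..<p} A x) (app {..<p} A x)) \<le> frob_norm m p A"
      using sqrt_dot_app_le_frob[of m p A x] by linarith
  qed
  have le: "sqrt (dot {..<m} (app {..<p} A x) (app {..<p} A x)) \<le> spec_norm m p A" if "dot {..<p} x x \<le> 1" for x
    unfolding spec_norm_def by (rule cSup_upper[OF _ bdd]) (use that V in blast)
  show nn: "0 \<le> spec_norm m p A" using le[of "\<lambda>_. 0"] by (simp add: dot_def app_def)
  define n where "n = sqrt (dot {..<p} x x)"
  have n2: "n\<^sup>2 = dot {..<p} x x" by (simp add: n_def)
  show "dot {..<m} (app {..<p} A x) (app {..<p} A x) \<le> (spec_norm m p A)\<^sup>2 * dot {..<p} x x"
  proof (cases "n = 0")
    case True
    then have "sqrt (dot {..<m} (app {..<p} A x) (app {..<p} A x)) \<le> 0"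
      using sqrt_dot_app_le[of "{..<m}" "{..<p}" A x] by (simp add: n_def)
    then have "dot {..<m} (app {..<p} A x) (app {..<p} A x) \<le> 0" by simp
    then show ?thesis by (meson dot_self_nonneg mult_nonneg_nonneg order.trans zero_le_power2)
  next
    case False
    define z where "z = (\<lambda>j. (1 / n) * x j)"
    have zz: "dot {..<p} z z = (1 / n) * ((1 / n) * dot {..<p} x x)" by (simp only: z_def dot_scale_left dot_scale_right)
    also have "\<dots> = 1" using False unfolding n2[symmetric] by (simp add: power2_eq_square)
    finally have "sqrt (dot {..<m} (app {..<p} A z) (app {..<p} A z)) \<le> spec_norm m p A" by (intro le) simp
    then have "dot {..<m} (app {..<p} A z) (app {..<p} A z) \<le> (spec_norm m p A)\<^sup>2" by (rule sqrt_le_D)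
    moreover have "app {..<p} A z = (\<lambda>i. (1 / n) * app {..<p} A x i)" by (rule ext) (simp only: z_def app_linear)
    ultimately have "(1 / n) * ((1 / n) * dot {..<m} (app {..<p} A x) (app {..<p} A x)) \<le> (spec_norm m p A)\<^sup>2"
      by (simp only: dot_scale_left dot_scale_right)
    then have "n\<^sup>2 * ((1 / n) * ((1 / n) * dot {..<m} (app {..<p} A x) (app {..<p} A x))) \<le> n\<^sup>2 * (spec_norm m p A)\<^sup>2"
      by (intro mult_left_mono) auto
    then show ?thesis using False unfolding n2[symmetric] by (simp add: power2_eq_square mult_ac)
  qed
qed

text \<open>This accounts for \<open>spec_norm m p D0 + 1\<close> in \<open>C_min\<close> and in the
  sparsity assumption: a perturbation of Frobenius norm at most 1 raises the operator norm by at
  most 1.\<close>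

lemma op_norm_perturbed:
  assumes \<delta>: "frob_norm m p (\<lambda>i j. D i j - D0 i j) \<le> 1"
  shows "dot {..<m} (app {..<p} D x) (app {..<p} D x) \<le> (spec_norm m p D0 + 1)\<^sup>2 * dot {..<p} x x"
proof -
  let ?n = "\<lambda>J v. sqrt (dot J v v)"
  have "app {..<p} D x = (\<lambda>i. app {..<p} D0 x i + app {..<p} (\<lambda>i j. D i j - D0 i j) x i)"
    by (simp add: app_def algebra_simps sum_subtractf)
  then have "?n {..<m} (app {..<p} D x) \<le> ?n {..<m} (app {..<p} D0 x) + ?n {..<m} (app {..<p} (\<lambda>i j. D i j - D0 i j) x)"
    using sqrt_dot_add_le[of "{..<m}" "app {..<p} D0 x" "app {..<p} (\<lambda>i j. D i j - D0 i j) x"] by simp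
  also have "?n {..<m} (app {..<p} D0 x) \<le> spec_norm m p D0 * ?n {..<p} x"
    using real_sqrt_le_mono[OF spec_norm_bound(2)[of m p D0 x]] spec_norm_bound(1)[of m p D0]
    by (simp add: real_sqrt_mult)
  also have "?n {..<m} (app {..<p} (\<lambda>i j. D i j - D0 i j) x) \<le> 1 * ?n {..<p} x"
    by (rule order.trans[OF sqrt_dot_app_le_frob mult_right_mono[OF \<delta>]]) simp
  finally have "?n {..<m} (app {..<p} D x) \<le> (spec_norm m p D0 + 1) * ?n {..<p} x" by (simp add: algebra_simps)
  then have "dot {..<m} (app {..<p} D x) (app {..<p} D x) \<le> ((spec_norm m p D0 + 1) * ?n {..<p} x)\<^sup>2" by (rule sqrt_le_D)
  then show ?thesis by (simp add: power_mult_distrib)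
qed

lemma cum_coherence_ge:
  assumes "J \<subseteq> {..<p}" "card J \<le> s" "j < p" "j \<notin> J"
  shows "(\<Sum>i\<in>J. \<bar>gram m D D i j\<bar>) \<le> cum_coherence m p s D"
proof -
  let ?A = "{(\<Sum>i\<in>J. \<bar>\<Sum>k<m. D k i * D k j\<bar>) | J j. J \<subseteq> {..<p} \<and> card J \<le> s \<and> j < p \<and> j \<notin> J}"
  have "?A \<subseteq> (\<lambda>(J, j). \<Sum>i\<in>J. \<bar>\<Sum>k<m. D k i * D k j\<bar>) ` (Pow {..<p} \<times> {..<p})" by auto
  then have "finite ?A" by (rule finite_subset) auto
  moreover have "(\<Sum>i\<in>J. \<bar>\<Sum>k<m. D k i * D k j\<bar>) \<in> ?A" using assms by blast
  ultimately show ?thesis unfolding cum_coherence_def gram_def dot_def by (rule Max_ge)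
qed

lemma cum_coherence_nonneg: "0 < p \<Longrightarrow> 0 \<le> cum_coherence m p s D"
  using cum_coherence_ge[of "{}" p s 0 m D] by simp

lemma gram_inverse_mono: "gram_inverse J G H \<mu> \<Longrightarrow> \<mu> \<le> \<mu>' \<Longrightarrow> \<mu>' < 1 \<Longrightarrow> gram_inverse J G H \<mu>'"
  unfolding gram_inverse_def by force

text \<open>This class is closed under sums and products and consists of integrable functions, so
  expanding products of the model variables raises no integrability questions.\<close>

definition (in prob_space) bdd_rv :: "('a \<Rightarrow> real) \<Rightarrow> bool" where
  "bdd_rv f \<longleftrightarrow> f \<in> borel_measurable M \<and> (\<exists>c. AE x in M. \<bar>f x\<bar> \<le> c)"

context prob_space
begin

lemma bdd_rv_measurable: "bdd_rv f \<Longrightarrow> f \<in> borel_measurable M"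
  by (simp add: bdd_rv_def)

lemma bdd_rv_integrable: "bdd_rv f \<Longrightarrow> integrable M f"
  unfolding bdd_rv_def real_norm_def[symmetric] using integrable_const_bound by blast

lemma bdd_rv_const: "bdd_rv (\<lambda>x. c)"
  unfolding bdd_rv_def by (auto intro!: exI[of _ "\<bar>c\<bar>"])

lemma bdd_rv_mult: "bdd_rv f \<Longrightarrow> bdd_rv g \<Longrightarrow> bdd_rv (\<lambda>x. f x * g x)"
proof -
  assume fg: "bdd_rv f" "bdd_rv g"
  then obtain c d where c: "AE x in M. \<bar>f x\<bar> \<le> c" and d: "AE x in M. \<bar>g x\<bar> \<le> d" by (auto simp: bdd_rv_def)
  have "AE x in M. \<bar>f x * g x\<bar> \<le> \<bar>c\<bar> * \<bar>d\<bar>"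
    using c d by eventually_elim (auto simp: abs_mult intro!: mult_mono)
  then show ?thesis using fg by (auto simp: bdd_rv_def)
qed

lemma bdd_rv_add: "bdd_rv f \<Longrightarrow> bdd_rv g \<Longrightarrow> bdd_rv (\<lambda>x. f x + g x)"
proof -
  assume fg: "bdd_rv f" "bdd_rv g"
  then obtain c d where c: "AE x in M. \<bar>f x\<bar> \<le> c" and d: "AE x in M. \<bar>g x\<bar> \<le> d" by (auto simp: bdd_rv_def)
  have "AE x in M. \<bar>f x + g x\<bar> \<le> c + d" using c d by eventually_elim linarith
  then show ?thesis using fg by (auto simp: bdd_rv_def)
qed

lemma bdd_rv_diff: "bdd_rv f \<Longrightarrow> bdd_rv g \<Longrightarrow> bdd_rv (\<lambda>x. f x - g x)"
  using bdd_rv_add[of f "\<lambda>x. (-1) * g x"] bdd_rv_mult[OF bdd_rv_const[of "-1"]] by simp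

lemma bdd_rv_sum: "(\<And>i. i \<in> I \<Longrightarrow> bdd_rv (f i)) \<Longrightarrow> bdd_rv (\<lambda>x. \<Sum>i\<in>I. f i x)"
  by (induction I rule: infinite_finite_induct) (auto intro!: bdd_rv_add bdd_rv_const)

lemmas bdd_rv_intros = bdd_rv_const bdd_rv_mult bdd_rv_add bdd_rv_diff bdd_rv_sum

lemma bdd_rv_indicator: "A \<in> events \<Longrightarrow> bdd_rv (indicator A)"
  unfolding bdd_rv_def by (auto intro!: exI[of _ 1] simp: indicator_def)

section \<open>Conditional moments given an event\<close>

context
  fixes A assumes A: "A \<in> events"
begin

lemma cond_exp_add: "bdd_rv f \<Longrightarrow> bdd_rv g \<Longrightarrow> cond_exp M A (\<lambda>x. f x + g x) = cond_exp M A f + cond_exp M A g"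
  unfolding cond_exp_def
  by (simp add: algebra_simps add_divide_distrib Bochner_Integration.integral_add bdd_rv_integrable bdd_rv_mult bdd_rv_indicator A)

lemma cond_exp_scale: "cond_exp M A (\<lambda>x. c * f x) = c * cond_exp M A f"
  unfolding cond_exp_def by (simp add: mult.left_commute)

lemma cond_exp_diff: "bdd_rv f \<Longrightarrow> bdd_rv g \<Longrightarrow> cond_exp M A (\<lambda>x. f x - g x) = cond_exp M A f - cond_exp M A g"
  using cond_exp_add[of f "\<lambda>x. (-1) * g x"] cond_exp_scale[of "-1" g] bdd_rv_mult[OF bdd_rv_const[of "-1"], of g] by simp

lemma cond_exp_sum: "(\<And>i. i \<in> I \<Longrightarrow> bdd_rv (f i)) \<Longrightarrow> cond_exp M A (\<lambda>x. \<Sum>i\<in>I. f i x) = (\<Sum>i\<in>I. cond_exp M A (f i))"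
proof (induction I rule: infinite_finite_induct)
  case (insert i I)
  then show ?case by (simp add: cond_exp_add bdd_rv_sum)
qed (simp_all add: cond_exp_def)

lemma cond_exp_bilinear:
  assumes "\<And>a. a \<in> I \<Longrightarrow> bdd_rv (u a)" "\<And>b. b \<in> K \<Longrightarrow> bdd_rv (v b)"
  shows "cond_exp M A (\<lambda>x. (\<Sum>a\<in>I. \<alpha> a * u a x) * (\<Sum>b\<in>K. \<beta> b * v b x)) =
    (\<Sum>a\<in>I. \<Sum>b\<in>K. \<alpha> a * \<beta> b * cond_exp M A (\<lambda>x. u a x * v b x))"
proof -
  have "cond_exp M A (\<lambda>x. (\<Sum>a\<in>I. \<alpha> a * u a x) * (\<Sum>b\<in>K. \<beta> b * v b x)) =
    cond_exp M A (\<lambda>x. \<Sum>a\<in>I. \<Sum>b\<in>K. (\<alpha> a * \<beta> b) * (u a x * v b x))"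
    by (simp add: sum_product mult_ac)
  also have "\<dots> = (\<Sum>a\<in>I. \<Sum>b\<in>K. cond_exp M A (\<lambda>x. (\<alpha> a * \<beta> b) * (u a x * v b x)))"
    using assms by (subst cond_exp_sum, force intro!: bdd_rv_intros, intro sum.cong refl cond_exp_sum bdd_rv_intros) auto
  finally show ?thesis by (simp only: cond_exp_scale)
qed

lemma cond_exp_mono_AE:
  assumes "bdd_rv f" "bdd_rv g" "AE x in M. x \<in> A \<longrightarrow> f x \<le> g x"
  shows "cond_exp M A f \<le> cond_exp M A g"
  unfolding cond_exp_def
proof (rule divide_right_mono, rule integral_mono_AE)
  show "AE x in M. indicat_real A x * f x \<le> indicat_real A x * g x"
    using assms(3) by eventually_elim (auto simp: indicator_def)
qed (use assms A in \<open>auto intro!: bdd_rv_integrable bdd_rv_mult bdd_rv_indicator\<close>)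

lemma cond_exp_const: "prob A \<noteq> 0 \<Longrightarrow> cond_exp M A (\<lambda>x. c) = c"
  unfolding cond_exp_def using A by simp

end

end

text \<open>The scalar laws of coefficients and noise enter only through their moments, so these are
  carried as plain numbers.\<close>

locale dict_model = prob_space \<mu> for \<mu> :: "sample measure" +
  fixes m p s :: nat and D0 :: mat and Ex2 Eabs Eeps2 Mx xlow Meps My lam :: real
  assumes sets_\<mu>: "sets \<mu> = sets sample_space"
    and s1: "1 \<le> s"
    and D0_oblique: "D0 \<in> oblique m p"
    and supp: "\<And>S. S \<subseteq> {..<p} \<Longrightarrow> card S = s \<Longrightarrow> prob {\<omega> \<in> space \<mu>. fst \<omega> = S} = 1 / real (p choose s)"
    and off_supp: "AE \<omega> in \<mu>. \<forall>j. j \<notin> fst \<omega> \<longrightarrow> fst (snd \<omega>) j = 0"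
    and moments: "\<And>S i j. S \<subseteq> {..<p} \<Longrightarrow> card S = s \<Longrightarrow> i \<in> S \<Longrightarrow> j \<in> S \<Longrightarrow>
       cond_exp \<mu> {\<omega> \<in> space \<mu>. fst \<omega> = S} (\<lambda>\<omega>. fst (snd \<omega>) i * fst (snd \<omega>) j) = (if i = j then Ex2 else 0)"
      "\<And>S i j. S \<subseteq> {..<p} \<Longrightarrow> card S = s \<Longrightarrow> i \<in> S \<Longrightarrow> j \<in> S \<Longrightarrow>
       cond_exp \<mu> {\<omega> \<in> space \<mu>. fst \<omega> = S} (\<lambda>\<omega>. sgn (fst (snd \<omega>) i) * sgn (fst (snd \<omega>) j)) = (if i = j then 1 else 0)"
      "\<And>S i j. S \<subseteq> {..<p} \<Longrightarrow> card S = s \<Longrightarrow> i \<in> S \<Longrightarrow> j \<in> S \<Longrightarrow>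
       cond_exp \<mu> {\<omega> \<in> space \<mu>. fst \<omega> = S} (\<lambda>\<omega>. sgn (fst (snd \<omega>) i) * fst (snd \<omega>) j) = (if i = j then Eabs else 0)"
    and x_bound: "AE \<omega> in \<mu>. sqrt (\<Sum>j<p. (fst (snd \<omega>) j)\<^sup>2) \<le> Mx"
    and x_low: "AE \<omega> in \<mu>. \<forall>j\<in>fst \<omega>. \<bar>fst (snd \<omega>) j\<bar> \<ge> xlow"
    and noise: "\<And>S i k. S \<subseteq> {..<p} \<Longrightarrow> card S = s \<Longrightarrow> i < m \<Longrightarrow> k < m \<Longrightarrow>
       cond_exp \<mu> {\<omega> \<in> space \<mu>. fst \<omega> = S} (\<lambda>\<omega>. snd (snd \<omega>) i * snd (snd \<omega>) k) = (if i = k then Eeps2 else 0)"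
      "\<And>S i j. S \<subseteq> {..<p} \<Longrightarrow> card S = s \<Longrightarrow> j < p \<Longrightarrow> i < m \<Longrightarrow>
       cond_exp \<mu> {\<omega> \<in> space \<mu>. fst \<omega> = S} (\<lambda>\<omega>. fst (snd \<omega>) j * snd (snd \<omega>) i) = 0"
      "\<And>S i j. S \<subseteq> {..<p} \<Longrightarrow> card S = s \<Longrightarrow> j < p \<Longrightarrow> i < m \<Longrightarrow>
       cond_exp \<mu> {\<omega> \<in> space \<mu>. fst \<omega> = S} (\<lambda>\<omega>. sgn (fst (snd \<omega>) j) * snd (snd \<omega>) i) = 0"
    and eps_bound: "AE \<omega> in \<mu>. sqrt (\<Sum>i<m. (snd (snd \<omega>) i)\<^sup>2) \<le> Meps"
    and y_bound: "AE \<omega> in \<mu>. sqrt (\<Sum>i<m. (sample_y p D0 \<omega> i)\<^sup>2) \<le> My"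
    and pos: "0 < Mx" "0 < xlow" "0 < Meps" "0 < My" "0 < lam" "0 \<le> Eeps2"
    and lam_le: "lam \<le> xlow / 4"
    and sparse: "real s \<le> real p / (16 * (spec_norm m p D0 + 1)\<^sup>2)"
    and coh: "cum_coherence m p s D0 \<le> 1/4"
begin

abbreviation Jev :: "nat set \<Rightarrow> sample set" where
  "Jev S \<equiv> {\<omega> \<in> space \<mu>. fst \<omega> = S}"

lemma measurable_parts:
  "fst \<in> measurable \<mu> (count_space UNIV)"
  "(\<lambda>\<omega>. fst (snd \<omega>) i) \<in> borel_measurable \<mu>"
  "(\<lambda>\<omega>. snd (snd \<omega>) i) \<in> borel_measurable \<mu>"
  by (subst measurable_cong_sets[OF sets_\<mu> refl], unfold sample_space_def, measurable)+

lemma Jev_sets: "Jev S \<in> events"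
  using measurable_sets[OF measurable_parts(1), of "{S}"] by (simp add: vimage_def Int_def conj_commute)

lemma p_pos: "0 < p" and s_le_p: "s \<le> p" and sparse': "real s / real p * (spec_norm m p D0 + 1)\<^sup>2 \<le> 1/16"
proof -
  have B: "1 \<le> (spec_norm m p D0 + 1)\<^sup>2" using spec_norm_bound(1)[of m p D0] by simp
  have "0 < real p / (16 * (spec_norm m p D0 + 1)\<^sup>2)" using sparse s1 by linarith
  then show p: "0 < p" by (simp add: zero_less_divide_iff)
  have "0 < 16 * (spec_norm m p D0 + 1)\<^sup>2" using B by linarith
  then have le: "real s * (16 * (spec_norm m p D0 + 1)\<^sup>2) \<le> real p"
    using sparse by (metis pos_le_divide_eq)
  have "real s * 1 \<le> real s * (16 * (spec_norm m p D0 + 1)\<^sup>2)" using B by (intro mult_left_mono) auto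
  then show "s \<le> p" using le by linarith
  show "real s / real p * (spec_norm m p D0 + 1)\<^sup>2 \<le> 1/16" using le p by (simp add: field_simps)
qed

lemma choose_pos: "0 < real (p choose s)"
  using s_le_p by (simp add: zero_less_binomial_iff)

text \<open>The prescribed probabilities of the supports of size \<open>s\<close> already add up to
  1, so nothing is left for other supports.\<close>

lemma AE_supp: "AE \<omega> in \<mu>. fst \<omega> \<subseteq> {..<p} \<and> card (fst \<omega>) = s"
proof -
  let ?\<S> = "{S. S \<subseteq> {..<p} \<and> card S = s}"
  have fin: "finite ?\<S>" by simp
  have "prob (\<Union>S\<in>?\<S>. Jev S) = (\<Sum>S\<in>?\<S>. prob (Jev S))"
    by (rule finite_measure_finite_Union[OF fin]) (auto simp: disjoint_family_on_def Jev_sets)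
  also have "\<dots> = (\<Sum>S\<in>?\<S>. 1 / real (p choose s))" by (intro sum.cong refl supp) auto
  also have "\<dots> = 1" using n_subsets[of "{..<p}" s] choose_pos by simp
  finally have "AE \<omega> in \<mu>. \<omega> \<in> (\<Union>S\<in>?\<S>. Jev S)" by (rule AE_prob_1)
  then show ?thesis by eventually_elim auto
qed

lemma x_bound': "AE \<omega> in \<mu>. sqrt (dot {..<p} (fst (snd \<omega>)) (fst (snd \<omega>))) \<le> Mx"
  and eps_bound': "AE \<omega> in \<mu>. sqrt (dot {..<m} (snd (snd \<omega>)) (snd (snd \<omega>))) \<le> Meps"
  and y_bound': "AE \<omega> in \<mu>. sqrt (dot {..<m} (sample_y p D0 \<omega>) (sample_y p D0 \<omega>)) \<le> My"
  using x_bound eps_bound y_bound by (simp_all add: dot_self)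

lemma abs_le_sqrt_dot: "finite J \<Longrightarrow> i \<in> J \<Longrightarrow> \<bar>u i\<bar> \<le> sqrt (dot J u u)"
proof -
  assume "finite J" "i \<in> J"
  then have "(u i)\<^sup>2 \<le> dot J u u" unfolding dot_self by (intro member_le_sum) auto
  then show ?thesis by (metis real_sqrt_abs real_sqrt_le_mono)
qed

lemma bdd_x: "j < p \<Longrightarrow> bdd_rv (\<lambda>\<omega>. fst (snd \<omega>) j)"
proof -
  assume j: "j < p"
  have "AE \<omega> in \<mu>. \<bar>fst (snd \<omega>) j\<bar> \<le> Mx"
    using x_bound'
  proof eventually_elim
    case (elim \<omega>)
    then show ?case using abs_le_sqrt_dot[of "{..<p}" j "fst (snd \<omega>)"] j by simp
  qed
  then show ?thesis using measurable_parts(2)[of j] unfolding bdd_rv_def by blast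
qed

lemma bdd_eps: "j < m \<Longrightarrow> bdd_rv (\<lambda>\<omega>. snd (snd \<omega>) j)"
proof -
  assume j: "j < m"
  have "AE \<omega> in \<mu>. \<bar>snd (snd \<omega>) j\<bar> \<le> Meps"
    using eps_bound'
  proof eventually_elim
    case (elim \<omega>)
    then show ?case using abs_le_sqrt_dot[of "{..<m}" j "snd (snd \<omega>)"] j by simp
  qed
  then show ?thesis using measurable_parts(3)[of j] unfolding bdd_rv_def by blast
qed

lemma bdd_sgn: "bdd_rv (\<lambda>\<omega>. sgn (fst (snd \<omega>) j))"
  unfolding bdd_rv_def
proof (intro conjI exI[of _ 1])
  show "(\<lambda>\<omega>. sgn (fst (snd \<omega>) j)) \<in> borel_measurable \<mu>"
    using measurable_parts(2)[of j] by measurable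
qed (auto simp: sgn_real_def)

text \<open>The response \<open>D_S^T y - lam * sgn x\<close> with \<open>y\<close> expanded into
  signal and noise, the form into which conditional moments can be inserted. It agrees with
  \<open>resp\<close> when \<open>x\<close> vanishes off \<open>S\<close>.\<close>

definition noisy_resp :: "mat \<Rightarrow> nat set \<Rightarrow> sample \<Rightarrow> nat \<Rightarrow> real" where
  "noisy_resp D S \<omega> i = (\<Sum>k\<in>S. gram m D D0 i k * fst (snd \<omega>) k) + (\<Sum>l<m. D l i * snd (snd \<omega>) l)
     - lam * sgn (fst (snd \<omega>) i)"

lemma bdd_noisy_resp: "S \<subseteq> {..<p} \<Longrightarrow> bdd_rv (\<lambda>\<omega>. noisy_resp D S \<omega> i)"
  unfolding noisy_resp_def by (intro bdd_rv_intros bdd_x bdd_eps bdd_sgn) auto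

text \<open>Signal, noise and sign parts are expanded separately. Products of the noise with signal
  or signs have conditional mean 0, so the noise contributes only through its own second
  moments.\<close>

lemma cond_exp_noisy_resp:
  assumes S: "S \<subseteq> {..<p}" "card S = s" and ij: "i \<in> S" "j \<in> S"
  shows "cond_exp \<mu> (Jev S) (\<lambda>\<omega>. noisy_resp D S \<omega> i * noisy_resp D S \<omega> j) =
     Ex2 * (\<Sum>k\<in>S. gram m D D0 i k * gram m D D0 j k) + Eeps2 * gram m D D i j
     + lam\<^sup>2 * of_bool (i = j) - lam * Eabs * (gram m D D0 i j + gram m D D0 j i)"
proof -
  have finS: "finite S" using S finite_subset by blast
  define x where "x = (\<lambda>k (\<omega> :: sample). fst (snd \<omega>) k)"
  define e where "e = (\<lambda>k (\<omega> :: sample). snd (snd \<omega>) k)"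
  define sg where "sg = (\<lambda>k (\<omega> :: sample). sgn (fst (snd \<omega>) k))"
  define C where "C = gram m D D0"
  define X where "X = (\<lambda>i \<omega>. \<Sum>k\<in>S. C i k * x k \<omega>)"
  define N where "N = (\<lambda>i \<omega>. \<Sum>l<m. D l i * e l \<omega>)"
  let ?E = "cond_exp \<mu> (Jev S)"
  have bx: "bdd_rv (x k)" if "k \<in> S" for k using that S bdd_x unfolding x_def by auto
  have be: "bdd_rv (e k)" if "k \<in> {..<m}" for k using that bdd_eps unfolding e_def by auto
  have bs: "bdd_rv (sg k)" for k using bdd_sgn unfolding sg_def .
  have bX: "bdd_rv (X i)" for i unfolding X_def using bx by (intro bdd_rv_intros) auto
  have bN: "bdd_rv (N i)" for i unfolding N_def using be by (intro bdd_rv_intros) auto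
  have delta: "(\<Sum>k\<in>S. f k * of_bool (k = i)) = (f i :: real)" if "i \<in> S" for f i
    using finS that by (simp add: of_bool_def if_distrib cong: if_cong)
  have XX: "?E (\<lambda>\<omega>. X i \<omega> * X j \<omega>) = Ex2 * (\<Sum>k\<in>S. C i k * C j k)"
  proof -
    have "?E (\<lambda>\<omega>. X i \<omega> * X j \<omega>) = (\<Sum>a\<in>S. \<Sum>b\<in>S. C i a * C j b * ?E (\<lambda>\<omega>. x a \<omega> * x b \<omega>))"
      unfolding X_def by (intro cond_exp_bilinear Jev_sets bx)
    also have "\<dots> = (\<Sum>a\<in>S. \<Sum>b\<in>S. if b = a then C i a * C j a * Ex2 else 0)"
      using moments(1)[OF S] by (intro sum.cong refl) (auto simp: x_def)
    also have "\<dots> = Ex2 * (\<Sum>k\<in>S. C i k * C j k)" using finS by (simp add: sum_distrib_left mult_ac)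
    finally show ?thesis .
  qed
  have NN: "?E (\<lambda>\<omega>. N i \<omega> * N j \<omega>) = Eeps2 * gram m D D i j"
  proof -
    have "?E (\<lambda>\<omega>. N i \<omega> * N j \<omega>) = (\<Sum>a<m. \<Sum>b<m. D a i * D b j * ?E (\<lambda>\<omega>. e a \<omega> * e b \<omega>))"
      unfolding N_def by (intro cond_exp_bilinear Jev_sets be)
    also have "\<dots> = (\<Sum>a<m. \<Sum>b<m. if b = a then D a i * D a j * Eeps2 else 0)"
      using noise(1)[OF S] by (intro sum.cong refl) (auto simp: e_def)
    also have "\<dots> = Eeps2 * gram m D D i j" by (simp add: gram_def dot_def sum_distrib_left mult_ac)
    finally show ?thesis .
  qed
  have XN: "?E (\<lambda>\<omega>. X i \<omega> * N j \<omega>) = 0" for i j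
  proof -
    have "?E (\<lambda>\<omega>. X i \<omega> * N j \<omega>) = (\<Sum>a\<in>S. \<Sum>b<m. C i a * D b j * ?E (\<lambda>\<omega>. x a \<omega> * e b \<omega>))"
      unfolding X_def N_def by (intro cond_exp_bilinear Jev_sets bx be)
    also have "\<dots> = 0" using noise(2)[OF S] S by (intro sum.neutral ballI) (auto simp: x_def e_def)
    finally show ?thesis .
  qed
  have SN: "?E (\<lambda>\<omega>. sg i \<omega> * N j \<omega>) = 0" if "i \<in> S" for i j
  proof -
    have "?E (\<lambda>\<omega>. (\<Sum>a\<in>{i}. 1 * sg a \<omega>) * N j \<omega>) = (\<Sum>a\<in>{i}. \<Sum>b<m. 1 * D b j * ?E (\<lambda>\<omega>. sg a \<omega> * e b \<omega>))"
      unfolding N_def by (intro cond_exp_bilinear Jev_sets bs be)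
    also have "\<dots> = 0" using noise(3)[OF S] S that by (intro sum.neutral ballI) (auto simp: sg_def e_def)
    finally show ?thesis by simp
  qed
  have SX: "?E (\<lambda>\<omega>. sg i \<omega> * X j \<omega>) = Eabs * C j i" if "i \<in> S" for i j
  proof -
    have "?E (\<lambda>\<omega>. (\<Sum>a\<in>{i}. 1 * sg a \<omega>) * X j \<omega>) = (\<Sum>a\<in>{i}. \<Sum>b\<in>S. 1 * C j b * ?E (\<lambda>\<omega>. sg a \<omega> * x b \<omega>))"
      unfolding X_def by (intro cond_exp_bilinear Jev_sets bs bx)
    also have "\<dots> = (\<Sum>b\<in>S. C j b * Eabs * of_bool (b = i))"
      using moments(3)[OF S that] by (auto simp: sg_def x_def intro!: sum.cong)
    also have "\<dots> = Eabs * C j i" using delta[OF that, of "\<lambda>b. C j b * Eabs"] by simp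
    finally show ?thesis by simp
  qed
  have SS: "?E (\<lambda>\<omega>. sg i \<omega> * sg j \<omega>) = of_bool (i = j)"
    using moments(2)[OF S ij] by (simp add: sg_def)
  have "?E (\<lambda>\<omega>. noisy_resp D S \<omega> i * noisy_resp D S \<omega> j) =
    ?E (\<lambda>\<omega>. (X i \<omega> * X j \<omega> + N i \<omega> * N j \<omega> + (X i \<omega> * N j \<omega> + X j \<omega> * N i \<omega>) + lam\<^sup>2 * (sg i \<omega> * sg j \<omega>))
      - lam * ((sg i \<omega> * X j \<omega> + sg j \<omega> * X i \<omega>) + (sg i \<omega> * N j \<omega> + sg j \<omega> * N i \<omega>)))"
    unfolding noisy_resp_def X_def N_def e_def sg_def C_def x_def
    by (rule arg_cong[of _ _ ?E]) (simp add: algebra_simps power2_eq_square)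
  also have "\<dots> = (?E (\<lambda>\<omega>. X i \<omega> * X j \<omega>) + ?E (\<lambda>\<omega>. N i \<omega> * N j \<omega>) + (?E (\<lambda>\<omega>. X i \<omega> * N j \<omega>) + ?E (\<lambda>\<omega>. X j \<omega> * N i \<omega>))
      + lam\<^sup>2 * ?E (\<lambda>\<omega>. sg i \<omega> * sg j \<omega>))
      - lam * ((?E (\<lambda>\<omega>. sg i \<omega> * X j \<omega>) + ?E (\<lambda>\<omega>. sg j \<omega> * X i \<omega>)) + (?E (\<lambda>\<omega>. sg i \<omega> * N j \<omega>) + ?E (\<lambda>\<omega>. sg j \<omega> * N i \<omega>)))"
    by (simp only: cond_exp_diff[OF Jev_sets] cond_exp_add[OF Jev_sets] cond_exp_scale[OF Jev_sets]
        bdd_rv_add bdd_rv_mult bdd_rv_const bX bN bs)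
  also have "\<dots> = Ex2 * (\<Sum>k\<in>S. C i k * C j k) + Eeps2 * gram m D D i j
     + lam\<^sup>2 * of_bool (i = j) - lam * Eabs * (C i j + C j i)"
    unfolding XX NN XN SN[OF ij(1)] SN[OF ij(2)] SX[OF ij(1)] SX[OF ij(2)] SS by (simp add: algebra_simps)
  finally show ?thesis by (simp add: C_def)
qed

lemma cond_exp_quadratic_form:
  assumes S: "S \<subseteq> {..<p}" "card S = s" and H: "\<And>i j. i \<in> S \<Longrightarrow> j \<in> S \<Longrightarrow> H i j = H j i"
  shows "cond_exp \<mu> (Jev S) (\<lambda>\<omega>. dot S (noisy_resp D S \<omega>) (app S H (noisy_resp D S \<omega>))) =
    quad_mean Ex2 Eabs Eeps2 lam S (gram m D D0) (gram m D D) H"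
proof -
  have finS: "finite S" using S finite_subset by blast
  let ?C = "gram m D D0"
  have "cond_exp \<mu> (Jev S) (\<lambda>\<omega>. dot S (noisy_resp D S \<omega>) (app S H (noisy_resp D S \<omega>))) =
    cond_exp \<mu> (Jev S) (\<lambda>\<omega>. \<Sum>i\<in>S. \<Sum>j\<in>S. H i j * (noisy_resp D S \<omega> i * noisy_resp D S \<omega> j))"
    by (simp add: dot_def app_def sum_distrib_left mult_ac)
  also have "\<dots> = (\<Sum>i\<in>S. cond_exp \<mu> (Jev S) (\<lambda>\<omega>. \<Sum>j\<in>S. H i j * (noisy_resp D S \<omega> i * noisy_resp D S \<omega> j)))"
    by (intro cond_exp_sum Jev_sets bdd_rv_intros bdd_noisy_resp S)
  also have "\<dots> = (\<Sum>i\<in>S. \<Sum>j\<in>S. cond_exp \<mu> (Jev S) (\<lambda>\<omega>. H i j * (noisy_resp D S \<omega> i * noisy_resp D S \<omega> j)))"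
    by (intro sum.cong refl cond_exp_sum Jev_sets bdd_rv_intros bdd_noisy_resp S)
  also have "\<dots> = (\<Sum>i\<in>S. \<Sum>j\<in>S. H i j * (Ex2 * (\<Sum>k\<in>S. ?C i k * ?C j k) + Eeps2 * gram m D D i j
     + lam\<^sup>2 * of_bool (i = j) - lam * Eabs * (?C i j + ?C j i)))"
    unfolding cond_exp_scale[OF Jev_sets] by (intro sum.cong refl) (simp add: cond_exp_noisy_resp[OF S])
  also have "\<dots> = Ex2 * (\<Sum>i\<in>S. \<Sum>j\<in>S. H i j * (\<Sum>k\<in>S. ?C i k * ?C j k)) + Eeps2 * (\<Sum>i\<in>S. \<Sum>j\<in>S. H i j * gram m D D i j)
     + lam\<^sup>2 * (\<Sum>i\<in>S. \<Sum>j\<in>S. H i j * of_bool (i = j)) - lam * Eabs * ((\<Sum>i\<in>S. \<Sum>j\<in>S. H i j * ?C i j) + (\<Sum>i\<in>S. \<Sum>j\<in>S. H i j * ?C j i))"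
  proof -
    have 1: "H i j * (Ex2 * (\<Sum>k\<in>S. ?C i k * ?C j k) + Eeps2 * gram m D D i j
        + lam\<^sup>2 * of_bool (i = j) - lam * Eabs * (?C i j + ?C j i)) =
      Ex2 * (H i j * (\<Sum>k\<in>S. ?C i k * ?C j k)) + Eeps2 * (H i j * gram m D D i j)
        + lam\<^sup>2 * (H i j * of_bool (i = j)) - lam * Eabs * (H i j * ?C i j + H i j * ?C j i)" for i j
      by (simp only: distrib_left right_diff_distrib mult_ac)
    show ?thesis unfolding 1 by (simp only: sum.distrib sum_subtractf sum_distrib_left[symmetric])
  qed
  also have "(\<Sum>i\<in>S. \<Sum>j\<in>S. H i j * of_bool (i = j)) = (\<Sum>i\<in>S. H i i)"
    using finS by (intro sum.cong refl) (simp add: of_bool_def if_distrib cong: if_cong)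
  also have "(\<Sum>i\<in>S. \<Sum>j\<in>S. H i j * ?C j i) = (\<Sum>i\<in>S. \<Sum>j\<in>S. H i j * ?C i j)"
    by (subst sum.swap) (auto intro!: sum.cong simp: H)
  finally show ?thesis by (simp add: quad_mean_def)
qed

end

section \<open>Averaging over supports and relations between the model constants\<close>

context dict_model
begin

abbreviation risk :: "mat \<Rightarrow> sample \<Rightarrow> real" where
  "risk D \<omega> \<equiv> lasso_obj m p lam (sample_y p D0 \<omega>) D"

lemma bdd_lasso: "bdd_rv (\<lambda>\<omega>. risk D \<omega>)"
  and lasso_bounds: "AE \<omega> in \<mu>. 0 \<le> risk D \<omega> \<and> risk D \<omega> \<le> My\<^sup>2 / 2"
proof -
  have lam0: "0 \<le> lam" using pos by simp
  have "(\<lambda>\<omega>. sample_y p D0 \<omega>) \<in> borel_measurable \<mu>"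
    unfolding sample_y_def
    by (rule measurable_coordinatewise_then_product)
      (intro borel_measurable_add borel_measurable_sum borel_measurable_times measurable_parts borel_measurable_const)
  then have meas: "(\<lambda>\<omega>. risk D \<omega>) \<in> borel_measurable \<mu>"
    using lasso_obj_measurable[OF lam0] by (rule measurable_compose)
  show bounds: "AE \<omega> in \<mu>. 0 \<le> risk D \<omega> \<and> risk D \<omega> \<le> My\<^sup>2 / 2"
    using y_bound'
  proof eventually_elim
    case (elim \<omega>)
    have "dot {..<m} (sample_y p D0 \<omega>) (sample_y p D0 \<omega>) \<le> My\<^sup>2" using elim by (rule sqrt_le_D)
    then show ?case using lasso_obj_le_half[OF lam0, of m p "sample_y p D0 \<omega>" D] lasso_obj_nonneg[OF lam0, of m p "sample_y p D0 \<omega>" D]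
      by linarith
  qed
  have "AE \<omega> in \<mu>. \<bar>risk D \<omega>\<bar> \<le> My\<^sup>2 / 2"
    using bounds by eventually_elim simp
  then show "bdd_rv (\<lambda>\<omega>. risk D \<omega>)"
    using meas unfolding bdd_rv_def by blast
qed

lemma prob_Jev: "S \<subseteq> {..<p} \<Longrightarrow> card S = s \<Longrightarrow> prob (Jev S) \<noteq> 0"
  using supp[of S] choose_pos by simp

lemma expectation_decomp:
  assumes f: "bdd_rv f"
  shows "expectation f = (\<Sum>S | S \<subseteq> {..<p} \<and> card S = s. (1 / real (p choose s)) * cond_exp \<mu> (Jev S) f)"
proof -
  let ?\<S> = "{S. S \<subseteq> {..<p} \<and> card S = s}"
  have fin: "finite ?\<S>" by simp
  have b: "bdd_rv (\<lambda>\<omega>. indicator (Jev S) \<omega> * f \<omega>)" for S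
    by (intro bdd_rv_mult bdd_rv_indicator Jev_sets f)
  have "expectation f = expectation (\<lambda>\<omega>. \<Sum>S\<in>?\<S>. indicator (Jev S) \<omega> * f \<omega>)"
  proof (rule integral_cong_AE)
    show "AE \<omega> in \<mu>. f \<omega> = (\<Sum>S\<in>?\<S>. indicator (Jev S) \<omega> * f \<omega>)"
      using AE_supp AE_space
    proof eventually_elim
      case (elim \<omega>)
      have "(\<Sum>S\<in>?\<S>. indicator (Jev S) \<omega> * f \<omega>) = (\<Sum>S\<in>?\<S>. if S = fst \<omega> then f \<omega> else 0)"
        using elim by (intro sum.cong refl) (auto simp: indicator_def)
      then show ?case using elim fin by simp
    qed
  qed (rule bdd_rv_measurable[OF f], rule bdd_rv_measurable[OF bdd_rv_sum[OF b]])
  also have "\<dots> = (\<Sum>S\<in>?\<S>. expectation (\<lambda>\<omega>. indicator (Jev S) \<omega> * f \<omega>))"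
    by (intro Bochner_Integration.integral_sum bdd_rv_integrable b)
  also have "\<dots> = (\<Sum>S\<in>?\<S>. (1 / real (p choose s)) * cond_exp \<mu> (Jev S) f)"
    using supp choose_pos by (intro sum.cong refl) (auto simp: cond_exp_def)
  finally show ?thesis .
qed

text \<open>The first three relations are read off the conditional moments on one concrete support,
  \<open>{..<s}\<close>, which has positive probability; the last compares almost sure bounds.
  Together with \<open>lam \<le> xlow / 4\<close> they make \<open>lam\<close> small against
  \<open>Eabs\<close>, \<open>Ex2 / Eabs\<close> and \<open>Mx / sqrt s\<close>.\<close>

lemma xlow_le_Eabs: "xlow \<le> Eabs"
  and xlow_Eabs_le: "xlow * Eabs \<le> Ex2"
  and s_Ex2_le: "real s * Ex2 \<le> Mx\<^sup>2"
  and sqrt_s_xlow_le: "sqrt (real s) * xlow \<le> Mx"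
proof -
  define S where "S = {..<s}"
  have S: "S \<subseteq> {..<p}" "card S = s" using s_le_p by (auto simp: S_def)
  have finS: "finite S" by (simp add: S_def)
  have 0: "0 \<in> S" "0 < p" using s1 p_pos by (auto simp: S_def)
  have "cond_exp \<mu> (Jev S) (\<lambda>\<omega>. xlow) \<le> cond_exp \<mu> (Jev S) (\<lambda>\<omega>. sgn (fst (snd \<omega>) 0) * fst (snd \<omega>) 0)"
  proof (intro cond_exp_mono_AE Jev_sets bdd_rv_intros bdd_sgn bdd_x 0)
    show "AE \<omega> in \<mu>. \<omega> \<in> Jev S \<longrightarrow> xlow \<le> sgn (fst (snd \<omega>) 0) * fst (snd \<omega>) 0"
      using x_low by eventually_elim (use 0 in \<open>auto simp: sgn_real_def abs_if split: if_splits\<close>)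
  qed
  then show "xlow \<le> Eabs"
    using moments(3)[OF S 0(1) 0(1)] cond_exp_const[OF Jev_sets prob_Jev[OF S]] by simp
  have "cond_exp \<mu> (Jev S) (\<lambda>\<omega>. xlow * (sgn (fst (snd \<omega>) 0) * fst (snd \<omega>) 0)) \<le> cond_exp \<mu> (Jev S) (\<lambda>\<omega>. fst (snd \<omega>) 0 * fst (snd \<omega>) 0)"
  proof (intro cond_exp_mono_AE Jev_sets bdd_rv_intros bdd_sgn bdd_x 0)
    show "AE \<omega> in \<mu>. \<omega> \<in> Jev S \<longrightarrow> xlow * (sgn (fst (snd \<omega>) 0) * fst (snd \<omega>) 0) \<le> fst (snd \<omega>) 0 * fst (snd \<omega>) 0"
      using x_low
    proof eventually_elim
      case (elim \<omega>)
      show ?case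
      proof
        assume "\<omega> \<in> Jev S"
        then have "xlow \<le> \<bar>fst (snd \<omega>) 0\<bar>" using elim 0 by auto
        then have "xlow * \<bar>fst (snd \<omega>) 0\<bar> \<le> \<bar>fst (snd \<omega>) 0\<bar> * \<bar>fst (snd \<omega>) 0\<bar>" by (intro mult_right_mono) auto
        moreover have "sgn (fst (snd \<omega>) 0) * fst (snd \<omega>) 0 = \<bar>fst (snd \<omega>) 0\<bar>"
          by (simp only: abs_sgn mult.commute)
        ultimately show "xlow * (sgn (fst (snd \<omega>) 0) * fst (snd \<omega>) 0) \<le> fst (snd \<omega>) 0 * fst (snd \<omega>) 0"
          by (simp only: abs_mult_self_eq)
      qed
    qed
  qed
  then show "xlow * Eabs \<le> Ex2"
    unfolding cond_exp_scale[OF Jev_sets] using moments(1,3)[OF S 0(1) 0(1)] by simp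
  have "cond_exp \<mu> (Jev S) (\<lambda>\<omega>. \<Sum>i\<in>S. fst (snd \<omega>) i * fst (snd \<omega>) i) \<le> cond_exp \<mu> (Jev S) (\<lambda>\<omega>. Mx\<^sup>2)"
  proof (intro cond_exp_mono_AE Jev_sets bdd_rv_intros bdd_x)
    show "AE \<omega> in \<mu>. \<omega> \<in> Jev S \<longrightarrow> (\<Sum>i\<in>S. fst (snd \<omega>) i * fst (snd \<omega>) i) \<le> Mx\<^sup>2"
      using x_bound'
    proof eventually_elim
      case (elim \<omega>)
      have "(\<Sum>i\<in>S. fst (snd \<omega>) i * fst (snd \<omega>) i) \<le> dot {..<p} (fst (snd \<omega>)) (fst (snd \<omega>))"
        unfolding dot_def using S by (intro sum_mono2) auto
      then show ?case using sqrt_le_D[OF elim] by simp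
    qed
  qed (use S in auto)
  moreover have "cond_exp \<mu> (Jev S) (\<lambda>\<omega>. \<Sum>i\<in>S. fst (snd \<omega>) i * fst (snd \<omega>) i) = (\<Sum>i\<in>S. Ex2)"
    using S moments(1)[OF S] by (subst cond_exp_sum[OF Jev_sets]) (auto intro!: bdd_rv_mult bdd_x sum.cong)
  ultimately show "real s * Ex2 \<le> Mx\<^sup>2"
    using S cond_exp_const[OF Jev_sets prob_Jev[OF S]] by simp
  have "AE \<omega> in \<mu>. sqrt (real s) * xlow \<le> Mx"
    using x_bound' x_low AE_supp
  proof eventually_elim
    case (elim \<omega>)
    then have fin: "finite (fst \<omega>)" using finite_subset by blast
    have "real s * xlow\<^sup>2 = (\<Sum>j\<in>fst \<omega>. xlow\<^sup>2)" using elim by simp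
    also have "\<dots> \<le> (\<Sum>j\<in>fst \<omega>. (fst (snd \<omega>) j)\<^sup>2)"
      using elim pos by (intro sum_mono) (auto simp: abs_le_square_iff[symmetric])
    also have "\<dots> \<le> dot {..<p} (fst (snd \<omega>)) (fst (snd \<omega>))"
      unfolding dot_self using elim by (intro sum_mono2) auto
    also have "\<dots> \<le> Mx\<^sup>2" using elim sqrt_le_D by blast
    finally have "(sqrt (real s) * xlow)\<^sup>2 \<le> Mx\<^sup>2" by (simp add: power_mult_distrib)
    then show ?case by (rule power2_le_imp_le) (use pos in simp)
  qed
  then show "sqrt (real s) * xlow \<le> Mx" by simp
qed

end

text \<open>The last two assumptions are the upper bound on the radius and the noise bound with
  denominators cleared: in \<open>lam / Eabs * C_max\<close> the mean \<open>Eabs\<close>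
  cancels.\<close>

locale dict_perturbation = dict_model +
  fixes \<rho> :: real
  assumes \<rho>_pos: "0 < \<rho>"
    and \<rho>_le: "\<rho> * (7 * Mx) \<le> 2 * lam * (1 - 2 * cum_coherence m p s D0)"
    and Meps_le: "Meps + 7/2 * (\<rho> * Mx) \<le> lam * (1 - 2 * cum_coherence m p s D0)"
begin

text \<open>\<open>\<mu>c\<close> bounds the cumulative coherence of every dictionary within distance \<open>\<rho>\<close> of \<open>D0\<close>.\<close>

definition \<mu>c :: real where "\<mu>c = cum_coherence m p s D0 + 2 * sqrt (real s) * \<rho>"

text \<open>\<open>sqrt s * xlow \<le> Mx\<close> and \<open>lam \<le> xlow / 4\<close> give
  \<open>4 * sqrt s * lam \<le> Mx\<close>, whence
  \<open>14 * sqrt s * \<rho> \<le> 1 - 2 * c\<close> for the coherence \<open>c\<close> of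
  \<open>D0\<close>. So \<open>\<mu>c \<le> (1 + 5 * c) / 7\<close>, which
  \<open>c \<le> 1/4\<close> keeps below 1/3. In the last claim the term
  \<open>7/2 * (\<rho> * Mx)\<close> pays once for the increased coherence and once for the misfit
  \<open>(D0 - D) x\<close>.\<close>

lemma \<mu>c_bounds: "0 \<le> \<mu>c" "\<mu>c \<le> 1/3" "cum_coherence m p s D0 \<le> \<mu>c"
  and \<rho>_small: "\<rho> \<le> 1/14"
  and resid_le: "\<rho> * Mx + Meps \<le> lam * (1 - 2 * \<mu>c)"
proof -
  let ?c = "cum_coherence m p s D0"
  have c: "0 \<le> ?c" "?c \<le> 1/4" using cum_coherence_nonneg[OF p_pos] coh by auto
  have "sqrt (real s) * (4 * lam) \<le> sqrt (real s) * xlow" using lam_le by (intro mult_left_mono) auto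
  then have 1: "4 * (sqrt (real s) * lam) \<le> Mx" using sqrt_s_xlow_le by simp
  have "(sqrt (real s) * \<rho>) * (7 * Mx) \<le> sqrt (real s) * (2 * lam * (1 - 2 * ?c))"
    using \<rho>_le by (simp add: mult.assoc mult_left_mono)
  also have "\<dots> = (sqrt (real s) * lam) * (2 * (1 - 2 * ?c))" by simp
  also have "\<dots> \<le> (Mx / 4) * (2 * (1 - 2 * ?c))" using 1 c by (intro mult_right_mono) auto
  finally have "(14 * (sqrt (real s) * \<rho>)) * Mx \<le> (1 - 2 * ?c) * Mx" by (simp add: algebra_simps)
  then have 2: "14 * (sqrt (real s) * \<rho>) \<le> 1 - 2 * ?c" using pos by simp
  have s0: "0 \<le> sqrt (real s) * \<rho>" using \<rho>_pos by simp
  show "0 \<le> \<mu>c" "\<mu>c \<le> 1/3" "?c \<le> \<mu>c" using c 2 s0 unfolding \<mu>c_def by linarith+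
  have "1 * \<rho> \<le> sqrt (real s) * \<rho>" using s1 \<rho>_pos by (intro mult_right_mono) auto
  then show "\<rho> \<le> 1/14" using 2 c by linarith
  have "4 * (sqrt (real s) * lam) * \<rho> \<le> Mx * \<rho>" using 1 \<rho>_pos by (intro mult_right_mono) auto
  then have "lam * (1 - 2 * \<mu>c) \<ge> lam * (1 - 2 * ?c) - Mx * \<rho>" by (simp add: \<mu>c_def algebra_simps)
  then show "\<rho> * Mx + Meps \<le> lam * (1 - 2 * \<mu>c)"
    using Meps_le mult_pos_pos[OF \<rho>_pos pos(1)] unfolding mult.commute[of Mx \<rho>] by linarith
qed

lemma unit_cols: "D \<in> oblique m p \<Longrightarrow> j < p \<Longrightarrow> gram m D D j j = 1"
  by (simp add: gram_def dot_self oblique_def)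

lemma frob_gram: "(\<Sum>j<p. gram m (\<lambda>k j. D0 k j - D k j) (\<lambda>k j. D0 k j - D k j) j j) = (frob_norm m p (\<lambda>i j. D i j - D0 i j))\<^sup>2"
proof -
  have "(\<Sum>j<p. gram m (\<lambda>k j. D0 k j - D k j) (\<lambda>k j. D0 k j - D k j) j j) = (\<Sum>i<m. \<Sum>j<p. (D i j - D0 i j)\<^sup>2)"
    unfolding gram_def dot_self by (subst sum.swap) (simp add: power2_commute)
  also have "\<dots> = (frob_norm m p (\<lambda>i j. D i j - D0 i j))\<^sup>2" by (simp add: frob_norm_def sum_nonneg)
  finally show ?thesis .
qed

lemma coherence_near:
  assumes D: "D \<in> oblique m p" "frob_norm m p (\<lambda>i j. D i j - D0 i j) \<le> \<rho>"
    and J: "J \<subseteq> {..<p}" "j < p" "j \<notin> J" "card J \<le> s"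
  shows "(\<Sum>i\<in>J. \<bar>gram m D D j i\<bar>) \<le> \<mu>c"
proof -
  have "(\<Sum>i\<in>J. \<bar>gram m D D i j\<bar>) \<le> \<mu>c"
    unfolding \<mu>c_def
  proof (rule sum_gram_perturbed_le[OF J])
    show "(\<Sum>j<p. gram m (\<lambda>k j. D0 k j - D k j) (\<lambda>k j. D0 k j - D k j) j j) \<le> \<rho>\<^sup>2"
      unfolding frob_gram using D(2) by (intro power_mono) auto
  qed (use unit_cols[OF D(1)] unit_cols[OF D0_oblique] cum_coherence_ge cum_coherence_nonneg[OF p_pos] coh \<rho>_pos in auto)
  then show ?thesis by (simp only: gram_sym)
qed

lemma gram_inverse_near:
  assumes D: "D \<in> oblique m p" "frob_norm m p (\<lambda>i j. D i j - D0 i j) \<le> \<rho>"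
    and S: "S \<subseteq> {..<p}" "card S = s"
  shows "\<exists>H. gram_inverse S (gram m D D) H \<mu>c"
proof (rule gram_inverse_exists)
  show fin: "finite S" using S finite_subset by blast
  fix i assume i: "i \<in> S"
  show "(\<Sum>j\<in>S - {i}. \<bar>gram m D D i j\<bar>) \<le> \<mu>c"
    using S i fin by (intro coherence_near[OF D]) (auto simp: card_Diff_singleton_if)
  show "gram m D D i i = 1" using unit_cols[OF D(1)] i S by auto
qed (use \<mu>c_bounds in \<open>auto simp: gram_sym\<close>)

definition Qf :: "mat \<Rightarrow> (nat set \<Rightarrow> mat) \<Rightarrow> nat set \<Rightarrow> sample \<Rightarrow> real" where
  "Qf D H S \<omega> = dot S (noisy_resp D S \<omega>) (app S (H S) (noisy_resp D S \<omega>))"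

lemma bdd_Qf: "S \<subseteq> {..<p} \<Longrightarrow> bdd_rv (Qf D H S)"
  unfolding Qf_def[abs_def] dot_def app_def by (intro bdd_rv_intros bdd_noisy_resp)

text \<open>The misfit of the dictionary is treated as noise: \<open>y = D x + z\<close> with
  \<open>z = (D0 - D) x + eps\<close>, of norm at most \<open>\<rho> * Mx + Meps\<close>.\<close>

lemma lasso_ge_Qf:
  assumes D: "D \<in> oblique m p" "frob_norm m p (\<lambda>i j. D i j - D0 i j) \<le> \<rho>"
    and H: "gram_inverse S (gram m D D) (H S) \<mu>c"
    and S: "S \<subseteq> {..<p}" "card S = s"
  shows "AE \<omega> in \<mu>. \<omega> \<in> Jev S \<longrightarrow>
    (1/2) * dot {..<m} (sample_y p D0 \<omega>) (sample_y p D0 \<omega>) - (1/2) * Qf D H S \<omega> \<le> risk D \<omega>"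
    and "D = D0 \<Longrightarrow> AE \<omega> in \<mu>. \<omega> \<in> Jev S \<longrightarrow>
    risk D \<omega> \<le> (1/2) * dot {..<m} (sample_y p D0 \<omega>) (sample_y p D0 \<omega>) - (1/2) * Qf D H S \<omega>"
proof -
  interpret gi: gram_inverse S "gram m D D" "H S" \<mu>c by (rule H)
  interpret ls: lasso_support S m D "H S" \<mu>c p lam
    using S pos by unfold_locales auto
  have app_supp: "app {..<p} E x = app S E x" if "\<And>j. j \<notin> S \<Longrightarrow> x j = 0" for E :: mat and x
    unfolding app_def using that S by (intro ext sum.mono_neutral_right) auto
  have phi: "ls.phi (sample_y p D0 \<omega>) (\<lambda>j. sgn (fst (snd \<omega>) j)) = (1/2) * dot {..<m} (sample_y p D0 \<omega>) (sample_y p D0 \<omega>) - (1/2) * Qf D H S \<omega>"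
    if "\<And>j. j \<notin> S \<Longrightarrow> fst (snd \<omega>) j = 0" for \<omega>
  proof -
    have e: "app S D0 (fst (snd \<omega>)) = app {..<p} D0 (fst (snd \<omega>))" by (rule app_supp[OF that, symmetric])
    have "sample_y p D0 \<omega> = (\<lambda>i. app S D0 (fst (snd \<omega>)) i + snd (snd \<omega>) i)"
      unfolding e by (simp add: sample_y_def app_def)
    then have "ls.resp (sample_y p D0 \<omega>) (\<lambda>j. sgn (fst (snd \<omega>) j)) = noisy_resp D S \<omega>"
      unfolding ls.resp_def noisy_resp_def by (simp add: cor_linear cor_app) (simp add: app_def cor_def dot_def)
    then show ?thesis unfolding ls.phi_def Qf_def by simp
  qed
  show "AE \<omega> in \<mu>. \<omega> \<in> Jev S \<longrightarrow>
    (1/2) * dot {..<m} (sample_y p D0 \<omega>) (sample_y p D0 \<omega>) - (1/2) * Qf D H S \<omega> \<le> risk D \<omega>"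
    using x_bound' eps_bound' off_supp
  proof eventually_elim
    case (elim \<omega>)
    show ?case
    proof
      assume "\<omega> \<in> Jev S"
      then have x0: "fst (snd \<omega>) j = 0" if "j \<notin> S" for j using elim that by auto
      have e: "app S E (fst (snd \<omega>)) = app {..<p} E (fst (snd \<omega>))" for E :: mat
        by (rule app_supp[OF x0, symmetric])
      define z where "z = (\<lambda>i. app S (\<lambda>i j. D0 i j - D i j) (fst (snd \<omega>)) i + snd (snd \<omega>) i)"
      have "sqrt (dot {..<m} z z) \<le> sqrt (dot {..<m} (app S (\<lambda>i j. D0 i j - D i j) (fst (snd \<omega>))) (app S (\<lambda>i j. D0 i j - D i j) (fst (snd \<omega>))))
          + sqrt (dot {..<m} (snd (snd \<omega>)) (snd (snd \<omega>)))"
        unfolding z_def by (rule sqrt_dot_add_le)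
      also have "\<dots> \<le> \<rho> * Mx + Meps"
      proof (rule add_mono)
        have "sqrt (dot {..<m} (app S (\<lambda>i j. D0 i j - D i j) (fst (snd \<omega>))) (app S (\<lambda>i j. D0 i j - D i j) (fst (snd \<omega>))))
          \<le> frob_norm m p (\<lambda>i j. D0 i j - D i j) * sqrt (dot {..<p} (fst (snd \<omega>)) (fst (snd \<omega>)))"
          unfolding e by (rule sqrt_dot_app_le_frob)
        also have "\<dots> \<le> \<rho> * Mx" using D(2) elim \<rho>_pos
          by (intro mult_mono) (auto simp: frob_norm_diff_commute[of m p D0])
        finally show "sqrt (dot {..<m} (app S (\<lambda>i j. D0 i j - D i j) (fst (snd \<omega>))) (app S (\<lambda>i j. D0 i j - D i j) (fst (snd \<omega>)))) \<le> \<rho> * Mx" .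
      qed (use elim in simp)
      finally have z: "sqrt (dot {..<m} z z) \<le> lam * (1 - 2 * \<mu>c)" using resid_le by linarith
      have "ls.phi (sample_y p D0 \<omega>) (\<lambda>j. sgn (fst (snd \<omega>) j)) \<le> risk D \<omega>"
      proof (rule ls.phi_le_lasso_obj[where x = "fst (snd \<omega>)" and z = z])
        fix i
        show "sample_y p D0 \<omega> i = app S D (fst (snd \<omega>)) i + z i"
          unfolding z_def e by (simp add: sample_y_def app_def algebra_simps sum_subtractf)
      qed (use z unit_cols[OF D(1)] coherence_near[OF D] S \<mu>c_bounds in \<open>auto simp: sgn_real_def\<close>)
      then show "(1/2) * dot {..<m} (sample_y p D0 \<omega>) (sample_y p D0 \<omega>) - (1/2) * Qf D H S \<omega> \<le> risk D \<omega>"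
        using phi[OF x0] by simp
    qed
  qed
  assume DD: "D = D0"
  show "AE \<omega> in \<mu>. \<omega> \<in> Jev S \<longrightarrow>
    risk D \<omega> \<le> (1/2) * dot {..<m} (sample_y p D0 \<omega>) (sample_y p D0 \<omega>) - (1/2) * Qf D H S \<omega>"
    using x_low eps_bound' off_supp
  proof eventually_elim
    case (elim \<omega>)
    show ?case
    proof
      assume \<omega>: "\<omega> \<in> Jev S"
      then have x0: "fst (snd \<omega>) j = 0" if "j \<notin> S" for j using elim that by auto
      have e: "app S E (fst (snd \<omega>)) = app {..<p} E (fst (snd \<omega>))" for E :: mat
        by (rule app_supp[OF x0, symmetric])
      have "risk D \<omega> \<le> ls.phi (sample_y p D0 \<omega>) (\<lambda>j. sgn (fst (snd \<omega>) j))"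
      proof (rule ls.lasso_obj_le_phi[where x = "fst (snd \<omega>)" and z = "snd (snd \<omega>)" and xlow = xlow])
        fix i
        show "sample_y p D0 \<omega> i = app S D (fst (snd \<omega>)) i + snd (snd \<omega>) i"
          unfolding DD e by (simp add: sample_y_def app_def)
      next
        \<comment> \<open>Noise and \<open>lam\<close> together are at most
          \<open>2 * lam \<le> xlow / 2\<close>, which is below
          \<open>2/3 * xlow \<le> (1 - \<mu>c) * xlow\<close>.\<close>
        have "lam * (1 - 2 * \<mu>c) \<le> lam * 1" using \<mu>c_bounds pos by (intro mult_left_mono) auto
        then have "Meps \<le> lam" using resid_le mult_pos_pos[OF \<rho>_pos pos(1)] by linarith
        moreover have "(2/3) * xlow \<le> (1 - \<mu>c) * xlow" using \<mu>c_bounds pos by (intro mult_right_mono) auto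
        ultimately show "sqrt (dot {..<m} (snd (snd \<omega>)) (snd (snd \<omega>))) + lam \<le> (1 - \<mu>c) * xlow"
          using elim lam_le pos by linarith
      qed (use elim \<omega> pos in auto)
      then show "risk D \<omega> \<le> (1/2) * dot {..<m} (sample_y p D0 \<omega>) (sample_y p D0 \<omega>) - (1/2) * Qf D H S \<omega>"
        using phi[OF x0] by simp
    qed
  qed
qed

lemma cond_exp_Qf:
  assumes "gram_inverse S (gram m D D) (H S) \<mu>c" "S \<subseteq> {..<p}" "card S = s"
  shows "cond_exp \<mu> (Jev S) (Qf D H S) = quad_mean Ex2 Eabs Eeps2 lam S (gram m D D0) (gram m D D) (H S)"
proof -
  interpret gi: gram_inverse S "gram m D D" "H S" \<mu>c by fact
  show ?thesis unfolding Qf_def[abs_def] by (rule cond_exp_quadratic_form[OF assms(2,3) gi.symH])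
qed

lemma lam_Eabs_le: "lam * Eabs \<le> Ex2 / 4" "lam\<^sup>2 \<le> lam * Eabs / 4" "0 < Eabs" "0 < Ex2"
proof -
  show e: "0 < Eabs" using xlow_le_Eabs pos by linarith
  have "lam * Eabs \<le> xlow / 4 * Eabs" using lam_le e by (intro mult_right_mono) auto
  then show "lam * Eabs \<le> Ex2 / 4" using xlow_Eabs_le by linarith
  have "lam * lam \<le> lam * (Eabs / 4)" using lam_le xlow_le_Eabs pos by (intro mult_left_mono) auto
  then show "lam\<^sup>2 \<le> lam * Eabs / 4" by (simp add: power2_eq_square)
  show "0 < Ex2" using xlow_Eabs_le mult_pos_pos[OF pos(2) e] by linarith
qed

definition gap :: real where
  "gap = (1/8) * Ex2 * (s / p) * \<rho>\<^sup>2 - 3 * lam * Eabs * (spec_norm m p D0 + 1)\<^sup>2 * (s / p)\<^sup>2 * gram_dev m p D0 * \<rho>"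

lemma D0_near: "frob_norm m p (\<lambda>i j. D0 i j - D0 i j) \<le> \<rho>"
  using \<rho>_pos by simp

text \<open>The common term \<open>|y|^2 / 2\<close> cancels between the lower bound at
  \<open>D\<close> and the upper bound at \<open>D0\<close>, leaving half the difference of two
  quadratic forms on each support.\<close>

lemma expected_gap:
  assumes D: "D \<in> oblique m p" "frob_norm m p (\<lambda>i j. D i j - D0 i j) = \<rho>"
  shows "gap \<le> expectation (\<lambda>\<omega>. risk D \<omega> - risk D0 \<omega>)"
proof -
  let ?\<S> = "{S. S \<subseteq> {..<p} \<and> card S = s}"
  have D': "frob_norm m p (\<lambda>i j. D i j - D0 i j) \<le> \<rho>" using D by simp
  have "\<forall>S. \<exists>H. S \<in> ?\<S> \<longrightarrow> gram_inverse S (gram m D D) H \<mu>c" using gram_inverse_near[OF D(1) D'] by blast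
  from choice[OF this] obtain H where H: "\<And>S. S \<subseteq> {..<p} \<Longrightarrow> card S = s \<Longrightarrow> gram_inverse S (gram m D D) (H S) \<mu>c" by blast
  have "\<forall>S. \<exists>H. S \<in> ?\<S> \<longrightarrow> gram_inverse S (gram m D0 D0) H \<mu>c" using gram_inverse_near[OF D0_oblique D0_near] by blast
  from choice[OF this] obtain H0 where H0: "\<And>S. S \<subseteq> {..<p} \<Longrightarrow> card S = s \<Longrightarrow> gram_inverse S (gram m D0 D0) (H0 S) \<mu>c" by blast
  let ?f = "\<lambda>\<omega>. risk D \<omega> - risk D0 \<omega>"
  have ce: "(1/2) * (quad_mean Ex2 Eabs Eeps2 lam S (gram m D0 D0) (gram m D0 D0) (H0 S)
       - quad_mean Ex2 Eabs Eeps2 lam S (gram m D D0) (gram m D D) (H S)) \<le> cond_exp \<mu> (Jev S) ?f"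
    if S: "S \<subseteq> {..<p}" "card S = s" for S
  proof -
    have "(1/2) * (quad_mean Ex2 Eabs Eeps2 lam S (gram m D0 D0) (gram m D0 D0) (H0 S)
       - quad_mean Ex2 Eabs Eeps2 lam S (gram m D D0) (gram m D D) (H S)) =
      cond_exp \<mu> (Jev S) (\<lambda>\<omega>. (1/2) * (Qf D0 H0 S \<omega> - Qf D H S \<omega>))"
      by (simp only: cond_exp_scale[OF Jev_sets, of _ "1/2" "\<lambda>\<omega>. Qf D0 H0 S \<omega> - Qf D H S \<omega>"]
          cond_exp_diff[OF Jev_sets bdd_Qf[OF S(1), of D0 H0] bdd_Qf[OF S(1), of D H]]
          cond_exp_Qf[where H = H, OF H[OF S] S] cond_exp_Qf[where H = H0, OF H0[OF S] S])
    also have "\<dots> \<le> cond_exp \<mu> (Jev S) ?f"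
    proof (intro cond_exp_mono_AE Jev_sets bdd_rv_intros bdd_Qf S bdd_lasso)
      show "AE \<omega> in \<mu>. \<omega> \<in> Jev S \<longrightarrow> (1/2) * (Qf D0 H0 S \<omega> - Qf D H S \<omega>) \<le> ?f \<omega>"
        using lasso_ge_Qf(1)[where H = H, OF D(1) D' H[OF S] S] lasso_ge_Qf(2)[where H = H0, OF D0_oblique D0_near H0[OF S] S refl]
        by eventually_elim auto
    qed
    finally show ?thesis .
  qed
  \<comment> \<open>The averaged estimate has its constants fixed for coherence 1/3, where the
    inverses have norm at most 3/2.\<close>
  have third: "gram_inverse S G K \<mu>c \<Longrightarrow> gram_inverse S G K (1/3)" for S :: "nat set" and G K
    using \<mu>c_bounds by (elim gram_inverse_mono) auto
  have "(p choose s) * gap \<le> (\<Sum>S\<in>?\<S>. (1/2) * (quad_mean Ex2 Eabs Eeps2 lam S (gram m D0 D0) (gram m D0 D0) (H0 S)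
       - quad_mean Ex2 Eabs Eeps2 lam S (gram m D D0) (gram m D D) (H S)))"
    unfolding gap_def
  proof (rule averaged_quad_mean_gap[OF s1 s_le_p, where \<delta> = "\<lambda>k j. D0 k j - D k j"])
    show "(\<Sum>j<p. gram m (\<lambda>k j. D0 k j - D k j) (\<lambda>k j. D0 k j - D k j) j j) = \<rho>\<^sup>2"
      unfolding frob_gram D(2) ..
    show "dot {..<m} (app {..<p} D x) (app {..<p} D x) \<le> (spec_norm m p D0 + 1)\<^sup>2 * dot {..<p} x x" for x
      using \<rho>_small D by (intro op_norm_perturbed) auto
    show "dot {..<m} (app {..<p} D0 x) (app {..<p} D0 x) \<le> (spec_norm m p D0 + 1)\<^sup>2 * dot {..<p} x x" for x
      by (intro op_norm_perturbed) auto
    show "1 \<le> spec_norm m p D0 + 1" using spec_norm_bound(1) by simp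
    show "gram_inverse S (gram m D D) (H S) (1/3)" "gram_inverse S (gram m D0 D0) (H0 S) (1/3)"
      if "S \<subseteq> {..<p}" "card S = s" for S
      by (rule third[OF H[OF that]], rule third[OF H0[OF that]])
  qed (fact unit_cols[OF D(1)] unit_cols[OF D0_oblique] \<rho>_pos \<rho>_small sparse' lam_Eabs_le less_imp_le[OF lam_Eabs_le(3)] pos(5) refl)+
  also have "\<dots> \<le> (\<Sum>S\<in>?\<S>. cond_exp \<mu> (Jev S) ?f)" by (intro sum_mono ce) auto
  finally have "gap * real (p choose s) \<le> (\<Sum>S\<in>?\<S>. cond_exp \<mu> (Jev S) ?f)" by (simp only: mult.commute)
  then have "gap \<le> (\<Sum>S\<in>?\<S>. cond_exp \<mu> (Jev S) ?f) / real (p choose s)"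
    using pos_le_divide_eq[OF choose_pos] by blast
  then have "gap \<le> (1 / real (p choose s)) * (\<Sum>S\<in>?\<S>. cond_exp \<mu> (Jev S) ?f)" by simp
  also have "\<dots> = expectation ?f"
    unfolding expectation_decomp[OF bdd_rv_diff[OF bdd_lasso bdd_lasso]] by (simp add: sum_distrib_left)
  finally show ?thesis .
qed

text \<open>The risk at \<open>D0\<close> is nonnegative, so the quadratic form there is at most
  \<open>|y|^2\<close>, while its conditional mean is at least \<open>s * Ex2 / 2\<close> because
  \<open>2 * lam * Eabs \<le> Ex2 / 2\<close>. This ties \<open>My\<close> to the signal
  strength.\<close>

lemma s_Ex2_le_My: "real s * Ex2 \<le> 2 * My\<^sup>2"
proof -
  define S where "S = {..<s}"
  have S: "S \<subseteq> {..<p}" "card S = s" using s_le_p by (auto simp: S_def)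
  have "\<forall>S. \<exists>H. S \<in> {S. S \<subseteq> {..<p} \<and> card S = s} \<longrightarrow> gram_inverse S (gram m D0 D0) H \<mu>c"
    using gram_inverse_near[OF D0_oblique D0_near] by blast
  from choice[OF this] obtain H0 where H0: "\<And>S. S \<subseteq> {..<p} \<Longrightarrow> card S = s \<Longrightarrow> gram_inverse S (gram m D0 D0) (H0 S) \<mu>c" by blast
  interpret gi: gram_inverse S "gram m D0 D0" "H0 S" \<mu>c by (rule H0[OF S])
  have "cond_exp \<mu> (Jev S) (Qf D0 H0 S) \<le> cond_exp \<mu> (Jev S) (\<lambda>\<omega>. My\<^sup>2)"
  proof (intro cond_exp_mono_AE Jev_sets bdd_rv_intros bdd_Qf S)
    show "AE \<omega> in \<mu>. \<omega> \<in> Jev S \<longrightarrow> Qf D0 H0 S \<omega> \<le> My\<^sup>2"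
      using lasso_ge_Qf(2)[where H = H0, OF D0_oblique D0_near H0[OF S] S refl] lasso_bounds[of D0] y_bound'
    proof eventually_elim
      case (elim \<omega>)
      then show ?case using sqrt_le_D[OF elim(3)] by auto
    qed
  qed
  then have "(Ex2 + Eeps2 - 2 * lam * Eabs) * s + lam\<^sup>2 * (\<Sum>i\<in>S. H0 S i i) \<le> My\<^sup>2"
    unfolding cond_exp_Qf[where H = H0, OF H0[OF S] S] cond_exp_const[OF Jev_sets prob_Jev[OF S]] gi.quad_mean_self S(2) .
  moreover have "0 \<le> lam\<^sup>2 * (\<Sum>i\<in>S. H0 S i i)" using gi.H_entry by (intro mult_nonneg_nonneg sum_nonneg) auto
  moreover have "(Ex2 / 2) * s \<le> (Ex2 + Eeps2 - 2 * lam * Eabs) * s"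
    using lam_Eabs_le pos by (intro mult_right_mono) auto
  ultimately show ?thesis by (simp add: mult.commute)
qed

end

section \<open>Concentration and local minimizers\<close>

text \<open>The coordinates of a product measure are independent because the measure equals the
  product of its own marginals.\<close>

lemma (in prob_space) hoeffding_PiM_le:
  fixes f :: "'a \<Rightarrow> real" and L :: nat
  assumes f: "f \<in> borel_measurable M" and bnd: "AE x in M. f x \<in> {a..b}" and ab: "a < b"
    and t: "0 \<le> t" and L: "0 < L"
  shows "measure (\<Pi>\<^sub>M l\<in>{..<L}. M) {Y \<in> space (\<Pi>\<^sub>M l\<in>{..<L}. M). (\<Sum>l<L. f (Y l)) \<le> real L * expectation f - real L * t}
    \<le> exp (- 2 * real L * t\<^sup>2 / (b - a)\<^sup>2)"
proof -
  let ?P = "\<Pi>\<^sub>M l\<in>{..<L}. M"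
  have ps: "prob_space M" by unfold_locales
  interpret P: prob_space ?P by (intro prob_space_PiM ps)
  have comp: "(\<lambda>Y. Y l) \<in> measurable ?P M" if "l \<in> {..<L}" for l
    using that by (rule measurable_component_singleton)
  have distr_comp: "distr ?P M (\<lambda>Y. Y l) = M" if "l \<in> {..<L}" for l
    by (rule distr_PiM_component[where M = "\<lambda>_. M"]) (use that ps in auto)
  have "P.indep_vars (\<lambda>_. M) (\<lambda>l Y. Y l) {..<L}"
  proof (subst P.indep_vars_iff_distr_eq_PiM')
    have "distr ?P ?P (\<lambda>x. \<lambda>i\<in>{..<L}. x i) = distr ?P ?P (\<lambda>x. x)"
      by (rule distr_cong) (auto simp: space_PiM PiE_def extensional_restrict)
    also have "\<dots> = ?P" by (rule distr_id)
    also have "\<dots> = (\<Pi>\<^sub>M i\<in>{..<L}. distr ?P M (\<lambda>Y. Y i))"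
      by (rule PiM_cong) (simp_all add: distr_comp)
    finally show "distr ?P ?P (\<lambda>x. \<lambda>i\<in>{..<L}. x i) = (\<Pi>\<^sub>M i\<in>{..<L}. distr ?P M (\<lambda>Y. Y i))" .
  qed (use L comp in auto)
  then have indep: "P.indep_vars (\<lambda>_. borel) (\<lambda>l Y. f (Y l)) {..<L}"
    by (rule P.indep_vars_compose2) (rule f)
  have expect: "P.expectation (\<lambda>Y. f (Y l)) = expectation f" if "l \<in> {..<L}" for l
    using integral_distr[OF comp[OF that] f] distr_comp[OF that] by simp
  interpret H: Hoeffding_ineq ?P "{..<L}" "\<lambda>l Y. f (Y l)" "\<lambda>_. a" "\<lambda>_. b" "\<Sum>l\<in>{..<L}. P.expectation (\<lambda>Y. f (Y l))"
  proof unfold_locales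
    show "AE Y in ?P. f (Y l) \<in> {a..b}" if "l \<in> {..<L}" for l
      by (rule AE_PiM_component[where P = "\<lambda>x. f x \<in> {a..b}"]) (use that ps bnd in auto)
  qed (use indep in auto)
  have "P.prob {Y \<in> space ?P. (\<Sum>l<L. f (Y l)) \<le> (\<Sum>l<L. P.expectation (\<lambda>Y. f (Y l))) - real L * t}
     \<le> exp (- 2 * (real L * t)\<^sup>2 / (\<Sum>l<L. (b - a)\<^sup>2))"
    by (rule H.Hoeffding_ineq_le) (use t ab L in auto)
  also have "(\<Sum>l<L. P.expectation (\<lambda>Y. f (Y l))) = real L * expectation f" by (simp add: expect)
  also have "- 2 * (real L * t)\<^sup>2 / (\<Sum>l<L. (b - a)\<^sup>2) = - 2 * real L * t\<^sup>2 / (b - a)\<^sup>2"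
    using L by (simp add: power2_eq_square)
  finally show ?thesis .
qed

text \<open>\<open>\<tau>\<close> stands for the gap relative to \<open>My\<^sup>2\<close>. The
  sample size forces \<open>p\<close>, \<open>\<nu>\<close> and \<open>1 / \<eta>\<close> below
  \<open>L\<close>, so the base of the net count is at most
  \<open>4 * c0 * L^3 \<le> exp (7 * ln c0 * ln L)\<close>. The logarithm of the count then costs
  \<open>7 * \<nu> * ln c0 * ln L\<close>, which explains the quotient \<open>L / ln L\<close> in
  the hypothesis.\<close>

lemma net_count_numeric:
  fixes L :: nat and \<nu> c0 u \<tau> c \<eta> p :: real and d :: nat
  assumes hyp: "real L / ln (real L) \<ge> (1000/64) * (\<nu> * ln c0 + u) / \<tau>\<^sup>2"
    and \<nu>: "1 \<le> \<nu>" and c0: "3 \<le> c0" and u: "0 < u" and \<tau>: "0 < \<tau>" "\<tau> * p \<le> 1" and p: "1 \<le> p"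
    and d: "1 \<le> d" "real d \<le> \<nu>" and c: "0 < c" "c * d \<le> c0 * p * \<nu>" and \<eta>: "\<tau>\<^sup>2 \<le> \<eta>"
  shows "0 < L" and "(4 * c * d / \<eta>) ^ d * exp (- real L * \<tau>\<^sup>2 / 2) \<le> exp (- u)"
proof -
  define X where "X = \<nu> * ln c0 + u"
  have ln3: "1 \<le> ln (3::real)" using exp_le by (subst ln_ge_iff) auto
  have "ln 3 \<le> ln c0" using c0 by simp
  then have lc: "1 \<le> ln c0" using ln3 by linarith
  have nl: "\<nu> * 1 \<le> \<nu> * ln c0" using lc \<nu> by (intro mult_left_mono) auto
  then have X: "\<nu> \<le> X" using u by (simp add: X_def)
  have "\<tau> * 1 \<le> \<tau> * p" using p \<tau> by (intro mult_left_mono) auto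
  then have \<tau>1: "\<tau> \<le> 1" using \<tau> by linarith
  then have t2: "0 < \<tau>\<^sup>2" "\<tau>\<^sup>2 \<le> 1" using \<tau> by (auto simp: power_le_one)
  define R where "R = (1000/64) * X / \<tau>\<^sup>2"
  have "(1000/64) * X * \<tau>\<^sup>2 \<le> (1000/64) * X * 1" using t2 X \<nu> by (intro mult_left_mono) auto
  then have RX: "(1000/64) * X \<le> R" using t2 unfolding R_def by (subst pos_le_divide_eq) auto
  have R15: "15 \<le> R" using RX X \<nu> by linarith
  have LR: "R \<le> real L / ln (real L)" using hyp by (simp add: R_def X_def)
  have L2: "2 \<le> L"
  proof (rule ccontr)
    \<comment> \<open>For \<open>L = 0\<close> and \<open>L = 1\<close> the quotient is 0, the
      latter since \<open>ln 1 = 0\<close> and division by zero yields 0.\<close>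
    assume "\<not> 2 \<le> L"
    then have "L = 0 \<or> L = 1" by auto
    then show False using LR R15 by auto
  qed
  then have lnpos: "0 < ln (real L)" by simp
  then have LRl: "R * ln (real L) \<le> real L" using LR by (simp add: pos_le_divide_eq)
  have "1 - 1 / real 2 \<le> ln (real 2)" using ln_ge_iff[of 2 1] ln_one_minus_pos_lower_bound[of "1/2"] ln_le_minus_one[of "1/2"]
    by (simp add: ln_div)
  then have ln2: "1/2 \<le> ln (2::real)" by simp
  have "ln 2 \<le> ln (real L)" using L2 by simp
  then have "R * (1/2) \<le> R * ln (real L)" using R15 ln2 by (intro mult_left_mono) auto
  then have "7 \<le> real L" using LRl R15 by linarith
  then have "ln 3 \<le> ln (real L)" by simp
  then have lL: "1 \<le> ln (real L)" using ln3 by linarith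
  have "R * 1 \<le> R * ln (real L)" using lL R15 by (intro mult_left_mono) auto
  then have RL: "R \<le> real L" using LRl by linarith
  show L0: "0 < L" using L2 by simp
  have \<nu>L: "\<nu> \<le> real L" using RX RL X \<nu> by linarith
  have "1 \<le> (1000/64) * X" using X \<nu> by linarith
  then have "1 / \<tau>\<^sup>2 \<le> R" unfolding R_def using t2 by (intro divide_right_mono) auto
  then have tL: "1 / \<tau>\<^sup>2 \<le> real L" using RL by linarith
  have pL: "p \<le> real L"
  proof -
    have "p * \<tau>\<^sup>2 = (\<tau> * p) * \<tau>" by (simp add: power2_eq_square)
    also have "\<dots> \<le> 1 * 1" using \<tau> \<tau>1 p by (intro mult_mono) auto
    finally have "p \<le> 1 / \<tau>\<^sup>2" using t2 by (simp add: pos_le_divide_eq)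
    then show ?thesis using tL by linarith
  qed
  have \<eta>L: "1 / real L \<le> \<eta>"
  proof -
    have "1 \<le> real L * \<tau>\<^sup>2" using tL t2 by (simp add: pos_divide_le_eq)
    then have "1 / real L \<le> \<tau>\<^sup>2" using L0 by (simp add: pos_divide_le_eq mult.commute)
    then show ?thesis using \<eta> by linarith
  qed
  have cd: "0 < c * d" using c d by simp
  have "4 * c * d / \<eta> \<le> 4 * c * d / (1 / real L)" using \<eta>L cd L0 by (intro divide_left_mono mult_pos_pos) (auto simp: t2 less_le_trans[OF t2(1) \<eta>])
  also have "\<dots> = 4 * (c * d) * real L" by simp
  also have "\<dots> \<le> 4 * (c0 * real L * real L) * real L"
  proof -
    have "c0 * p * \<nu> \<le> c0 * real L * real L" using pL \<nu>L c0 p \<nu> by (intro mult_mono) auto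
    then show ?thesis using c by (intro mult_right_mono mult_left_mono) auto
  qed
  finally have base: "4 * c * d / \<eta> \<le> 4 * (c0 * real L * real L) * real L" .
  have "4 * (c0 * real L * real L) * real L \<le> exp (7 * (ln c0 * ln (real L)))"
  proof -
    have ln4: "ln (4::real) \<le> 3" using ln_le_minus_one[of 4] by simp
    have "ln (4 * (c0 * real L * real L) * real L) = ln 4 + (ln c0 + ln (real L) + ln (real L)) + ln (real L)"
      using c0 L0 by (simp add: ln_mult)
    \<comment> \<open>7 = 3 + 1 + 3, from \<open>ln 4 \<le> 3\<close>, \<open>ln c0\<close> and
      \<open>3 * ln L\<close>, each compared with \<open>ln c0 * ln L\<close>.\<close>
    also have "\<dots> \<le> 7 * (ln c0 * ln (real L))"
    proof -
      have "1 * ln (real L) \<le> ln c0 * ln (real L)" using lc lL by (intro mult_right_mono) auto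
      moreover have "ln c0 * 1 \<le> ln c0 * ln (real L)" using lc lL by (intro mult_left_mono) auto
      ultimately show ?thesis using ln4 lc lL by linarith
    qed
    finally have "exp (ln (4 * (c0 * real L * real L) * real L)) \<le> exp (7 * (ln c0 * ln (real L)))"
      by (simp only: exp_le_cancel_iff)
    moreover have "0 < 4 * (c0 * real L * real L) * real L" using c0 L0 by simp
    ultimately show ?thesis by (simp only: exp_ln)
  qed
  then have base': "4 * c * d / \<eta> \<le> exp (7 * (ln c0 * ln (real L)))" using base by linarith
  have "(4 * c * d / \<eta>) ^ d \<le> exp (7 * (ln c0 * ln (real L))) ^ d"
    using base' cd less_le_trans[OF t2(1) \<eta>] by (intro power_mono) auto
  also have "\<dots> = exp (real d * (7 * (ln c0 * ln (real L))))" by (simp only: exp_of_nat_mult)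
  also have "\<dots> \<le> exp (\<nu> * (7 * (ln c0 * ln (real L))))"
    using d lc lL by (simp add: mult_right_mono)
  finally have Q: "(4 * c * d / \<eta>) ^ d \<le> exp (\<nu> * (7 * (ln c0 * ln (real L))))" .
  \<comment> \<open>By hypothesis \<open>X * ln L\<close> is at most
    \<open>64/1000 * L * \<tau>\<^sup>2\<close>; as \<open>7 * 64/1000 < 1/2\<close>, the Hoeffding
    exponent covers both the net and \<open>u\<close>.\<close>
  have "\<nu> * (7 * (ln c0 * ln (real L))) + u \<le> real L * \<tau>\<^sup>2 / 2"
  proof -
    have "u * 1 \<le> u * ln (real L)" using u lL by (intro mult_left_mono) auto
    moreover have "0 \<le> u * ln (real L)" using u lL by simp
    ultimately have "\<nu> * (7 * (ln c0 * ln (real L))) + u \<le> 7 * (X * ln (real L))"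
      unfolding X_def by (simp add: algebra_simps)
    moreover have "(1000/64) * X * ln (real L) \<le> real L * \<tau>\<^sup>2"
      using LRl t2 unfolding R_def by (simp add: field_simps)
    moreover have "0 \<le> X * ln (real L)" using X \<nu> lL by simp
    ultimately show ?thesis by linarith
  qed
  then have "exp (\<nu> * (7 * (ln c0 * ln (real L)))) * exp (- real L * \<tau>\<^sup>2 / 2) \<le> exp (- u)"
    unfolding exp_add[symmetric] by simp
  moreover have "(4 * c * d / \<eta>) ^ d * exp (- real L * \<tau>\<^sup>2 / 2) \<le> exp (\<nu> * (7 * (ln c0 * ln (real L)))) * exp (- real L * \<tau>\<^sup>2 / 2)"
    using Q by (intro mult_right_mono) auto
  ultimately show "(4 * c * d / \<eta>) ^ d * exp (- real L * \<tau>\<^sup>2 / 2) \<le> exp (- u)" by linarith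
qed

section \<open>Sample size and existence of the local minimizer\<close>

context dict_perturbation
begin

lemma gap_le: "gap \<le> (1/8) * (real s * Ex2) / p * \<rho>\<^sup>2"
proof -
  have "0 \<le> gram_dev m p D0" by (simp add: gram_dev_def sum_nonneg)
  then have "0 \<le> 3 * lam * Eabs * (spec_norm m p D0 + 1)\<^sup>2 * (s / p)\<^sup>2 * gram_dev m p D0 * \<rho>"
    using lam_Eabs_le pos \<rho>_pos by simp
  then have "gap \<le> (1/8) * Ex2 * (s / p) * \<rho>\<^sup>2" unfolding gap_def by linarith
  then show ?thesis by (simp add: mult_ac)
qed

text \<open>Side conditions for the mesh \<open>lam * \<tau> / (2 * My)\<close>. They rest on
  \<open>gap * p \<le> s * Ex2 * \<rho>\<^sup>2 / 8\<close>, which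
  \<open>s * Ex2 \<le> 2 * My\<^sup>2\<close> turns into \<open>\<tau> * p \<le> 1\<close>, and
  \<open>s * Ex2 \<le> Mx\<^sup>2\<close> into
  \<open>\<tau> * My \<le> \<rho> * Mx \<le> lam / 2\<close>.\<close>

lemma scale_bounds:
  assumes gap: "0 < gap" and \<tau>: "\<tau> = gap / My\<^sup>2"
  shows "\<tau> * p \<le> 1" "\<tau>\<^sup>2 \<le> lam * \<tau> / (2 * My)" "lam * \<tau> / (2 * My) \<le> 1"
proof -
  have p: "1 \<le> real p" using p_pos by simp
  have My2: "0 < My\<^sup>2" using pos by simp
  have \<tau>0: "0 < \<tau>" using gap My2 by (simp add: \<tau>)
  have gapE: "gap = \<tau> * My\<^sup>2" using My2 by (simp add: \<tau>)
  have r2: "\<rho>\<^sup>2 \<le> 1" using \<rho>_pos \<rho>_small by (simp add: power_le_one)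
  have g8: "gap * p \<le> (1/8) * (real s * Ex2) * \<rho>\<^sup>2"
    using gap_le p by (simp add: pos_le_divide_eq)
  have sE: "0 \<le> real s * Ex2" using lam_Eabs_le by simp
  have "(1/8) * (real s * Ex2) * \<rho>\<^sup>2 \<le> (1/8) * (real s * Ex2) * 1"
    using r2 sE by (intro mult_left_mono) auto
  then have "gap * p \<le> My\<^sup>2" using g8 s_Ex2_le_My My2 by linarith
  then have "(\<tau> * p) * My\<^sup>2 \<le> 1 * My\<^sup>2" unfolding gapE by (simp add: mult_ac)
  then show tp: "\<tau> * p \<le> 1" using My2 by (simp only: mult_le_cancel_right_pos)
  have "\<tau> * 1 \<le> \<tau> * p" using p \<tau>0 by (intro mult_left_mono) auto
  then have \<tau>1: "\<tau> \<le> 1" using tp by linarith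
  have "(\<tau> * My)\<^sup>2 \<le> (\<rho> * Mx)\<^sup>2"
  proof -
    have "gap * 1 \<le> gap * p" using p gap by (intro mult_left_mono) auto
    moreover have "(1/8) * (real s * Ex2) \<le> Mx\<^sup>2" using s_Ex2_le sE by linarith
    then have "(1/8) * (real s * Ex2) * \<rho>\<^sup>2 \<le> Mx\<^sup>2 * \<rho>\<^sup>2" by (rule mult_right_mono) simp
    ultimately have "\<tau> * My\<^sup>2 \<le> Mx\<^sup>2 * \<rho>\<^sup>2" using g8 unfolding gapE by linarith
    moreover have "\<tau> * \<tau> * My\<^sup>2 \<le> 1 * \<tau> * My\<^sup>2" using \<tau>1 \<tau>0 by (intro mult_right_mono) auto
    ultimately show ?thesis by (simp add: power_mult_distrib mult.commute power2_eq_square[of \<tau>])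
  qed
  then have tm: "\<tau> * My \<le> \<rho> * Mx" by (rule power2_le_imp_le) (use \<rho>_pos pos in simp)
  have "lam * (1 - 2 * cum_coherence m p s D0) \<le> lam * 1"
    using cum_coherence_nonneg[OF p_pos] pos by (intro mult_left_mono) auto
  then have "2 * (\<rho> * Mx) \<le> lam" using Meps_le mult_pos_pos[OF \<rho>_pos pos(1)] pos by linarith
  then have "2 * (\<tau> * My) \<le> lam" using tm by linarith
  then have "2 * (\<tau> * My) * \<tau> \<le> lam * \<tau>" using \<tau>0 by (intro mult_right_mono) auto
  then show "\<tau>\<^sup>2 \<le> lam * \<tau> / (2 * My)" using pos by (simp add: pos_le_divide_eq power2_eq_square mult_ac)
  have "lam\<^sup>2 \<le> My\<^sup>2"
  proof -
    have "1 * Ex2 \<le> real s * Ex2" using s1 lam_Eabs_le by (intro mult_right_mono) auto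
    then show ?thesis using lam_Eabs_le s_Ex2_le_My by linarith
  qed
  then have "lam \<le> My" by (rule power2_le_imp_le) (use pos in simp)
  then have "lam * \<tau> \<le> My * 1" using \<tau>0 \<tau>1 pos by (intro mult_mono) auto
  then show "lam * \<tau> / (2 * My) \<le> 1" using pos by (simp add: pos_divide_le_eq)
qed

lemma emp_risk_lipschitz:
  assumes Y: "\<And>l. l < L \<Longrightarrow> sqrt (dot {..<m} (Y l) (Y l)) \<le> My" and L: "0 < L"
    and \<eta>: "frob_norm m p (\<lambda>i j. D i j - D' i j) \<le> \<eta>" "q = \<eta> * My / (2 * lam)" "q \<le> 1"
  shows "emp_risk m p lam L Y D' \<le> emp_risk m p lam L Y D + 3/2 * My\<^sup>2 * q"
proof -
  have "(\<Sum>l<L. lasso_obj m p lam (Y l) D') \<le> (\<Sum>l<L. lasso_obj m p lam (Y l) D + 3/2 * My\<^sup>2 * q)"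
    using Y by (intro sum_mono lasso_obj_lipschitz[OF pos(5) pos(4) _ \<eta>]) auto
  also have "\<dots> = (\<Sum>l<L. lasso_obj m p lam (Y l) D) + real L * (3/2 * My\<^sup>2 * q)" by (simp add: sum.distrib)
  finally have "(1 / real L) * (\<Sum>l<L. lasso_obj m p lam (Y l) D') \<le>
     (1 / real L) * ((\<Sum>l<L. lasso_obj m p lam (Y l) D) + real L * (3/2 * My\<^sup>2 * q))"
    by (rule mult_left_mono) simp
  then show ?thesis unfolding emp_risk_def using L by (simp add: distrib_left)
qed

lemma local_min_of_sphere_gap:
  fixes Y :: "nat \<Rightarrow> nat \<Rightarrow> real"
  assumes Y: "\<And>l. l < L \<Longrightarrow> sqrt (dot {..<m} (Y l) (Y l)) \<le> My" and L: "0 < L"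
    and mp: "m = prod_list ms" "p = prod_list ps" "length ps = length ms"
    and Cset: "Cset = oblique m p \<inter> synth c r ms ps ` params r ms ps" and D0: "D0 \<in> Cset"
    and sphere: "\<And>D. D \<in> Cset \<Longrightarrow> frob_norm m p (\<lambda>i j. D i j - D0 i j) = \<rho> \<Longrightarrow> emp_risk m p lam L Y D0 < emp_risk m p lam L Y D"
  shows "\<exists>Dstar. local_min_on m p Cset (emp_risk m p lam L Y) Dstar \<and> frob_norm m p (\<lambda>i j. Dstar i j - D0 i j) < \<rho>"
proof -
  let ?F = "emp_risk m p lam L Y"
  have "\<exists>D\<in>Cset. frob_norm m p (\<lambda>i j. D i j - D0 i j) \<le> \<rho> \<and>
    (\<forall>D'\<in>Cset. frob_norm m p (\<lambda>i j. D' i j - D0 i j) \<le> \<rho> \<longrightarrow> ?F D \<le> ?F D')"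
    unfolding Cset mp(1,2)
  proof (rule synth_attains_min)
    show "D0 \<in> oblique (prod_list ms) (prod_list ps) \<inter> synth c r ms ps ` params r ms ps" using D0 Cset mp by simp
    fix D and e :: real assume e: "0 < e"
    define q where "q = min 1 (e / (3 * My\<^sup>2))"
    define d where "d = 2 * lam * q / My"
    have q: "0 < q" "q \<le> 1" using e pos by (auto simp: q_def)
    have qd: "q = d * My / (2 * lam)" using pos by (simp add: d_def)
    have "3 * My\<^sup>2 * q \<le> 3 * My\<^sup>2 * (e / (3 * My\<^sup>2))" using pos by (intro mult_left_mono) (auto simp: q_def)
    then have qe: "3/2 * My\<^sup>2 * q < e" using e pos by simp
    show "\<exists>d>0. \<forall>D'\<in>oblique (prod_list ms) (prod_list ps) \<inter> synth c r ms ps ` params r ms ps.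
      frob_norm (prod_list ms) (prod_list ps) (\<lambda>i j. D' i j - D i j) < d \<longrightarrow>
      \<bar>emp_risk (prod_list ms) (prod_list ps) lam L Y D' - emp_risk (prod_list ms) (prod_list ps) lam L Y D\<bar> < e"
      unfolding mp(1,2)[symmetric]
    proof (intro exI[of _ d] conjI ballI impI)
      show "0 < d" using q pos by (simp add: d_def)
      fix D' assume "frob_norm m p (\<lambda>i j. D' i j - D i j) < d"
      then have n: "frob_norm m p (\<lambda>i j. D' i j - D i j) \<le> d" "frob_norm m p (\<lambda>i j. D i j - D' i j) \<le> d"
        by (simp_all add: frob_norm_diff_commute[of m p D D'])
      have "?F D \<le> ?F D' + 3/2 * My\<^sup>2 * q" by (rule emp_risk_lipschitz[OF _ L n(1) qd q(2)]) (rule Y)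
      moreover have "?F D' \<le> ?F D + 3/2 * My\<^sup>2 * q" by (rule emp_risk_lipschitz[OF _ L n(2) qd q(2)]) (rule Y)
      ultimately show "\<bar>?F D' - ?F D\<bar> < e" using qe by linarith
    qed
  qed (use \<rho>_pos mp in auto)
  then obtain D where D: "D \<in> Cset" "frob_norm m p (\<lambda>i j. D i j - D0 i j) \<le> \<rho>"
    and min: "\<And>D'. D' \<in> Cset \<Longrightarrow> frob_norm m p (\<lambda>i j. D' i j - D0 i j) \<le> \<rho> \<Longrightarrow> ?F D \<le> ?F D'"
    by blast
  have "?F D \<le> ?F D0" using D0 D0_near by (rule min)
  then have "frob_norm m p (\<lambda>i j. D i j - D0 i j) \<noteq> \<rho>" using sphere[OF D(1)] by force
  then have lt: "frob_norm m p (\<lambda>i j. D i j - D0 i j) < \<rho>" using D(2) by simp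
  have "local_min_on m p Cset ?F D"
    unfolding local_min_on_def
  proof (intro conjI D(1) exI[of _ "\<rho> - frob_norm m p (\<lambda>i j. D i j - D0 i j)"] ballI impI)
    fix D' assume "D' \<in> Cset" "frob_norm m p (\<lambda>i j. D' i j - D i j) < \<rho> - frob_norm m p (\<lambda>i j. D i j - D0 i j)"
    then show "?F D \<le> ?F D'" using frob_norm_diff_triangle[of m p D' D0 D] by (intro min) auto
  qed (use lt in simp)
  then show ?thesis using lt by blast
qed

text \<open>At a net point the empirical difference may fall short of its mean by
  \<open>gap / 2\<close>, and passing to an arbitrary point of the sphere costs
  \<open>3/8 * gap\<close>, so a margin of \<open>gap / 8\<close> remains.\<close>

lemma high_probability_local_min:
  fixes L d :: nat and \<nu> c0 c u :: real
  assumes mp: "m = prod_list ms" "p = prod_list ps" "length ps = length ms"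
    and Cset: "Cset = oblique m p \<inter> synth c r ms ps ` params r ms ps" and D0: "D0 \<in> Cset"
    and gap: "0 < gap" and \<tau>: "\<tau> = gap / My\<^sup>2"
    and d: "d = r * (\<Sum>n<length ms. ms ! n * ps ! n)" "1 \<le> d" "real d \<le> \<nu>"
    and c: "0 < c" "1 \<le> c * d" "c * d \<le> c0 * p * \<nu>" and c0: "3 \<le> c0" and u: "0 < u"
    and L: "real L / ln (real L) \<ge> (1000/64) * (\<nu> * ln c0 + u) / \<tau>\<^sup>2"
  shows "\<exists>A \<in> sets (\<Pi>\<^sub>M l\<in>{..<L}. \<mu>). measure (\<Pi>\<^sub>M l\<in>{..<L}. \<mu>) A \<ge> 1 - exp (- u) \<and>
    (\<forall>Y\<in>A. \<exists>Dstar. local_min_on m p Cset (emp_risk m p lam L (\<lambda>l. sample_y p D0 (Y l))) Dstar \<and>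
       frob_norm m p (\<lambda>i j. Dstar i j - D0 i j) < \<rho>)"
proof -
  have \<tau>0: "0 < \<tau>" using gap pos by (simp add: \<tau>)
  \<comment> \<open>With this mesh the parameter \<open>q\<close> of the Lipschitz bound is
    \<open>\<tau> / 4\<close>, and the loss is
    \<open>3/2 * My\<^sup>2 * \<tau> / 4 = 3/8 * gap\<close>.\<close>
  define \<eta> where "\<eta> = lam * \<tau> / (2 * My)"
  note sb = scale_bounds[OF gap \<tau>, folded \<eta>_def]
  have \<eta>0: "0 < \<eta>" using \<tau>0 pos by (simp add: \<eta>_def)
  have num: "0 < L" "(4 * c * d / \<eta>) ^ d * exp (- real L * \<tau>\<^sup>2 / 2) \<le> exp (- u)"
    using net_count_numeric[OF L _ c0 u \<tau>0 sb(1) _ d(2,3) c(1,3) sb(2)] d p_pos by auto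
  define S where "S = {D \<in> Cset. frob_norm m p (\<lambda>i j. D i j - D0 i j) = \<rho>}"
  have "\<exists>Q\<subseteq>S. finite Q \<and> real (card Q) \<le> (4 * c * d / \<eta>) ^ d \<and>
    (\<forall>D\<in>S. \<exists>D'\<in>Q. frob_norm m p (\<lambda>i j. D i j - D' i j) \<le> \<eta>)"
    unfolding mp(1,2)
    by (rule synth_net[OF _ c(1) mp(3) d(1,2) \<eta>0]) (use sb(3) c(2) in \<open>auto simp: S_def Cset\<close>)
  then obtain Q where Q: "Q \<subseteq> S" "finite Q" "real (card Q) \<le> (4 * c * d / \<eta>) ^ d"
    and net: "\<And>D. D \<in> S \<Longrightarrow> \<exists>D'\<in>Q. frob_norm m p (\<lambda>i j. D i j - D' i j) \<le> \<eta>" by blast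
  let ?P = "\<Pi>\<^sub>M l\<in>{..<L}. \<mu>"
  interpret P: prob_space ?P by (intro prob_space_PiM) unfold_locales
  define f where "f = (\<lambda>D \<omega>. risk D \<omega> - risk D0 \<omega>)"
  define bad where "bad = (\<lambda>D. {Y \<in> space ?P. (\<Sum>l<L. f D (Y l)) \<le> real L * expectation (f D) - real L * (gap / 2)})"
  have fm: "f D \<in> borel_measurable \<mu>" for D
    unfolding f_def by (intro bdd_rv_measurable bdd_rv_diff bdd_lasso)
  have bad_sets: "bad D \<in> P.events" for D
  proof -
    have "(\<lambda>Y. f D (Y l)) \<in> borel_measurable ?P" if "l \<in> {..<L}" for l
      using measurable_component_singleton[OF that] fm by (rule measurable_compose)
    then have "(\<lambda>Y. \<Sum>l<L. f D (Y l)) \<in> borel_measurable ?P" by (rule borel_measurable_sum)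
    then show ?thesis unfolding bad_def by measurable
  qed
  have bad_prob: "P.prob (bad D) \<le> exp (- real L * \<tau>\<^sup>2 / 2)" for D
  proof -
    have "P.prob (bad D) \<le> exp (- 2 * real L * (gap / 2)\<^sup>2 / (My\<^sup>2 / 2 - (- (My\<^sup>2 / 2)))\<^sup>2)"
      unfolding bad_def
    proof (rule hoeffding_PiM_le[OF fm _ _ _ num(1)])
      show "AE \<omega> in \<mu>. f D \<omega> \<in> {- (My\<^sup>2 / 2)..My\<^sup>2 / 2}"
        using lasso_bounds[of D] lasso_bounds[of D0] by eventually_elim (auto simp: f_def)
    qed (use pos gap in auto)
    also have "- 2 * real L * (gap / 2)\<^sup>2 / (My\<^sup>2 / 2 - (- (My\<^sup>2 / 2)))\<^sup>2 = - real L * \<tau>\<^sup>2 / 2"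
      unfolding \<tau> by (simp add: power_divide)
    finally show ?thesis .
  qed
  define G where "G = {\<omega> \<in> space \<mu>. sqrt (\<Sum>i<m. (sample_y p D0 \<omega> i)\<^sup>2) \<le> My}"
  have "(\<lambda>\<omega>. sample_y p D0 \<omega> i) \<in> borel_measurable \<mu>" for i
    unfolding sample_y_def
    by (intro borel_measurable_add borel_measurable_sum borel_measurable_times measurable_parts borel_measurable_const)
  then have G: "G \<in> events" unfolding G_def by measurable
  \<comment> \<open>The Lipschitz estimate is applied to each \<open>Y\<close> of the good event, so
    its samples must be bounded pointwise; the almost sure bound makes this restriction
    free.\<close>
  define B where "B = (\<Pi>\<^sub>E l\<in>{..<L}. G)"
  have B: "B \<in> P.events" unfolding B_def using G by (intro sets_PiM_I_finite) auto
  have B_AE: "AE Y in ?P. Y \<in> B"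
  proof -
    have "AE \<omega> in \<mu>. \<omega> \<in> G" using y_bound AE_space by eventually_elim (simp add: G_def)
    then have "AE Y in ?P. \<forall>l\<in>{..<L}. Y l \<in> G"
      by (intro eventually_ball_finite ballI AE_PiM_component[where P = "\<lambda>x. x \<in> G"]) (auto intro: prob_space_axioms)
    then show ?thesis using AE_space
      by eventually_elim (auto simp: B_def space_PiM PiE_def)
  qed
  define A where "A = (space ?P - (\<Union>D\<in>Q. bad D)) \<inter> B"
  have U: "(\<Union>D\<in>Q. bad D) \<in> P.events" using Q(2) bad_sets by (intro sets.finite_UN) auto
  have A: "A \<in> P.events" unfolding A_def using U B by auto
  have "P.prob (\<Union>D\<in>Q. bad D) \<le> (\<Sum>D\<in>Q. P.prob (bad D))"
    by (rule P.finite_measure_subadditive_finite) (use Q(2) bad_sets in auto)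
  also have "\<dots> \<le> (\<Sum>D\<in>Q. exp (- real L * \<tau>\<^sup>2 / 2))" by (intro sum_mono bad_prob)
  also have "\<dots> = real (card Q) * exp (- real L * \<tau>\<^sup>2 / 2)" by simp
  also have "\<dots> \<le> (4 * c * d / \<eta>) ^ d * exp (- real L * \<tau>\<^sup>2 / 2)" using Q(3) by (intro mult_right_mono) auto
  also have "\<dots> \<le> exp (- u)" by (rule num(2))
  finally have "1 - exp (- u) \<le> P.prob (space ?P - (\<Union>D\<in>Q. bad D))" using P.prob_compl[OF U] by simp
  also have "\<dots> = P.prob A"
  proof (rule P.finite_measure_eq_AE)
    show "AE x in ?P. (x \<in> space ?P - (\<Union>D\<in>Q. bad D)) = (x \<in> A)"
      using B_AE by eventually_elim (simp add: A_def)
  qed (use A U in auto)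
  finally have prob: "1 - exp (- u) \<le> P.prob A" .
  have "\<exists>Dstar. local_min_on m p Cset (emp_risk m p lam L (\<lambda>l. sample_y p D0 (Y l))) Dstar \<and>
       frob_norm m p (\<lambda>i j. Dstar i j - D0 i j) < \<rho>" if Y: "Y \<in> A" for Y
  proof (rule local_min_of_sphere_gap[OF _ num(1) mp Cset D0])
    have YG: "Y l \<in> G" if "l < L" for l using Y that by (auto simp: A_def B_def)
    then show Yb: "sqrt (dot {..<m} (sample_y p D0 (Y l)) (sample_y p D0 (Y l))) \<le> My" if "l < L" for l
      using that by (auto simp: G_def dot_self)
    fix D assume D: "D \<in> Cset" "frob_norm m p (\<lambda>i j. D i j - D0 i j) = \<rho>"
    let ?F = "emp_risk m p lam L (\<lambda>l. sample_y p D0 (Y l))"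
    have "D \<in> S" using D by (simp add: S_def)
    then obtain D' where D': "D' \<in> Q" "frob_norm m p (\<lambda>i j. D i j - D' i j) \<le> \<eta>" using net by blast
    have "D' \<in> oblique m p" "frob_norm m p (\<lambda>i j. D' i j - D0 i j) = \<rho>"
      using D'(1) Q(1) by (auto simp: S_def Cset)
    then have "gap \<le> expectation (f D')" unfolding f_def by (rule expected_gap)
    then have "real L * gap \<le> real L * expectation (f D')" by (intro mult_left_mono) auto
    moreover have "real L * expectation (f D') - real L * (gap / 2) < (\<Sum>l<L. f D' (Y l))"
      using Y D'(1) unfolding A_def bad_def by force
    ultimately have "real L * (gap / 2) < (\<Sum>l<L. f D' (Y l))" by simp
    then have "(1 / real L) * (real L * (gap / 2)) < (1 / real L) * (\<Sum>l<L. f D' (Y l))"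
      using num(1) by (intro mult_strict_left_mono) auto
    moreover have "(1 / real L) * (\<Sum>l<L. f D' (Y l)) = ?F D' - ?F D0"
      unfolding emp_risk_def f_def by (simp add: sum_subtractf right_diff_distrib)
    moreover have "(1 / real L) * (real L * (gap / 2)) = gap / 2" using num(1) by simp
    ultimately have 1: "gap / 2 < ?F D' - ?F D0" by linarith
    have q: "\<tau> / 4 = \<eta> * My / (2 * lam)" using pos by (simp add: \<eta>_def)
    have "\<tau> / 4 \<le> 1"
    proof -
      have "\<tau> * 1 \<le> \<tau> * p" using p_pos \<tau>0 by (intro mult_left_mono) auto
      then show ?thesis using sb(1) by linarith
    qed
    then have "?F D' \<le> ?F D + 3/2 * My\<^sup>2 * (\<tau> / 4)"
      by (intro emp_risk_lipschitz[OF _ num(1) D'(2) q]) (use Yb in auto)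
    also have "3/2 * My\<^sup>2 * (\<tau> / 4) = 3/8 * gap" using pos by (simp add: \<tau>)
    finally show "?F D0 < ?F D" using 1 gap by linarith
  qed
  then show ?thesis using A prob by blast
qed

end

text \<open>Triangle inequality for the norm \<open>sqrt p\<close> of a matrix with unit columns.
  Together with \<open>16 \<le> p\<close> it excludes \<open>r = 0\<close> and gives
  \<open>r * c \<ge> 4\<close>, so that \<open>c0 \<ge> 3\<close>.\<close>

lemma sqrt_card_cols_le_of_cK_set:
  assumes "D \<in> cK_set ms ps r c"
  shows "sqrt (prod_list ps) \<le> real r * c"
proof -
  obtain F where F: "\<And>k. k < r \<Longrightarrow> frob_norm (prod_list ms) (prod_list ps) (kron_list (F k) ms ps) \<le> c"
    "\<And>i j. i < prod_list ms \<Longrightarrow> j < prod_list ps \<Longrightarrow> D i j = (\<Sum>k<r. kron_list (F k) ms ps i j)"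
    and obl: "D \<in> oblique (prod_list ms) (prod_list ps)" using assms unfolding cK_set_def by blast
  have "sqrt (prod_list ps) = frob_norm (prod_list ms) (prod_list ps) (\<lambda>i j. \<Sum>k<r. kron_list (F k) ms ps i j)"
    unfolding frob_norm_oblique[OF obl, symmetric] by (rule frob_norm_cong) (rule F(2))
  also have "\<dots> \<le> (\<Sum>k<r. frob_norm (prod_list ms) (prod_list ps) (kron_list (F k) ms ps))" by (rule frob_norm_sum_le)
  also have "\<dots> \<le> (\<Sum>k<r. c)" by (intro sum_mono F(1)) simp
  finally show ?thesis by simp
qed

text \<open>All three constraint sets are of the form \<open>cK_set\<close>, which is compact and has small nets.\<close>

lemma constraint_set_cases:
  fixes \<nu> c c0 :: real
  assumes N: "2 \<le> N" "length ms = N" "length ps = N" and ge1: "\<forall>n<N. ms ! n \<ge> 1 \<and> ps ! n \<ge> 1"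
    and cases: "(Cset = K_set ms ps 1 \<and> \<nu> = (\<Sum>n<N. real (ms ! n * ps ! n)) \<and> c0 = 3) \<or>
     (N = 2 \<and> Cset = K_set ms ps r \<and>
        \<nu> = 2 * real r * real (ms ! 0 * ps ! 0 + ms ! 1 * ps ! 1 + 1) \<and> c0 = 9 * real (prod_list ps)) \<or>
     (c > 0 \<and> Cset = cK_set ms ps r c \<and>
        \<nu> = real r * (\<Sum>n<N. real (ms ! n * ps ! n)) \<and> c0 = real r * c)"
    and D0: "D0 \<in> Cset" and p: "16 \<le> prod_list ps"
  obtains r' c' d where "Cset = cK_set ms ps r' c'" "d = r' * (\<Sum>n<length ms. ms ! n * ps ! n)" "1 \<le> d" "real d \<le> \<nu>"
    "0 < c'" "1 \<le> c' * d" "c' * d \<le> c0 * prod_list ps * \<nu>" "3 \<le> c0"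
proof -
  define p where "p = real (prod_list ps)"
  define \<Sigma> where "\<Sigma> = (\<Sum>n<length ms. ms ! n * ps ! n)"
  have p16: "16 \<le> p" using p by (simp add: p_def)
  have "ms ! 0 * ps ! 0 \<le> \<Sigma>" unfolding \<Sigma>_def using N by (intro member_le_sum) auto
  moreover have "1 * 1 \<le> ms ! 0 * ps ! 0" using ge1 N by (intro mult_le_mono) auto
  ultimately have \<Sigma>1: "1 \<le> \<Sigma>" by linarith
  have \<Sigma>r: "(\<Sum>n<N. real (ms ! n * ps ! n)) = real \<Sigma>" using N by (simp add: \<Sigma>_def)
  have sp: "4 \<le> sqrt p" "sqrt p \<le> p"
  proof -
    have "sqrt 16 \<le> sqrt p" using p16 by (rule real_sqrt_le_mono)
    then show s4: "4 \<le> sqrt p" by simp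
    have "sqrt p * 1 \<le> sqrt p * sqrt p" by (rule mult_left_mono) (use s4 in linarith)+
    also have "\<dots> = p" using p16 by simp
    finally show "sqrt p \<le> p" by simp
  qed
  have len: "length ps = length ms" "ms \<noteq> []" using N by auto
  have r1: "1 \<le> r'" if "Cset = cK_set ms ps r' c'" for r' c'
  proof (rule ccontr)
    assume "\<not> 1 \<le> r'"
    then have "r' = 0" by simp
    then show False using sqrt_card_cols_le_of_cK_set[of D0 ms ps r' c'] D0 that sp(1) by (simp add: p_def)
  qed
  show thesis
    using cases
  proof (elim disjE conjE)
    assume h: "Cset = K_set ms ps 1" "\<nu> = (\<Sum>n<N. real (ms ! n * ps ! n))" "c0 = 3"
    have \<nu>: "\<nu> = real \<Sigma>" using h(2) \<Sigma>r by simp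
    show thesis
    proof (rule that[of 1 "sqrt p" "1 * \<Sigma>"])
      show "Cset = cK_set ms ps 1 (sqrt p)" unfolding h(1) p_def by (rule K_set_rank_one[OF len])
      show "1 \<le> sqrt p * real (1 * \<Sigma>)" using mult_mono[of 1 "sqrt p" 1 "real \<Sigma>"] sp \<Sigma>1 by simp
      show "sqrt p * real (1 * \<Sigma>) \<le> c0 * real (prod_list ps) * \<nu>"
        unfolding h(3) \<nu> p_def[symmetric] using sp p16 by (intro mult_mono) auto
    qed (use \<Sigma>1 h \<nu> sp in \<open>auto simp: \<Sigma>_def\<close>)
  next
    assume h: "N = 2" "Cset = K_set ms ps r" "\<nu> = 2 * real r * real (ms ! 0 * ps ! 0 + ms ! 1 * ps ! 1 + 1)"
      "c0 = 9 * real (prod_list ps)"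
    have cK: "Cset = cK_set ms ps r (sqrt p)" unfolding h(2) p_def by (rule K_set_two_factors) (use N h in auto)
    have r: "1 \<le> r" by (rule r1[OF cK])
    have "\<Sigma> = ms ! 0 * ps ! 0 + ms ! 1 * ps ! 1" unfolding \<Sigma>_def N(2) h(1) by (simp add: numeral_2_eq_2)
    then have \<nu>: "\<nu> = 2 * real r * (real \<Sigma> + 1)" using h(3) by simp
    have d\<nu>: "real (r * \<Sigma>) \<le> \<nu>" unfolding \<nu> using r by (simp add: algebra_simps)
    have d1: "1 \<le> r * \<Sigma>" using r \<Sigma>1 by simp
    show thesis
    proof (rule that[of r "sqrt p" "r * \<Sigma>"])
      have "1 \<le> real (r * \<Sigma>)" by (metis d1 of_nat_1 of_nat_le_iff)
      then have "1 * 1 \<le> sqrt p * real (r * \<Sigma>)" by (intro mult_mono) (use sp in linarith)+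
      then show "1 \<le> sqrt p * real (r * \<Sigma>)" by simp
      have "sqrt p * real (r * \<Sigma>) \<le> p * \<nu>" using sp d\<nu> p16 by (intro mult_mono) auto
      also have "\<dots> \<le> (9 * p * p) * \<nu>"
      proof (rule mult_right_mono)
        have "1 * p \<le> (9 * p) * p" using p16 by (intro mult_right_mono) auto
        then show "p \<le> 9 * p * p" by simp
        show "0 \<le> \<nu>" using d\<nu> d1 by linarith
      qed
      finally show "sqrt p * real (r * \<Sigma>) \<le> c0 * real (prod_list ps) * \<nu>" unfolding h(4) p_def[symmetric] .
      show "3 \<le> c0" unfolding h(4) p_def[symmetric] using p16 by simp
    qed (use cK d1 d\<nu> sp in \<open>auto simp: \<Sigma>_def\<close>)
  next
    assume h: "0 < c" "Cset = cK_set ms ps r c" "\<nu> = real r * (\<Sum>n<N. real (ms ! n * ps ! n))" "c0 = real r * c"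
    have r: "1 \<le> r" by (rule r1[OF h(2)])
    have \<nu>: "\<nu> = real (r * \<Sigma>)" using h(3) \<Sigma>r by simp
    have c04: "4 \<le> c0" using sqrt_card_cols_le_of_cK_set[of D0 ms ps r c] D0 h(2,4) sp(1) by (simp add: p_def)
    have d1: "1 \<le> r * \<Sigma>" using r \<Sigma>1 by simp
    have cd: "c * real (r * \<Sigma>) = c0 * real \<Sigma>" by (simp add: h(4))
    have "1 * \<Sigma> \<le> r * \<Sigma>" using r by (rule mult_le_mono1)
    then have "real \<Sigma> \<le> \<nu>" unfolding \<nu> by (metis mult_1 of_nat_le_iff)
    then have "1 * real \<Sigma> \<le> p * \<nu>" using p16 by (intro mult_mono) auto
    then have "c0 * real \<Sigma> \<le> c0 * (p * \<nu>)" using c04 by (intro mult_left_mono) auto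
    then have le: "c * real (r * \<Sigma>) \<le> c0 * real (prod_list ps) * \<nu>" unfolding cd p_def[symmetric] by (simp add: mult.assoc)
    have "1 * 1 \<le> c0 * real \<Sigma>" using c04 \<Sigma>1 by (intro mult_mono) auto
    then have ge: "1 \<le> c * real (r * \<Sigma>)" unfolding cd by simp
    show thesis
      by (rule that[of r c "r * \<Sigma>", OF h(2) _ d1 _ h(1) ge le]) (use \<nu> c04 in \<open>auto simp: \<Sigma>_def\<close>)
  qed
qed

text \<open>Taking \<open>Ex2 * (s / p) * \<rho> / 8\<close> out of \<open>gap\<close> leaves
  \<open>\<rho>\<close> minus exactly \<open>lam / Eabs * C_min\<close>; this brings the gap into
  the shape of the sample size condition.\<close>

lemma (in dict_model) gap_eq:
  assumes "dict_perturbation \<mu> m p s D0 Ex2 Eabs Eeps2 Mx xlow Meps My lam \<rho>"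
  shows "8 * real p * dict_perturbation.gap m p s D0 Ex2 Eabs lam \<rho> =
    \<rho> * (\<rho> - lam / Eabs * C_min Eabs Ex2 s m p D0) * real s * Ex2"
proof -
  interpret dict_perturbation \<mu> m p s D0 Ex2 Eabs Eeps2 Mx xlow Meps My lam \<rho> by fact
  have "lam / Eabs * C_min Eabs Ex2 s m p D0 = 24 * lam * Eabs / Ex2 * (spec_norm m p D0 + 1)\<^sup>2 * (real s / real p) * gram_dev m p D0"
    using lam_Eabs_le by (simp add: C_min_def power2_eq_square)
  note e = this
  show ?thesis unfolding gap_def e using lam_Eabs_le(3,4) p_pos
    by (simp add: field_simps power2_eq_square)
qed

lemma (in dict_model) local_min_of_sample_size:
  fixes \<nu> c c0 u \<rho> :: real
  assumes mp: "m = prod_list ms" "p = prod_list ps"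
    and N: "2 \<le> N" "length ms = N" "length ps = N" and ge1: "\<forall>n<N. ms ! n \<ge> 1 \<and> ps ! n \<ge> 1"
    and cases: "(Cset = K_set ms ps 1 \<and> \<nu> = (\<Sum>n<N. real (ms ! n * ps ! n)) \<and> c0 = 3) \<or>
     (N = 2 \<and> Cset = K_set ms ps r \<and>
        \<nu> = 2 * real r * real (ms ! 0 * ps ! 0 + ms ! 1 * ps ! 1 + 1) \<and> c0 = 9 * real p) \<or>
     (c > 0 \<and> Cset = cK_set ms ps r c \<and>
        \<nu> = real r * (\<Sum>n<N. real (ms ! n * ps ! n)) \<and> c0 = real r * c)"
    and D0: "D0 \<in> Cset" and u: "0 < u"
    and \<rho>: "lam / Eabs * C_min Eabs Ex2 s m p D0 < \<rho>" "\<rho> < lam / Eabs * C_max Eabs Mx s m p D0"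
      "Meps / Mx < 7/2 * (lam / Eabs * C_max Eabs Mx s m p D0 - \<rho>)"
    and L: "real L / ln (real L) \<ge> 1000 * (real p)\<^sup>2 * (\<nu> * ln c0 + u) * My ^ 4 /
      (\<rho> * (\<rho> - lam / Eabs * C_min Eabs Ex2 s m p D0) * real s * Ex2)\<^sup>2"
  shows "\<exists>A \<in> sets (\<Pi>\<^sub>M l\<in>{..<L}. \<mu>). measure (\<Pi>\<^sub>M l\<in>{..<L}. \<mu>) A \<ge> 1 - exp (- u) \<and>
    (\<forall>Y\<in>A. \<exists>Dstar. local_min_on m p Cset (emp_risk m p lam L (\<lambda>l. sample_y p D0 (Y l))) Dstar \<and>
       frob_norm m p (\<lambda>i j. Dstar i j - D0 i j) < \<rho>)"
proof -
  have E: "0 < Eabs" "0 < Ex2"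
    using xlow_le_Eabs xlow_Eabs_le pos mult_pos_pos[of xlow Eabs] by linarith+
  define q where "q = 1 - 2 * cum_coherence m p s D0"
  have Cmax: "lam / Eabs * C_max Eabs Mx s m p D0 = 2 * lam * q / (7 * Mx)"
    using E pos by (simp add: C_max_def q_def)
  have "0 \<le> lam / Eabs * C_min Eabs Ex2 s m p D0"
    unfolding C_min_def gram_dev_def using E pos
    by (intro mult_nonneg_nonneg divide_nonneg_nonneg real_sqrt_ge_zero sum_nonneg) auto
  then have \<rho>0: "0 < \<rho>" using \<rho>(1) by linarith
  have \<rho>1: "\<rho> * (7 * Mx) \<le> 2 * lam * q" using \<rho>(2) pos unfolding Cmax by (simp add: pos_less_divide_eq)
  have "Meps < 7/2 * (2 * lam * q / (7 * Mx) - \<rho>) * Mx" using \<rho>(3) pos unfolding Cmax by (simp only: pos_divide_less_eq)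
  also have "\<dots> = lam * q - 7/2 * (\<rho> * Mx)" using pos by (simp add: field_simps)
  finally have Meps: "Meps + 7/2 * (\<rho> * Mx) \<le> lam * q" by linarith
  interpret dict_perturbation \<mu> m p s D0 Ex2 Eabs Eeps2 Mx xlow Meps My lam \<rho>
    by unfold_locales (use \<rho>0 \<rho>1 Meps in \<open>simp_all add: q_def\<close>)
  define Z where "Z = \<rho> * (\<rho> - lam / Eabs * C_min Eabs Ex2 s m p D0) * real s * Ex2"
  have Z: "8 * real p * gap = Z" unfolding Z_def by (rule gap_eq) unfold_locales
  have "0 < Z" unfolding Z_def using \<rho>(1) \<rho>0 s1 E by simp
  then have gap0: "0 < gap" unfolding Z[symmetric] using p_pos by (simp add: zero_less_mult_iff)
  define \<tau> where "\<tau> = gap / My\<^sup>2"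
  \<comment> \<open>The 64 is the square of the 8 in \<open>8 * p * gap\<close>, and
    \<open>p\<close> cancels.\<close>
  have "1000 * (real p)\<^sup>2 * (\<nu> * ln c0 + u) * My ^ 4 / Z\<^sup>2 = (1000/64) * (\<nu> * ln c0 + u) / \<tau>\<^sup>2"
  proof -
    have 1: "Z\<^sup>2 = (real p)\<^sup>2 * (64 * gap\<^sup>2)" unfolding Z[symmetric] by (simp add: power_mult_distrib)
    have 2: "\<tau>\<^sup>2 = gap\<^sup>2 / My ^ 4" unfolding \<tau>_def by (simp add: power_divide)
    have "1000 * (real p)\<^sup>2 * (\<nu> * ln c0 + u) * My ^ 4 / Z\<^sup>2 =
      ((real p)\<^sup>2 * (1000 * (\<nu> * ln c0 + u) * My ^ 4)) / ((real p)\<^sup>2 * (64 * gap\<^sup>2))"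
      unfolding 1 by (simp only: mult_ac)
    also have "\<dots> = 1000 * (\<nu> * ln c0 + u) * My ^ 4 / (64 * gap\<^sup>2)"
      by (rule mult_divide_mult_cancel_left) (use p_pos in simp)
    also have "1000 * x * w / (64 * v) = (1000/64) * x / (v / w)" for v w x :: real by simp
    finally show ?thesis unfolding 2 .
  qed
  then have L': "real L / ln (real L) \<ge> (1000/64) * (\<nu> * ln c0 + u) / \<tau>\<^sup>2"
    using L unfolding Z_def[symmetric] by simp
  \<comment> \<open>Sparsity with \<open>s \<ge> 1\<close> forces at least 16 columns, which keeps
    \<open>c0\<close> at least 3 where it depends on \<open>p\<close> or on
    \<open>r * c\<close>.\<close>
  have p16: "16 \<le> prod_list ps"
    unfolding mp(2)[symmetric]
  proof -
    have "real s / real p * 1 \<le> real s / real p * (spec_norm m p D0 + 1)\<^sup>2"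
      using spec_norm_bound(1)[of m p D0] by (intro mult_left_mono) auto
    then have "real s / real p \<le> 1/16" using sparse' by linarith
    then have "16 * real s \<le> real p" using p_pos by (simp add: field_simps)
    then show "16 \<le> p" using s1 by linarith
  qed
  show ?thesis
  proof (rule constraint_set_cases[OF N ge1 cases[unfolded mp(2)] D0 p16])
    fix r' d :: nat and c' :: real
    assume C: "Cset = cK_set ms ps r' c'" and d: "d = r' * (\<Sum>n<length ms. ms ! n * ps ! n)" "1 \<le> d" "real d \<le> \<nu>"
      and c': "0 < c'" "1 \<le> c' * d" "c' * d \<le> c0 * prod_list ps * \<nu>" "3 \<le> c0"
    have len: "length ps = length ms" using N by simp
    have "Cset = oblique m p \<inter> synth c' r' ms ps ` params r' ms ps"
      unfolding C mp by (rule cK_set_eq[OF c'(1)]) (use N in auto)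
    then show ?thesis
      by (rule high_probability_local_min[OF mp len _ D0 gap0 \<tau>_def d c'[folded mp(2)] u L'])
  qed
qed

text \<open>The constant 1000 serves all instances: divided by the 64 stemming from
  \<open>8 * p * gap\<close> and by the 2 in the Hoeffding exponent, it still exceeds the 7 of the
  net count.\<close>

theorem theorem2:
  shows "\<exists>C>0. \<forall>(N::nat) (ms::nat list) (ps::nat list) (r::nat) (c::real) (Cset::mat set)
      (\<nu>::real) (c0::real) (D0::mat) (s::nat) (\<mu>::sample measure) (\<xi>::real measure)
      (\<eta>::real measure) (Mx::real) (xlow::real) (Meps::real) (My::real) (lam::real)
      (\<rho>::real) (u::real).
    (let m = prod_list ms; p = prod_list ps;
         Ex2 = (\<integral>t. t\<^sup>2 \<partial>\<xi>); Eabs = (\<integral>t. \<bar>t\<bar> \<partial>\<xi>); Eeps2 = (\<integral>t. t\<^sup>2 \<partial>\<eta>);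
         lamb = lam / Eabs;
         Cmin = C_min Eabs Ex2 s m p D0; Cmax = C_max Eabs Mx s m p D0;
         Jev = (\<lambda>S. {\<omega> \<in> space \<mu>. fst \<omega> = S})
     in
    N \<ge> 2 \<and> length ms = N \<and> length ps = N \<and>
    (\<forall>n<N. ms ! n \<ge> 1 \<and> ps ! n \<ge> 1) \<and>
    ((Cset = K_set ms ps 1 \<and> \<nu> = (\<Sum>n<N. real (ms ! n * ps ! n)) \<and> c0 = 3) \<or>
     (N = 2 \<and> Cset = K_set ms ps r \<and>
        \<nu> = 2 * real r * real (ms ! 0 * ps ! 0 + ms ! 1 * ps ! 1 + 1) \<and> c0 = 9 * real p) \<or>
     (c > 0 \<and> Cset = cK_set ms ps r c \<and>
        \<nu> = real r * (\<Sum>n<N. real (ms ! n * ps ! n)) \<and> c0 = real r * c)) \<and>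
    u > 0 \<and> D0 \<in> Cset \<and> 1 \<le> s \<and>
    \<comment> \<open>the generative model: the law \<mu> of one sample (J, x0, eps)\<close>
    prob_space \<mu> \<and> sets \<mu> = sets sample_space \<and>
    (\<forall>S. S \<subseteq> {..<p} \<and> card S = s \<longrightarrow> measure \<mu> (Jev S) = 1 / real (p choose s)) \<and>
    (AE \<omega> in \<mu>. \<forall>j. j \<notin> fst \<omega> \<longrightarrow> fst (snd \<omega>) j = 0) \<and>
    \<comment> \<open>coefficient assumption\<close>
    prob_space \<xi> \<and> sets \<xi> = sets borel \<and> integrable \<xi> (\<lambda>t. t\<^sup>2) \<and> Mx > 0 \<and> xlow > 0 \<and>
    (\<forall>S. S \<subseteq> {..<p} \<and> card S = s \<longrightarrow>
       (\<forall>i\<in>S. \<forall>j\<in>S.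
          cond_exp \<mu> (Jev S) (\<lambda>\<omega>. fst (snd \<omega>) i * fst (snd \<omega>) j) = (if i = j then Ex2 else 0) \<and>
          cond_exp \<mu> (Jev S) (\<lambda>\<omega>. sgn (fst (snd \<omega>) i) * sgn (fst (snd \<omega>) j)) = (if i = j then 1 else 0) \<and>
          cond_exp \<mu> (Jev S) (\<lambda>\<omega>. sgn (fst (snd \<omega>) i) * fst (snd \<omega>) j) = (if i = j then Eabs else 0))) \<and>
    (AE \<omega> in \<mu>. sqrt (\<Sum>j<p. (fst (snd \<omega>) j)\<^sup>2) \<le> Mx) \<and>
    (AE \<omega> in \<mu>. \<forall>j\<in>fst \<omega>. \<bar>fst (snd \<omega>) j\<bar> \<ge> xlow) \<and>
    \<comment> \<open>noise assumption\<close>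
    prob_space \<eta> \<and> sets \<eta> = sets borel \<and> integrable \<eta> (\<lambda>t. t\<^sup>2) \<and> Meps > 0 \<and>
    (\<forall>S. S \<subseteq> {..<p} \<and> card S = s \<longrightarrow>
       (\<forall>i<m. \<forall>k<m. cond_exp \<mu> (Jev S) (\<lambda>\<omega>. snd (snd \<omega>) i * snd (snd \<omega>) k)
                       = (if i = k then Eeps2 else 0)) \<and>
       (\<forall>j<p. \<forall>i<m. cond_exp \<mu> (Jev S) (\<lambda>\<omega>. fst (snd \<omega>) j * snd (snd \<omega>) i) = 0 \<and>
                    cond_exp \<mu> (Jev S) (\<lambda>\<omega>. sgn (fst (snd \<omega>) j) * snd (snd \<omega>) i) = 0)) \<and>
    (AE \<omega> in \<mu>. sqrt (\<Sum>i<m. (snd (snd \<omega>) i)\<^sup>2) \<le> Meps) \<and>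
    My > 0 \<and> (AE \<omega> in \<mu>. sqrt (\<Sum>i<m. (sample_y p D0 \<omega> i)\<^sup>2) \<le> My) \<and>
    \<comment> \<open>parameter assumption\<close>
    lam > 0 \<and> Cmin \<le> Cmax \<and> lam \<le> xlow / 4 \<and>
    real s \<le> real p / (16 * (spec_norm m p D0 + 1)\<^sup>2) \<and>
    cum_coherence m p s D0 \<le> 1/4 \<and>
    Meps / Mx < 7/2 * (Cmax - Cmin) * lamb \<and>
    \<comment> \<open>radius\<close>
    lamb * Cmin < \<rho> \<and> \<rho> < lamb * Cmax \<and> Meps / Mx < 7/2 * (lamb * Cmax - \<rho>)
    \<longrightarrow>
    (\<forall>L::nat. real L / ln (real L) \<ge>
        C * (real p)\<^sup>2 * (\<nu> * ln c0 + u) * My ^ 4 / (\<rho> * (\<rho> - lamb * Cmin) * real s * Ex2)\<^sup>2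
      \<longrightarrow> (\<exists>A \<in> sets (\<Pi>\<^sub>M l\<in>{..<L}. \<mu>).
             measure (\<Pi>\<^sub>M l\<in>{..<L}. \<mu>) A \<ge> 1 - exp (- u) \<and>
             (\<forall>Y\<in>A. \<exists>Dstar. local_min_on m p Cset
                        (emp_risk m p lam L (\<lambda>l. sample_y p D0 (Y l))) Dstar \<and>
                      frob_norm m p (\<lambda>i j. Dstar i j - D0 i j) < \<rho>))))"
proof (intro exI[of _ "1000 :: real"] conjI allI, goal_cases)
  case 1
  show ?case by simp
next
  case (2 N ms ps r c Cset \<nu> c0 D0 s \<mu> \<xi> \<eta> Mx xlow Meps My lam \<rho> u)
  show ?case
    unfolding Let_def
  proof (intro impI allI, elim conjE, goal_cases)
    case (1 L)
    note h = 1
    have D0: "D0 \<in> oblique (prod_list ms) (prod_list ps)"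
      using h(6,8) unfolding K_set_def cK_set_def by blast
    have model: "dict_model \<mu> (prod_list ms) (prod_list ps) s D0 (\<integral>t. t\<^sup>2 \<partial>\<xi>) (\<integral>t. \<bar>t\<bar> \<partial>\<xi>) (\<integral>t. t\<^sup>2 \<partial>\<eta>) Mx xlow Meps My lam"
    proof (rule dict_model.intro[OF h(10)], rule dict_model_axioms.intro)
      note supp = h(12)[rule_format, OF conjI] and mom = h(19)[rule_format, OF conjI] and noise = h(26)[rule_format, OF conjI]
      let ?E = "\<lambda>S. cond_exp \<mu> {\<omega> \<in> space \<mu>. fst \<omega> = S}"
      fix S i j assume S: "S \<subseteq> {..<prod_list ps}" "card S = s"
      show "measure \<mu> {\<omega> \<in> space \<mu>. fst \<omega> = S} = 1 / real (prod_list ps choose s)" by (rule supp[OF S])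
      {
        assume ij: "i \<in> S" "j \<in> S"
        note m = mom[OF S ij]
        show "?E S (\<lambda>\<omega>. fst (snd \<omega>) i * fst (snd \<omega>) j) = (if i = j then \<integral>t. t\<^sup>2 \<partial>\<xi> else 0)"
          by (rule m[THEN conjunct1])
        show "?E S (\<lambda>\<omega>. sgn (fst (snd \<omega>) i) * sgn (fst (snd \<omega>) j)) = (if i = j then 1 else 0)"
          by (rule m[THEN conjunct2, THEN conjunct1])
        show "?E S (\<lambda>\<omega>. sgn (fst (snd \<omega>) i) * fst (snd \<omega>) j) = (if i = j then \<integral>t. \<bar>t\<bar> \<partial>\<xi> else 0)"
          by (rule m[THEN conjunct2, THEN conjunct2])
      next
        assume ij: "i < prod_list ms" "j < prod_list ms"
        show "?E S (\<lambda>\<omega>. snd (snd \<omega>) i * snd (snd \<omega>) j) = (if i = j then \<integral>t. t\<^sup>2 \<partial>\<eta> else 0)"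
          by (rule noise[OF S, THEN conjunct1, rule_format, OF ij])
      next
        assume ij: "j < prod_list ps" "i < prod_list ms"
        note n = noise[OF S, THEN conjunct2, rule_format, OF ij]
        show "?E S (\<lambda>\<omega>. fst (snd \<omega>) j * snd (snd \<omega>) i) = 0" by (rule n[THEN conjunct1])
        show "?E S (\<lambda>\<omega>. sgn (fst (snd \<omega>) j) * snd (snd \<omega>) i) = 0" by (rule n[THEN conjunct2])
      }
    next
      show "0 \<le> (\<integral>t. t\<^sup>2 \<partial>\<eta>)" by (rule integral_nonneg_AE) simp
    qed (rule D0 h(9) h(11) h(13) h(17) h(18) h(20) h(21) h(25) h(27) h(28) h(29) h(30) h(32) h(33) h(34))+
    show ?case
      by (rule dict_model.local_min_of_sample_size[OF model refl refl h(2,3,4,5,6,8,7) h(36,37,38) h(1)])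
  qed
qed

end
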